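(* Let $G$ be a finite group and $p$ a prime with $p \mid |G|$ and $p^2 \nmid |G|$. Let $\mathcal{E}$ be the set of equivalence classes of the relation $\sim_p$ on $\operatorname{ccs}(G)$, and let $E_1, \ldots, E_q$ be the equivalence classes of cardinality $2$. For a subgroup $H \subset G$ and $l \geq 1$, write $M_{H,l}$ for the $p$-part of $\operatorname{Ext}^l_{A(G)}(\mathbb{Z}_H, \mathbb{Z}_H)$; for a subgroup $J \subset G$ not conjugate to $H$ and $l \geq 1$, write $N_{H,J,l}$ for the $p$-part of $\operatorname{Ext}^l_{A(G)}(\mathbb{Z}_H, \mathbb{Z}_J)$. Then: (i) each $E \in \mathcal{E}$ has cardinality $\leq 2$; (ii) $M_{H,l}$ is non-zero for some $l \geq 1$ if and only if $(H) \in E_i$ for some $1 \leq i \leq q$; (iii) $N_{H,J,l}$ is non-zero for some $l \geq 1$ if and only if $\{(H),(J)\} = E_i$ for some $1 \leq i \leq q$; (iv) if $(H) \in E_i$ for some $1 \leq i \leq q$, then for all $l \geq 1$ \[ M_{H,l} \simeq \begin{cases} 0 & \text{if } l \text{ is odd} \\ \mathbb{Z}/p\mathbb{Z} & \text{if } l \text{ is even;}\end{cases} \] (v) if $\{(H),(J)\} = E_i$ for some $1 \leq i \leq q$, then for all $l \geq 1$ \[ N_{H,J,l} \simeq \begin{cases} \mathbb{Z}/p\mathbb{Z} & \text{if } l \text{ is odd} \\ 0 & \text{if } l \text{ is even.}\end{cases} \]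
   Context: For a finite group $G$, the Burnside ring $A(G)$ is the Grothendieck ring of the commutative semi-ring of isomorphism classes of finite $G$-sets, with addition given by disjoint union and multiplication by cartesian product; $[X]$ denotes the class of a finite $G$-set $X$. For a subgroup $H \subset G$, the mark homomorphism $\pi_H : A(G) \to \mathbb{Z}$ is the ring homomorphism determined by $\pi_H([X]) = |X^H|$, where $X^H$ is the set of $H$-fixed points of the finite $G$-set $X$; it depends only on the conjugacy class of $H$. $\mathbb{Z}_H$ denotes the $A(G)$-module with underlying abelian group $\mathbb{Z}$ and action $a\cdot n = \pi_H(a)n$. $\operatorname{ccs}(G)$ is the set of conjugacy classes of subgroups of $G$, and $(H)$ is the conjugacy class of $H$. For non-conjugate subgroups $H, J$, $d(H,J)$ is the greatest positive integer such that $\pi_H(a) \equiv \pi_J(a) \bmod d(H,J)$ for all $a \in A(G)$. The equivalence relation $\sim_p$ on $\operatorname{ccs}(G)$ is defined by: $(H) \sim_p (J)$ if and only if $(H) = (J)$, or $(H) \neq (J)$ and $p \mid d(H,J)$. For $l\geq 1$ the groups $\operatorname{Ext}^l_{A(G)}(\mathbb{Z}_H,\mathbb{Z}_J)$ are finite; the $p$-part of such a group is the submodule of elements annihilated by some power of $p$. *)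

theory Defs
  imports "HOL-Algebra.Group_Action" "HOL-Algebra.AbelCoset" "HOL-Algebra.Module" "HOL-Algebra.Elementary_Groups"
    "HOL-Number_Theory.Cong" "HOL-Library.Nat_Bijection"
begin

section \<open>The Burnside ring\<close>

text \<open>
  A \<open>G\<close>-set is a pair of a carrier and an action in the sense of \<^locale>\<open>group_action\<close>. Every finite
  \<open>G\<close>-set is isomorphic to one whose carrier is a set of natural numbers, so isomorphism classes of
  \<open>G\<close>-sets over \<^typ>\<open>nat\<close> represent all isomorphism classes of finite \<open>G\<close>-sets.
\<close>

type_synonym 'g gset = "nat set \<times> ('g \<Rightarrow> nat \<Rightarrow> nat)"

definition finite_gset :: "('g, 'a) monoid_scheme \<Rightarrow> 'g gset \<Rightarrow> bool" where
  "finite_gset G U \<longleftrightarrow> finite (fst U) \<and> group_action G (fst U) (snd U)"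

definition gset_iso :: "('g, 'a) monoid_scheme \<Rightarrow> ('g gset \<times> 'g gset) set" where
  "gset_iso G = {(U, V). finite_gset G U \<and> finite_gset G V \<and>
     (\<exists>f. bij_betw f (fst U) (fst V) \<and>
          (\<forall>g\<in>carrier G. \<forall>x\<in>fst U. f (snd U g x) = snd V g (f x)))}"

definition gset_class :: "('g, 'a) monoid_scheme \<Rightarrow> 'g gset \<Rightarrow> 'g gset set" where
  "gset_class G U = gset_iso G `` {U}"

definition gset_sum :: "'g gset \<Rightarrow> 'g gset \<Rightarrow> 'g gset" where
  "gset_sum U V =
     (sum_encode ` Sum_Type.Plus (fst U) (fst V),
      \<lambda>g. \<lambda>n\<in>sum_encode ` Sum_Type.Plus (fst U) (fst V).
        sum_encode (map_sum (snd U g) (snd V g) (sum_decode n)))"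

definition gset_prod :: "'g gset \<Rightarrow> 'g gset \<Rightarrow> 'g gset" where
  "gset_prod U V =
     (prod_encode ` (fst U \<times> fst V),
      \<lambda>g. \<lambda>n\<in>prod_encode ` (fst U \<times> fst V).
        prod_encode (map_prod (snd U g) (snd V g) (prod_decode n)))"

definition trivial_gset :: "nat set \<Rightarrow> 'g gset" where
  "trivial_gset E = (E, \<lambda>g. \<lambda>x\<in>E. x)"

definition gset_semiring :: "('g, 'a) monoid_scheme \<Rightarrow> 'g gset set ring" where
  "gset_semiring G =
     \<lparr>carrier = {U. finite_gset G U} // gset_iso G,
      monoid.mult = (\<lambda>A B. \<Union>U\<in>A. \<Union>V\<in>B. gset_class G (gset_prod U V)),
      one = gset_class G (trivial_gset {0}),
      zero = gset_class G (trivial_gset {}),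
      add = (\<lambda>A B. \<Union>U\<in>A. \<Union>V\<in>B. gset_class G (gset_sum U V))\<rparr>"

text \<open>The pair \<open>(a, b)\<close> stands for the formal difference of \<open>a\<close> and \<open>b\<close>.\<close>

definition groth_rel :: "('s, 'b) ring_scheme \<Rightarrow> (('s \<times> 's) \<times> ('s \<times> 's)) set" where
  "groth_rel S = {((a, b), (c, d)). a \<in> carrier S \<and> b \<in> carrier S \<and> c \<in> carrier S \<and> d \<in> carrier S \<and>
     (\<exists>k\<in>carrier S. a \<oplus>\<^bsub>S\<^esub> d \<oplus>\<^bsub>S\<^esub> k = c \<oplus>\<^bsub>S\<^esub> b \<oplus>\<^bsub>S\<^esub> k)}"

definition groth_class :: "('s, 'b) ring_scheme \<Rightarrow> 's \<Rightarrow> 's \<Rightarrow> ('s \<times> 's) set" where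
  "groth_class S a b = groth_rel S `` {(a, b)}"

definition grothendieck_ring :: "('s, 'b) ring_scheme \<Rightarrow> ('s \<times> 's) set ring" where
  "grothendieck_ring S =
     \<lparr>carrier = (carrier S \<times> carrier S) // groth_rel S,
      monoid.mult = (\<lambda>A B. \<Union>(a, b)\<in>A. \<Union>(c, d)\<in>B.
        groth_class S (a \<otimes>\<^bsub>S\<^esub> c \<oplus>\<^bsub>S\<^esub> b \<otimes>\<^bsub>S\<^esub> d) (a \<otimes>\<^bsub>S\<^esub> d \<oplus>\<^bsub>S\<^esub> b \<otimes>\<^bsub>S\<^esub> c)),
      one = groth_class S \<one>\<^bsub>S\<^esub> \<zero>\<^bsub>S\<^esub>,
      zero = groth_class S \<zero>\<^bsub>S\<^esub> \<zero>\<^bsub>S\<^esub>,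
      add = (\<lambda>A B. \<Union>(a, b)\<in>A. \<Union>(c, d)\<in>B.
        groth_class S (a \<oplus>\<^bsub>S\<^esub> c) (b \<oplus>\<^bsub>S\<^esub> d))\<rparr>"

type_synonym 'g burnside = "('g gset set \<times> 'g gset set) set"

definition burnside_ring :: "('g, 'a) monoid_scheme \<Rightarrow> 'g burnside ring" where
  "burnside_ring G = grothendieck_ring (gset_semiring G)"

definition burnside_class :: "('g, 'a) monoid_scheme \<Rightarrow> 'g gset \<Rightarrow> 'g burnside" where
  "burnside_class G U = groth_class (gset_semiring G) (gset_class G U) \<zero>\<^bsub>gset_semiring G\<^esub>"

definition fixed_points :: "'g set \<Rightarrow> 'g gset \<Rightarrow> nat set" where
  "fixed_points H U = {x \<in> fst U. \<forall>h\<in>H. snd U h x = x}"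

definition mark :: "('g, 'a) monoid_scheme \<Rightarrow> 'g set \<Rightarrow> 'g burnside \<Rightarrow> int" where
  "mark G H a = (THE n. \<exists>U V. finite_gset G U \<and> finite_gset G V \<and>
     a = burnside_class G U \<ominus>\<^bsub>burnside_ring G\<^esub> burnside_class G V \<and>
     n = int (card (fixed_points H U)) - int (card (fixed_points H V)))"

definition mark_module :: "('g, 'a) monoid_scheme \<Rightarrow> 'g set \<Rightarrow> ('g burnside, int) module" where
  "mark_module G H = \<lparr>carrier = UNIV, monoid.mult = (*), one = 1, zero = 0, add = (+),
     smult = (\<lambda>a n. mark G H a * n)\<rparr>"

section \<open>Conjugacy classes of subgroups\<close>

definition conj_class :: "('g, 'a) monoid_scheme \<Rightarrow> 'g set \<Rightarrow> 'g set set" where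
  "conj_class G H = {g <#\<^bsub>G\<^esub> H #>\<^bsub>G\<^esub> inv\<^bsub>G\<^esub> g | g. g \<in> carrier G}"

definition ccs :: "('g, 'a) monoid_scheme \<Rightarrow> 'g set set set" where
  "ccs G = conj_class G ` {H. subgroup H G}"

text \<open>The modulus is only meaningful for non-conjugate subgroups; for conjugate ones no greatest
  \<open>d\<close> exists.\<close>

definition mark_modulus :: "('g, 'a) monoid_scheme \<Rightarrow> 'g set \<Rightarrow> 'g set \<Rightarrow> nat" where
  "mark_modulus G H J = (GREATEST d. d > 0 \<and>
     (\<forall>a\<in>carrier (burnside_ring G). [mark G H a = mark G J a] (mod int d)))"

definition p_rel :: "('g, 'a) monoid_scheme \<Rightarrow> nat \<Rightarrow> ('g set set \<times> 'g set set) set" where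
  "p_rel G p = {(conj_class G H, conj_class G J) | H J. subgroup H G \<and> subgroup J G \<and>
     (conj_class G H = conj_class G J \<or>
      conj_class G H \<noteq> conj_class G J \<and> p dvd mark_modulus G H J)}"

section \<open>Ext modules\<close>

text \<open>
  Records of type \<^typ>\<open>('r, 'm) module\<close> inherit the ring fields \<^const>\<open>monoid.mult\<close> and \<^const>\<open>one\<close>, which
  play no role for modules and are left unspecified below.
\<close>

definition lin_maps :: "('r, 'a) ring_scheme \<Rightarrow> ('r, 'm, 'b) module_scheme \<Rightarrow>
    ('r, 'n, 'c) module_scheme \<Rightarrow> ('m \<Rightarrow> 'n) set" where
  "lin_maps R M N = {f \<in> carrier M \<rightarrow>\<^sub>E carrier N.
     (\<forall>x\<in>carrier M. \<forall>y\<in>carrier M. f (x \<oplus>\<^bsub>M\<^esub> y) = f x \<oplus>\<^bsub>N\<^esub> f y) \<and>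
     (\<forall>r\<in>carrier R. \<forall>x\<in>carrier M. f (r \<odot>\<^bsub>M\<^esub> x) = r \<odot>\<^bsub>N\<^esub> f x)}"

definition hom_module :: "('r, 'a) ring_scheme \<Rightarrow> ('r, 'm, 'b) module_scheme \<Rightarrow>
    ('r, 'n, 'c) module_scheme \<Rightarrow> ('r, 'm \<Rightarrow> 'n) module" where
  "hom_module R M N = \<lparr>carrier = lin_maps R M N, monoid.mult = undefined, one = undefined,
     zero = (\<lambda>x\<in>carrier M. \<zero>\<^bsub>N\<^esub>),
     add = (\<lambda>f g. \<lambda>x\<in>carrier M. f x \<oplus>\<^bsub>N\<^esub> g x),
     smult = (\<lambda>r f. \<lambda>x\<in>carrier M. r \<odot>\<^bsub>N\<^esub> f x)\<rparr>"

definition quot_module :: "('r, 'm, 'b) module_scheme \<Rightarrow> 'm set \<Rightarrow> ('r, 'm set) module" where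
  "quot_module M S = \<lparr>carrier = a_rcosets\<^bsub>M\<^esub> S, monoid.mult = undefined, one = undefined,
     zero = S, add = (<+>\<^bsub>M\<^esub>), smult = (\<lambda>r C. \<Union>x\<in>C. S +>\<^bsub>M\<^esub> (r \<odot>\<^bsub>M\<^esub> x))\<rparr>"

definition free_module :: "('r, 'a) ring_scheme \<Rightarrow> 'b set \<Rightarrow> ('r, 'b \<Rightarrow> 'r) module" where
  "free_module R B = \<lparr>carrier = {f. finite {b. f b \<noteq> \<zero>\<^bsub>R\<^esub>} \<and> (\<forall>b\<in>B. f b \<in> carrier R) \<and>
       (\<forall>b. b \<notin> B \<longrightarrow> f b = \<zero>\<^bsub>R\<^esub>)},
     monoid.mult = undefined, one = undefined,
     zero = (\<lambda>b. \<zero>\<^bsub>R\<^esub>),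
     add = (\<lambda>f g b. f b \<oplus>\<^bsub>R\<^esub> g b),
     smult = (\<lambda>r f b. r \<otimes>\<^bsub>R\<^esub> f b)\<rparr>"

text \<open>The linear map on a free module that sends the basis element \<open>b\<close> to \<open>v b\<close>.\<close>

definition lin_ext :: "('r, 'a) ring_scheme \<Rightarrow> ('r, 'm, 'c) module_scheme \<Rightarrow> ('b \<Rightarrow> 'm) \<Rightarrow>
    ('b \<Rightarrow> 'r) \<Rightarrow> 'm" where
  "lin_ext R M v f = (\<Oplus>\<^bsub>M\<^esub>b\<in>{b. f b \<noteq> \<zero>\<^bsub>R\<^esub>}. f b \<odot>\<^bsub>M\<^esub> v b)"

text \<open>
  \<open>Ext\<close> is computed from a canonical free resolution \<open>\<dots> \<rightarrow> P\<^sub>1 \<rightarrow> P\<^sub>0 \<rightarrow> M\<close>. The module \<open>P\<^sub>0\<close> is free on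
  the elements of \<open>M\<close>, and \<open>P\<^sub>n\<^sub>+\<^sub>1\<close> is free on all formal linear combinations of generators of \<open>P\<^sub>n\<close>
  that evaluate to an element of the kernel of the previous map. Writing formal combinations as lists
  keeps the generators of all degrees in a single type.
\<close>

datatype ('r, 'm) gen = Elt 'm | Syz "('r \<times> ('r, 'm) gen) list"

definition formal_comb :: "('r, 'a) ring_scheme \<Rightarrow> ('r \<times> 'b) list \<Rightarrow> 'b \<Rightarrow> 'r" where
  "formal_comb R xs = foldr (\<lambda>(r, b) f. f(b := r \<oplus>\<^bsub>R\<^esub> f b)) xs (\<lambda>b. \<zero>\<^bsub>R\<^esub>)"

definition res_aug :: "('r, 'a) ring_scheme \<Rightarrow> ('r, 'm, 'c) module_scheme \<Rightarrow>
    (('r, 'm) gen \<Rightarrow> 'r) \<Rightarrow> 'm" where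
  "res_aug R M = lin_ext R M (\<lambda>b. case b of Elt m \<Rightarrow> m | Syz xs \<Rightarrow> \<zero>\<^bsub>M\<^esub>)"

definition res_bd :: "('r, 'a) ring_scheme \<Rightarrow> (('r, 'm) gen \<Rightarrow> 'r) \<Rightarrow> ('r, 'm) gen \<Rightarrow> 'r" where
  "res_bd R = lin_ext R (free_module R UNIV)
     (\<lambda>b. case b of Elt m \<Rightarrow> (\<lambda>_. \<zero>\<^bsub>R\<^esub>) | Syz xs \<Rightarrow> formal_comb R xs)"

primrec res_gens :: "('r, 'a) ring_scheme \<Rightarrow> ('r, 'm, 'c) module_scheme \<Rightarrow> nat \<Rightarrow>
    ('r, 'm) gen set" where
  "res_gens R M 0 = Elt ` carrier M"
| "res_gens R M (Suc n) = Syz ` {xs. set xs \<subseteq> carrier R \<times> res_gens R M n \<and>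
     (if n = 0 then res_aug R M (formal_comb R xs) = \<zero>\<^bsub>M\<^esub>
      else res_bd R (formal_comb R xs) = (\<lambda>_. \<zero>\<^bsub>R\<^esub>))}"

definition res_module :: "('r, 'a) ring_scheme \<Rightarrow> ('r, 'm, 'c) module_scheme \<Rightarrow> nat \<Rightarrow>
    ('r, ('r, 'm) gen \<Rightarrow> 'r) module" where
  "res_module R M n = free_module R (res_gens R M n)"

text \<open>
  The degree \<open>l\<close> cohomology of \<open>Hom(P, N)\<close> for a chain complex \<open>P\<close> with differentials
  \<open>d l : P (Suc l) \<rightarrow> P l\<close>.
\<close>

definition hom_cohomology :: "('r, 'a) ring_scheme \<Rightarrow> (nat \<Rightarrow> ('r, 'm, 'b) module_scheme) \<Rightarrow>
    (nat \<Rightarrow> 'm \<Rightarrow> 'm) \<Rightarrow> ('r, 'n, 'c) module_scheme \<Rightarrow> nat \<Rightarrow> ('r, ('m \<Rightarrow> 'n) set) module" where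
  "hom_cohomology R P d N l = quot_module
     ((hom_module R (P l) N)\<lparr>carrier :=
        {f \<in> lin_maps R (P l) N. \<forall>x\<in>carrier (P (Suc l)). f (d l x) = \<zero>\<^bsub>N\<^esub>}\<rparr>)
     (case l of 0 \<Rightarrow> {\<zero>\<^bsub>hom_module R (P 0) N\<^esub>}
      | Suc k \<Rightarrow> (\<lambda>g. \<lambda>x\<in>carrier (P (Suc k)). g (d k x)) ` lin_maps R (P k) N)"

definition Ext :: "('r, 'a) ring_scheme \<Rightarrow> nat \<Rightarrow> ('r, 'm, 'b) module_scheme \<Rightarrow>
    ('r, 'n, 'c) module_scheme \<Rightarrow> ('r, ((('r, 'm) gen \<Rightarrow> 'r) \<Rightarrow> 'n) set) module" where
  "Ext R l M N = hom_cohomology R (res_module R M) (\<lambda>_. res_bd R) N l"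

definition p_part :: "nat \<Rightarrow> ('r, 'm, 'b) module_scheme \<Rightarrow> ('r, 'm, 'b) module_scheme" where
  "p_part p M = M\<lparr>carrier := {x \<in> carrier M. \<exists>k::nat. add_pow M (p ^ k) x = \<zero>\<^bsub>M\<^esub>}\<rparr>"

definition mark_Ext :: "('g, 'a) monoid_scheme \<Rightarrow> nat \<Rightarrow> 'g set \<Rightarrow> 'g set \<Rightarrow> nat \<Rightarrow>
    ('g burnside, ((('g burnside, int) gen \<Rightarrow> 'g burnside) \<Rightarrow> int) set) module" where
  "mark_Ext G p H J l = p_part p (Ext (burnside_ring G) l (mark_module G H) (mark_module G J))"

section \<open>The Burnside ring is a commutative ring\<close>

context group begin

lemma finite_gsetI:
  assumes "finite E" "\<And>g. g \<in> carrier G \<Longrightarrow> \<phi> g \<in> extensional E"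
    "\<And>g x. g \<in> carrier G \<Longrightarrow> x \<in> E \<Longrightarrow> \<phi> g x \<in> E"
    "\<And>x. x \<in> E \<Longrightarrow> \<phi> \<one> x = x"
    "\<And>g h x. g \<in> carrier G \<Longrightarrow> h \<in> carrier G \<Longrightarrow> x \<in> E \<Longrightarrow> \<phi> (g \<otimes> h) x = \<phi> g (\<phi> h x)"
  shows "finite_gset G (E, \<phi>)"
proof -
  have bij: "\<phi> g \<in> Bij E" if g: "g \<in> carrier G" for g
  proof -
    have "\<phi> g (\<phi> (inv g) x) = x" "\<phi> (inv g) (\<phi> g x) = x" if "x \<in> E" for x
      using assms(4)[OF that] assms(5)[OF g inv_closed[OF g] that]
        assms(5)[OF inv_closed[OF g] g that] g by auto
    hence "bij_betw (\<phi> g) E E"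
      by (intro bij_betw_byWitness[where f' = "\<phi> (inv g)"]) (use assms(3) g in auto)
    thus ?thesis using assms(2)[OF g] by (simp add: Bij_def)
  qed
  have "\<phi> \<in> hom G (BijGroup E)"
    using bij assms(2,5)
    by (auto simp: hom_def BijGroup_def intro!: extensionalityI[where A = E] compose_extensional
        simp: compose_eq)
  hence "group_action G E \<phi>"
    by (simp add: group_action_def group_hom_def group_hom_axioms_def group_BijGroup is_group)
  thus ?thesis using assms(1) by (simp add: finite_gset_def)
qed

lemma finite_gsetD:
  assumes "finite_gset G U"
  shows "finite (fst U)"
    "g \<in> carrier G \<Longrightarrow> snd U g \<in> extensional (fst U)"
    "g \<in> carrier G \<Longrightarrow> x \<in> fst U \<Longrightarrow> snd U g x \<in> fst U"
    "x \<in> fst U \<Longrightarrow> snd U \<one> x = x"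
    "g \<in> carrier G \<Longrightarrow> h \<in> carrier G \<Longrightarrow> x \<in> fst U \<Longrightarrow> snd U (g \<otimes> h) x = snd U g (snd U h x)"
proof -
  interpret group_action G "fst U" "snd U" using assms by (simp add: finite_gset_def)
  show "finite (fst U)" using assms by (simp add: finite_gset_def)
  show "g \<in> carrier G \<Longrightarrow> snd U g \<in> extensional (fst U)" using bij_prop0 by (simp add: Bij_def)
  show "g \<in> carrier G \<Longrightarrow> x \<in> fst U \<Longrightarrow> snd U g x \<in> fst U" using element_image by blast
  show "x \<in> fst U \<Longrightarrow> snd U \<one> x = x" using id_eq_one by (metis restrict_apply')
  show "g \<in> carrier G \<Longrightarrow> h \<in> carrier G \<Longrightarrow> x \<in> fst U \<Longrightarrow> snd U (g \<otimes> h) x = snd U g (snd U h x)"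
    using composition_rule by blast
qed

lemma gset_isoI:
  assumes "finite_gset G U" "finite_gset G V" "bij_betw f (fst U) (fst V)"
    "\<And>g x. g \<in> carrier G \<Longrightarrow> x \<in> fst U \<Longrightarrow> f (snd U g x) = snd V g (f x)"
  shows "(U, V) \<in> gset_iso G"
  using assms unfolding gset_iso_def by blast

lemma equiv_gset_iso: "equiv {U. finite_gset G U} (gset_iso G)"
proof (rule equivI)
  show "gset_iso G \<subseteq> {U. finite_gset G U} \<times> {U. finite_gset G U}"
    by (auto simp: gset_iso_def)
  show "refl_on {U. finite_gset G U} (gset_iso G)"
    by (auto simp: refl_on_def gset_iso_def intro!: exI[of _ id])
  show "sym (gset_iso G)"
  proof (rule symI, clarsimp simp: gset_iso_def)
    fix E \<phi> F \<psi> f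
    assume U: "finite_gset G (E, \<phi>)" and f: "bij_betw f E F"
      and eq: "\<forall>g\<in>carrier G. \<forall>x\<in>E. f (\<phi> g x) = \<psi> g (f x)"
    have "inv_into E f (\<psi> g y) = \<phi> g (inv_into E f y)" if g: "g \<in> carrier G" and y: "y \<in> F" for g y
    proof -
      obtain x where x: "x \<in> E" "y = f x" using f y by (auto simp: bij_betw_def)
      hence "\<psi> g y = f (\<phi> g x)" "\<phi> g x \<in> E" using eq g finite_gsetD(3)[OF U] by auto
      thus ?thesis using x f by (simp add: bij_betw_inv_into_left)
    qed
    thus "\<exists>f. bij_betw f F E \<and> (\<forall>g\<in>carrier G. \<forall>x\<in>F. f (\<psi> g x) = \<phi> g (f x))"
      using bij_betw_inv_into[OF f] by blast
  qed
  show "trans (gset_iso G)"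
  proof (rule transI, clarsimp simp: gset_iso_def)
    fix E \<phi> F \<psi> D \<chi> f h
    assume "bij_betw f E F" "bij_betw h F D"
      and "\<forall>g\<in>carrier G. \<forall>x\<in>E. f (\<phi> g x) = \<psi> g (f x)"
      and "\<forall>g\<in>carrier G. \<forall>x\<in>F. h (\<psi> g x) = \<chi> g (h x)"
    thus "\<exists>f. bij_betw f E D \<and> (\<forall>g\<in>carrier G. \<forall>x\<in>E. f (\<phi> g x) = \<chi> g (f x))"
      by (intro exI[of _ "h \<circ> f"]) (auto simp: bij_betw_trans bij_betwE)
  qed
qed

lemma gset_class_eq_iff:
  assumes "finite_gset G U" "finite_gset G V"
  shows "gset_class G U = gset_class G V \<longleftrightarrow> (U, V) \<in> gset_iso G"
  using assms eq_equiv_class_iff[OF equiv_gset_iso] by (simp add: gset_class_def)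

lemma fst_gset_sum: "fst (gset_sum U V) = sum_encode ` Sum_Type.Plus (fst U) (fst V)"
  by (simp add: gset_sum_def)

lemma snd_gset_sum [simp]:
  "x \<in> fst U \<Longrightarrow> snd (gset_sum U V) g (sum_encode (Inl x)) = sum_encode (Inl (snd U g x))"
  "y \<in> fst V \<Longrightarrow> snd (gset_sum U V) g (sum_encode (Inr y)) = sum_encode (Inr (snd V g y))"
  by (auto simp: gset_sum_def)

lemma fst_gset_prod: "fst (gset_prod U V) = prod_encode ` (fst U \<times> fst V)"
  by (simp add: gset_prod_def)

lemma snd_gset_prod [simp]:
  "x \<in> fst U \<Longrightarrow> y \<in> fst V \<Longrightarrow>
   snd (gset_prod U V) g (prod_encode (x, y)) = prod_encode (snd U g x, snd V g y)"
  by (auto simp: gset_prod_def)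

lemma finite_gset_sum:
  assumes "finite_gset G U" "finite_gset G V"
  shows "finite_gset G (gset_sum U V)"
proof -
  have *: "snd (gset_sum U V) g \<in> extensional (fst (gset_sum U V))" for g
    by (auto simp: gset_sum_def)
  have "finite_gset G (fst (gset_sum U V), snd (gset_sum U V))"
    by (rule finite_gsetI[OF _ *]) (auto simp: fst_gset_sum finite_gsetD[OF assms(1)] finite_gsetD[OF assms(2)])
  thus ?thesis by simp
qed

lemma finite_gset_prod:
  assumes "finite_gset G U" "finite_gset G V"
  shows "finite_gset G (gset_prod U V)"
proof -
  have *: "snd (gset_prod U V) g \<in> extensional (fst (gset_prod U V))" for g
    by (auto simp: gset_prod_def)
  have "finite_gset G (fst (gset_prod U V), snd (gset_prod U V))"
    by (rule finite_gsetI[OF _ *]) (auto simp: fst_gset_prod finite_gsetD[OF assms(1)] finite_gsetD[OF assms(2)])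
  thus ?thesis by simp
qed

lemma finite_gset_trivial: "finite E \<Longrightarrow> finite_gset G (trivial_gset E)"
  unfolding trivial_gset_def by (rule finite_gsetI) auto

lemma trivial_gset_simps [simp]:
  "fst (trivial_gset E) = E" "x \<in> E \<Longrightarrow> snd (trivial_gset E) g x = x"
  by (simp_all add: trivial_gset_def)

lemmas finite_gset_intros = finite_gset_sum finite_gset_prod finite_gset_trivial

lemma gset_isoI2:
  assumes "finite_gset G U" "finite_gset G V"
    "\<And>x. x \<in> fst U \<Longrightarrow> f x \<in> fst V \<and> f' (f x) = x"
    "\<And>y. y \<in> fst V \<Longrightarrow> f' y \<in> fst U \<and> f (f' y) = y"
    "\<And>g x. g \<in> carrier G \<Longrightarrow> x \<in> fst U \<Longrightarrow> f (snd U g x) = snd V g (f x)"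
  shows "(U, V) \<in> gset_iso G"
proof (rule gset_isoI[OF assms(1,2) _ assms(5)])
  show "bij_betw f (fst U) (fst V)"
    using assms(3,4) by (intro bij_betw_byWitness[where f' = f']) auto
qed auto

lemma gset_isoE:
  assumes "(U, V) \<in> gset_iso G"
  obtains f f' where "\<And>x. x \<in> fst U \<Longrightarrow> f x \<in> fst V \<and> f' (f x) = x"
    "\<And>y. y \<in> fst V \<Longrightarrow> f' y \<in> fst U \<and> f (f' y) = y"
    "\<And>g x. g \<in> carrier G \<Longrightarrow> x \<in> fst U \<Longrightarrow> f (snd U g x) = snd V g (f x)"
    "finite_gset G U" "finite_gset G V"
proof -
  obtain f where f: "bij_betw f (fst U) (fst V)"
    "\<forall>g\<in>carrier G. \<forall>x\<in>fst U. f (snd U g x) = snd V g (f x)"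
    using assms by (auto simp: gset_iso_def)
  show thesis
  proof (rule that[of f "inv_into (fst U) f"])
    show "f x \<in> fst V \<and> inv_into (fst U) f (f x) = x" if "x \<in> fst U" for x
      using f(1) that by (simp add: bij_betw_inv_into_left bij_betwE)
    show "inv_into (fst U) f y \<in> fst U \<and> f (inv_into (fst U) f y) = y" if "y \<in> fst V" for y
      using f(1) that by (metis bij_betw_imp_surj_on bij_betw_inv_into_right inv_into_into)
  qed (use f assms in \<open>auto simp: gset_iso_def\<close>)
qed

lemma gset_sum_cong:
  assumes "(U, U') \<in> gset_iso G" "(V, V') \<in> gset_iso G"
  shows "(gset_sum U V, gset_sum U' V') \<in> gset_iso G"
proof -
  obtain f f' where f: "\<And>x. x \<in> fst U \<Longrightarrow> f x \<in> fst U' \<and> f' (f x) = x"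
    "\<And>y. y \<in> fst U' \<Longrightarrow> f' y \<in> fst U \<and> f (f' y) = y"
    "\<And>g x. g \<in> carrier G \<Longrightarrow> x \<in> fst U \<Longrightarrow> f (snd U g x) = snd U' g (f x)"
    "finite_gset G U" "finite_gset G U'" by (rule gset_isoE[OF assms(1)]) blast
  obtain h h' where h: "\<And>x. x \<in> fst V \<Longrightarrow> h x \<in> fst V' \<and> h' (h x) = x"
    "\<And>y. y \<in> fst V' \<Longrightarrow> h' y \<in> fst V \<and> h (h' y) = y"
    "\<And>g x. g \<in> carrier G \<Longrightarrow> x \<in> fst V \<Longrightarrow> h (snd V g x) = snd V' g (h x)"
    "finite_gset G V" "finite_gset G V'" by (rule gset_isoE[OF assms(2)]) blast
  show ?thesis
    by (rule gset_isoI2[where f = "\<lambda>n. sum_encode (map_sum f h (sum_decode n))"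
          and f' = "\<lambda>n. sum_encode (map_sum f' h' (sum_decode n))"])
      (use f h in \<open>auto intro: finite_gset_intros simp: fst_gset_sum finite_gsetD(3)\<close>)
qed

lemma gset_prod_cong:
  assumes "(U, U') \<in> gset_iso G" "(V, V') \<in> gset_iso G"
  shows "(gset_prod U V, gset_prod U' V') \<in> gset_iso G"
proof -
  obtain f f' where f: "\<And>x. x \<in> fst U \<Longrightarrow> f x \<in> fst U' \<and> f' (f x) = x"
    "\<And>y. y \<in> fst U' \<Longrightarrow> f' y \<in> fst U \<and> f (f' y) = y"
    "\<And>g x. g \<in> carrier G \<Longrightarrow> x \<in> fst U \<Longrightarrow> f (snd U g x) = snd U' g (f x)"
    "finite_gset G U" "finite_gset G U'" by (rule gset_isoE[OF assms(1)]) blast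
  obtain h h' where h: "\<And>x. x \<in> fst V \<Longrightarrow> h x \<in> fst V' \<and> h' (h x) = x"
    "\<And>y. y \<in> fst V' \<Longrightarrow> h' y \<in> fst V \<and> h (h' y) = y"
    "\<And>g x. g \<in> carrier G \<Longrightarrow> x \<in> fst V \<Longrightarrow> h (snd V g x) = snd V' g (h x)"
    "finite_gset G V" "finite_gset G V'" by (rule gset_isoE[OF assms(2)]) blast
  show ?thesis
    by (rule gset_isoI2[where f = "\<lambda>n. prod_encode (map_prod f h (prod_decode n))"
          and f' = "\<lambda>n. prod_encode (map_prod f' h' (prod_decode n))"])
      (use f h in \<open>auto intro: finite_gset_intros simp: fst_gset_prod finite_gsetD(3)\<close>)
qed

lemma gset_natural_isos:
  assumes "finite_gset G U" "finite_gset G V" "finite_gset G W"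
  shows gset_sum_comm: "(gset_sum U V, gset_sum V U) \<in> gset_iso G"
    and gset_sum_assoc: "(gset_sum (gset_sum U V) W, gset_sum U (gset_sum V W)) \<in> gset_iso G"
    and gset_sum_empty: "(gset_sum (trivial_gset {}) U, U) \<in> gset_iso G"
    and gset_prod_comm: "(gset_prod U V, gset_prod V U) \<in> gset_iso G"
    and gset_prod_assoc: "(gset_prod (gset_prod U V) W, gset_prod U (gset_prod V W)) \<in> gset_iso G"
    and gset_prod_one: "(gset_prod (trivial_gset {0}) U, U) \<in> gset_iso G"
    and gset_distrib: "(gset_prod (gset_sum U V) W, gset_sum (gset_prod U W) (gset_prod V W)) \<in> gset_iso G"
    and gset_prod_empty: "(gset_prod (trivial_gset {}) U, trivial_gset {}) \<in> gset_iso G"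
proof -
  note fin = assms finite_gset_intros
  have Plus: "Inl x \<in> Sum_Type.Plus A B \<longleftrightarrow> x \<in> A" "Inr y \<in> Sum_Type.Plus A B \<longleftrightarrow> y \<in> B"
    for x y :: nat and A B by auto
  note simps = fst_gset_sum fst_gset_prod finite_gsetD(3)[OF assms(1)] finite_gsetD(3)[OF assms(2)]
    finite_gsetD(3)[OF assms(3)]
    inj_image_mem_iff[OF inj_sum_encode] inj_image_mem_iff[OF inj_prod_encode] Plus
  show "(gset_sum U V, gset_sum V U) \<in> gset_iso G"
    by (rule gset_isoI2[where f = "\<lambda>n. sum_encode (case sum_decode n of Inl x \<Rightarrow> Inr x | Inr x \<Rightarrow> Inl x)"
         and f' = "\<lambda>n. sum_encode (case sum_decode n of Inl x \<Rightarrow> Inr x | Inr x \<Rightarrow> Inl x)"])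
      (auto simp: simps intro: fin)
  show "(gset_sum (gset_sum U V) W, gset_sum U (gset_sum V W)) \<in> gset_iso G"
    by (rule gset_isoI2[where f = "\<lambda>n. case sum_decode n of
           Inl x \<Rightarrow> (case sum_decode x of Inl y \<Rightarrow> sum_encode (Inl y)
                      | Inr y \<Rightarrow> sum_encode (Inr (sum_encode (Inl y))))
         | Inr x \<Rightarrow> sum_encode (Inr (sum_encode (Inr x)))"
       and f' = "\<lambda>n. case sum_decode n of
           Inr x \<Rightarrow> (case sum_decode x of Inr y \<Rightarrow> sum_encode (Inr y)
                      | Inl y \<Rightarrow> sum_encode (Inl (sum_encode (Inr y))))
         | Inl x \<Rightarrow> sum_encode (Inl (sum_encode (Inl x)))"])
      (auto simp: simps intro: fin)
  show "(gset_sum (trivial_gset {}) U, U) \<in> gset_iso G"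
    by (rule gset_isoI2[where f = "\<lambda>n. case sum_decode n of Inl x \<Rightarrow> x | Inr x \<Rightarrow> x"
         and f' = "\<lambda>n. sum_encode (Inr n)"])
      (auto simp: simps intro: fin)
  show "(gset_prod U V, gset_prod V U) \<in> gset_iso G"
    by (rule gset_isoI2[where f = "\<lambda>n. prod_encode (prod.swap (prod_decode n))"
         and f' = "\<lambda>n. prod_encode (prod.swap (prod_decode n))"])
      (auto simp: simps intro: fin)
  show "(gset_prod (gset_prod U V) W, gset_prod U (gset_prod V W)) \<in> gset_iso G"
    by (rule gset_isoI2[where
          f = "\<lambda>n. case prod_decode n of (x, z) \<Rightarrow> case prod_decode x of (x, y) \<Rightarrow>
             prod_encode (x, prod_encode (y, z))"
         and f' = "\<lambda>n. case prod_decode n of (x, z) \<Rightarrow> case prod_decode z of (y, z) \<Rightarrow>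
             prod_encode (prod_encode (x, y), z)"])
      (auto simp: simps intro: fin)
  show "(gset_prod (trivial_gset {0}) U, U) \<in> gset_iso G"
    by (rule gset_isoI2[where f = "\<lambda>n. snd (prod_decode n)" and f' = "\<lambda>n. prod_encode (0, n)"])
      (auto simp: simps intro: fin)
  show "(gset_prod (gset_sum U V) W, gset_sum (gset_prod U W) (gset_prod V W)) \<in> gset_iso G"
    by (rule gset_isoI2[where
          f = "\<lambda>n. case prod_decode n of (x, z) \<Rightarrow>
             sum_encode (map_sum (\<lambda>x. prod_encode (x, z)) (\<lambda>y. prod_encode (y, z)) (sum_decode x))"
         and f' = "\<lambda>n. case sum_decode n of
             Inl x \<Rightarrow> prod_encode (sum_encode (Inl (fst (prod_decode x))), snd (prod_decode x))
           | Inr x \<Rightarrow> prod_encode (sum_encode (Inr (fst (prod_decode x))), snd (prod_decode x))"])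
      (auto simp: simps intro: fin)
  show "(gset_prod (trivial_gset {}) U, trivial_gset {}) \<in> gset_iso G"
    by (rule gset_isoI2) (auto simp: simps intro: fin)
qed

lemma gset_semiring_carrierE:
  assumes "A \<in> carrier (gset_semiring G)"
  obtains U where "finite_gset G U" "A = gset_class G U"
  using assms by (auto simp: gset_semiring_def gset_class_def elim!: quotientE)

lemma gset_class_closed [intro]:
  "finite_gset G U \<Longrightarrow> gset_class G U \<in> carrier (gset_semiring G)"
  by (auto simp: gset_semiring_def gset_class_def intro!: quotientI)

lemma gset_semiring_ops:
  assumes "finite_gset G U" "finite_gset G V"
  shows "gset_class G U \<oplus>\<^bsub>gset_semiring G\<^esub> gset_class G V = gset_class G (gset_sum U V)"
    and "gset_class G U \<otimes>\<^bsub>gset_semiring G\<^esub> gset_class G V = gset_class G (gset_prod U V)"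
    and "\<zero>\<^bsub>gset_semiring G\<^esub> = gset_class G (trivial_gset {})"
    and "\<one>\<^bsub>gset_semiring G\<^esub> = gset_class G (trivial_gset {0})"
proof -
  have D: "finite_gset G U'" "finite_gset G V'" if "(U', V') \<in> gset_iso G" for U' V'
    using that by (auto simp: gset_iso_def)
  have "congruent2 (gset_iso G) (gset_iso G) (\<lambda>U V. gset_class G (gset_sum U V))"
    by (rule congruent2I') (auto simp: gset_class_eq_iff finite_gset_sum D intro: gset_sum_cong)
  from UN_equiv_class2[OF equiv_gset_iso equiv_gset_iso this, of U V] assms
  show "gset_class G U \<oplus>\<^bsub>gset_semiring G\<^esub> gset_class G V = gset_class G (gset_sum U V)"
    by (simp add: gset_semiring_def gset_class_def)
  have "congruent2 (gset_iso G) (gset_iso G) (\<lambda>U V. gset_class G (gset_prod U V))"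
    by (rule congruent2I') (auto simp: gset_class_eq_iff finite_gset_prod D intro: gset_prod_cong)
  from UN_equiv_class2[OF equiv_gset_iso equiv_gset_iso this, of U V] assms
  show "gset_class G U \<otimes>\<^bsub>gset_semiring G\<^esub> gset_class G V = gset_class G (gset_prod U V)"
    by (simp add: gset_semiring_def gset_class_def)
qed (simp_all add: gset_semiring_def)

lemma semiring_gset_semiring: "semiring (gset_semiring G)"
  and comm_monoid_gset_semiring: "comm_monoid (gset_semiring G)"
proof -
  let ?S = "gset_semiring G"
  note [simp] = gset_semiring_ops finite_gset_sum finite_gset_prod finite_gset_trivial
    gset_class_eq_iff gset_natural_isos gset_class_closed
  have *: "\<zero>\<^bsub>?S\<^esub> = gset_class G (trivial_gset {})" "\<one>\<^bsub>?S\<^esub> = gset_class G (trivial_gset {0})"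
    by (simp_all add: gset_semiring_def)
  have c: "x \<otimes>\<^bsub>?S\<^esub> y = y \<otimes>\<^bsub>?S\<^esub> x" if "x \<in> carrier ?S" "y \<in> carrier ?S" for x y
    using that by (elim gset_semiring_carrierE) simp
  show cm: "comm_monoid ?S"
    by (rule comm_monoidI) ((elim gset_semiring_carrierE)?, simp add: *)+
  have am: "abelian_monoid ?S"
    by (rule abelian_monoidI) ((elim gset_semiring_carrierE)?, simp add: *)+
  have ld: "(x \<oplus>\<^bsub>?S\<^esub> y) \<otimes>\<^bsub>?S\<^esub> z = x \<otimes>\<^bsub>?S\<^esub> z \<oplus>\<^bsub>?S\<^esub> y \<otimes>\<^bsub>?S\<^esub> z"
    if "x \<in> carrier ?S" "y \<in> carrier ?S" "z \<in> carrier ?S" for x y z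
    using that by (elim gset_semiring_carrierE) simp
  have ln: "\<zero>\<^bsub>?S\<^esub> \<otimes>\<^bsub>?S\<^esub> x = \<zero>\<^bsub>?S\<^esub>" if "x \<in> carrier ?S" for x
    using that by (elim gset_semiring_carrierE) (simp add: *)
  show "semiring ?S"
    using am cm c ld ln
    by (simp add: semiring_def semiring_axioms_def comm_monoid_def abelian_monoid.zero_closed abelian_monoid.a_closed)
qed

end

locale comm_semiring = semiring S + comm_monoid S for S (structure)
begin

lemma groth_rel_iff:
  "((a, b), (c, d)) \<in> groth_rel S \<longleftrightarrow> a \<in> carrier S \<and> b \<in> carrier S \<and> c \<in> carrier S \<and> d \<in> carrier S \<and>
     (\<exists>k\<in>carrier S. a \<oplus> d \<oplus> k = c \<oplus> b \<oplus> k)"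
  by (simp add: groth_rel_def)

lemma equiv_groth_rel: "equiv (carrier S \<times> carrier S) (groth_rel S)"
proof (rule equivI)
  show "groth_rel S \<subseteq> (carrier S \<times> carrier S) \<times> (carrier S \<times> carrier S)"
    by (auto simp: groth_rel_def)
  show "refl_on (carrier S \<times> carrier S) (groth_rel S)"
    by (auto simp: refl_on_def groth_rel_def)
  show "sym (groth_rel S)"
    unfolding sym_def groth_rel_def by (clarsimp; metis)
  show "trans (groth_rel S)"
  proof (rule transI, clarsimp simp: groth_rel_iff)
    fix a b c d e f k l
    assume c: "a \<in> carrier S" "b \<in> carrier S" "c \<in> carrier S" "d \<in> carrier S"
      "e \<in> carrier S" "f \<in> carrier S" "k \<in> carrier S" "l \<in> carrier S"
    assume 1: "a \<oplus> d \<oplus> k = c \<oplus> b \<oplus> k" and 2: "c \<oplus> f \<oplus> l = e \<oplus> d \<oplus> l"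
    have "a \<oplus> f \<oplus> (c \<oplus> d \<oplus> k \<oplus> l) = (a \<oplus> d \<oplus> k) \<oplus> (c \<oplus> f \<oplus> l)"
      using c by (simp add: a_ac)
    also have "\<dots> = (c \<oplus> b \<oplus> k) \<oplus> (e \<oplus> d \<oplus> l)" by (simp only: 1 2)
    also have "\<dots> = e \<oplus> b \<oplus> (c \<oplus> d \<oplus> k \<oplus> l)"
      using c by (simp add: a_ac)
    finally show "\<exists>k\<in>carrier S. a \<oplus> f \<oplus> k = e \<oplus> b \<oplus> k"
      using c by (intro bexI[of _ "c \<oplus> d \<oplus> k \<oplus> l"]) auto
  qed
qed

lemma groth_class_eq_iff:
  assumes "a \<in> carrier S" "b \<in> carrier S" "c \<in> carrier S" "d \<in> carrier S"
  shows "groth_class S a b = groth_class S c d \<longleftrightarrow> (\<exists>k\<in>carrier S. a \<oplus> d \<oplus> k = c \<oplus> b \<oplus> k)"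
  using eq_equiv_class_iff[OF equiv_groth_rel, of "(a, b)" "(c, d)"] assms
  by (simp add: groth_class_def groth_rel_iff)

lemma groth_class_eqI:
  assumes "a \<in> carrier S" "b \<in> carrier S" "c \<in> carrier S" "d \<in> carrier S" "a \<oplus> d = c \<oplus> b"
  shows "groth_class S a b = groth_class S c d"
  using assms by (subst groth_class_eq_iff) auto

lemma groth_carrierE:
  assumes "A \<in> carrier (grothendieck_ring S)"
  obtains a b where "a \<in> carrier S" "b \<in> carrier S" "A = groth_class S a b"
  using assms by (auto simp: grothendieck_ring_def groth_class_def elim!: quotientE)

lemma groth_class_closed [simp, intro]:
  "a \<in> carrier S \<Longrightarrow> b \<in> carrier S \<Longrightarrow> groth_class S a b \<in> carrier (grothendieck_ring S)"
  by (auto simp: grothendieck_ring_def groth_class_def intro!: quotientI)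

lemma groth_mult_cong:
  assumes c: "a \<in> carrier S" "b \<in> carrier S" "a' \<in> carrier S" "b' \<in> carrier S"
    "c \<in> carrier S" "d \<in> carrier S"
    and eq: "groth_class S a b = groth_class S a' b'"
  shows "groth_class S (a \<otimes> c \<oplus> b \<otimes> d) (a \<otimes> d \<oplus> b \<otimes> c) =
         groth_class S (a' \<otimes> c \<oplus> b' \<otimes> d) (a' \<otimes> d \<oplus> b' \<otimes> c)"
proof -
  obtain k where k: "k \<in> carrier S" "a \<oplus> b' \<oplus> k = a' \<oplus> b \<oplus> k"
    using eq c by (auto simp: groth_class_eq_iff)
  have "(a \<oplus> b' \<oplus> k) \<otimes> c \<oplus> (a' \<oplus> b \<oplus> k) \<otimes> d = (a' \<oplus> b \<oplus> k) \<otimes> c \<oplus> (a \<oplus> b' \<oplus> k) \<otimes> d"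
    by (simp only: k)
  hence "(a \<otimes> c \<oplus> b \<otimes> d) \<oplus> (a' \<otimes> d \<oplus> b' \<otimes> c) \<oplus> (k \<otimes> c \<oplus> k \<otimes> d) =
    (a' \<otimes> c \<oplus> b' \<otimes> d) \<oplus> (a \<otimes> d \<oplus> b \<otimes> c) \<oplus> (k \<otimes> c \<oplus> k \<otimes> d)"
    using c k(1) by (simp add: l_distr a_ac)
  thus ?thesis using c k(1)
    by (subst groth_class_eq_iff) (auto intro!: bexI[of _ "k \<otimes> c \<oplus> k \<otimes> d"])
qed

lemma groth_add_cong:
  assumes c: "a \<in> carrier S" "b \<in> carrier S" "a' \<in> carrier S" "b' \<in> carrier S"
    "c \<in> carrier S" "d \<in> carrier S"
    and eq: "groth_class S a b = groth_class S a' b'"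
  shows "groth_class S (a \<oplus> c) (b \<oplus> d) = groth_class S (a' \<oplus> c) (b' \<oplus> d)"
proof -
  obtain k where k: "k \<in> carrier S" "a \<oplus> b' \<oplus> k = a' \<oplus> b \<oplus> k"
    using eq c by (auto simp: groth_class_eq_iff)
  have "(a \<oplus> b' \<oplus> k) \<oplus> (c \<oplus> d) = (a' \<oplus> b \<oplus> k) \<oplus> (c \<oplus> d)"
    by (simp only: k)
  hence "(a \<oplus> c) \<oplus> (b' \<oplus> d) \<oplus> k = (a' \<oplus> c) \<oplus> (b \<oplus> d) \<oplus> k"
    using c k(1) by (simp add: a_ac)
  thus ?thesis using c k(1) by (subst groth_class_eq_iff) auto
qed

lemma groth_ops:
  assumes c: "a \<in> carrier S" "b \<in> carrier S" "c \<in> carrier S" "d \<in> carrier S"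
  shows "groth_class S a b \<oplus>\<^bsub>grothendieck_ring S\<^esub> groth_class S c d = groth_class S (a \<oplus> c) (b \<oplus> d)"
    and "groth_class S a b \<otimes>\<^bsub>grothendieck_ring S\<^esub> groth_class S c d =
      groth_class S (a \<otimes> c \<oplus> b \<otimes> d) (a \<otimes> d \<oplus> b \<otimes> c)"
    and "\<zero>\<^bsub>grothendieck_ring S\<^esub> = groth_class S \<zero> \<zero>"
    and "\<one>\<^bsub>grothendieck_ring S\<^esub> = groth_class S \<one> \<zero>"
proof -
  have D: "a \<in> carrier S" "b \<in> carrier S" "c \<in> carrier S" "d \<in> carrier S"
      "groth_class S a b = groth_class S c d"
    if "((a, b), (c, d)) \<in> groth_rel S" for a b c d
    using that groth_class_eq_iff[of a b c d] by (auto simp: groth_rel_iff)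
  have "congruent2 (groth_rel S) (groth_rel S) (\<lambda>(a, b) (c, d). groth_class S (a \<oplus> c) (b \<oplus> d))"
  proof (rule congruent2I', clarify)
    fix a b a' b' c d c' d'
    assume "((a, b), (a', b')) \<in> groth_rel S" "((c, d), (c', d')) \<in> groth_rel S"
    note r = D[OF this(1)] D[OF this(2)]
    show "groth_class S (a \<oplus> c) (b \<oplus> d) = groth_class S (a' \<oplus> c') (b' \<oplus> d')"
      using groth_add_cong[of a b a' b' c d] groth_add_cong[of c d c' d' a' b'] r
      by (simp add: a_comm)
  qed
  from UN_equiv_class2[OF equiv_groth_rel equiv_groth_rel this, of "(a, b)" "(c, d)"] c
  show "groth_class S a b \<oplus>\<^bsub>grothendieck_ring S\<^esub> groth_class S c d = groth_class S (a \<oplus> c) (b \<oplus> d)"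
    by (simp add: grothendieck_ring_def groth_class_def case_prod_unfold)
  have "congruent2 (groth_rel S) (groth_rel S)
     (\<lambda>(a, b) (c, d). groth_class S (a \<otimes> c \<oplus> b \<otimes> d) (a \<otimes> d \<oplus> b \<otimes> c))"
  proof (rule congruent2I', clarify)
    fix a b a' b' c d c' d'
    assume "((a, b), (a', b')) \<in> groth_rel S" "((c, d), (c', d')) \<in> groth_rel S"
    note r = D[OF this(1)] D[OF this(2)]
    show "groth_class S (a \<otimes> c \<oplus> b \<otimes> d) (a \<otimes> d \<oplus> b \<otimes> c) =
      groth_class S (a' \<otimes> c' \<oplus> b' \<otimes> d') (a' \<otimes> d' \<oplus> b' \<otimes> c')"
      using groth_mult_cong[of a b a' b' c d] groth_mult_cong[of c d c' d' a' b'] r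
      by (simp add: a_comm m_comm)
  qed
  from UN_equiv_class2[OF equiv_groth_rel equiv_groth_rel this, of "(a, b)" "(c, d)"] c
  show "groth_class S a b \<otimes>\<^bsub>grothendieck_ring S\<^esub> groth_class S c d =
      groth_class S (a \<otimes> c \<oplus> b \<otimes> d) (a \<otimes> d \<oplus> b \<otimes> c)"
    by (simp add: grothendieck_ring_def groth_class_def case_prod_unfold)
qed (simp_all add: grothendieck_ring_def)

lemma cring_grothendieck_ring: "cring (grothendieck_ring S)"
proof (rule cringI)
  let ?A = "grothendieck_ring S"
  have *: "\<zero>\<^bsub>?A\<^esub> = groth_class S \<zero> \<zero>" "\<one>\<^bsub>?A\<^esub> = groth_class S \<one> \<zero>"
    by (simp_all add: grothendieck_ring_def)
  show "abelian_group ?A"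
  proof (rule abelian_groupI)
    fix x assume "x \<in> carrier ?A"
    then obtain a b where x: "a \<in> carrier S" "b \<in> carrier S" "x = groth_class S a b"
      by (rule groth_carrierE)
    hence "groth_class S b a \<oplus>\<^bsub>?A\<^esub> x = \<zero>\<^bsub>?A\<^esub>"
      by (simp add: * groth_ops(1,2), intro groth_class_eqI) (simp_all add: a_comm)
    thus "\<exists>y\<in>carrier ?A. y \<oplus>\<^bsub>?A\<^esub> x = \<zero>\<^bsub>?A\<^esub>" using x by blast
  qed (auto simp: * groth_ops(1,2) a_ac elim!: groth_carrierE)
  show "comm_monoid ?A"
  proof (rule comm_monoidI)
    fix x y z assume "x \<in> carrier ?A" "y \<in> carrier ?A" "z \<in> carrier ?A"
    thus "x \<otimes>\<^bsub>?A\<^esub> y \<otimes>\<^bsub>?A\<^esub> z = x \<otimes>\<^bsub>?A\<^esub> (y \<otimes>\<^bsub>?A\<^esub> z)"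
      by (elim groth_carrierE) (simp add: groth_ops(1,2) l_distr r_distr a_ac m_assoc)
  next
    fix x y assume "x \<in> carrier ?A" "y \<in> carrier ?A"
    thus "x \<otimes>\<^bsub>?A\<^esub> y = y \<otimes>\<^bsub>?A\<^esub> x"
      by (elim groth_carrierE) (simp add: groth_ops(1,2) a_comm m_comm)
  qed (auto simp: * groth_ops(1,2) elim!: groth_carrierE)
  show "(x \<oplus>\<^bsub>?A\<^esub> y) \<otimes>\<^bsub>?A\<^esub> z = x \<otimes>\<^bsub>?A\<^esub> z \<oplus>\<^bsub>?A\<^esub> y \<otimes>\<^bsub>?A\<^esub> z"
    if "x \<in> carrier ?A" "y \<in> carrier ?A" "z \<in> carrier ?A" for x y z
    using that by (elim groth_carrierE) (simp add: groth_ops(1,2) l_distr a_ac)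
qed

lemma groth_diff:
  assumes "a \<in> carrier S" "b \<in> carrier S"
  shows "groth_class S a \<zero> \<ominus>\<^bsub>grothendieck_ring S\<^esub> groth_class S b \<zero> = groth_class S a b"
proof -
  interpret A: cring "grothendieck_ring S" by (rule cring_grothendieck_ring)
  have "groth_class S a b \<oplus>\<^bsub>grothendieck_ring S\<^esub> groth_class S b \<zero> = groth_class S a \<zero>"
    using assms by (simp add: groth_ops(1,2), intro groth_class_eqI) simp_all
  hence "groth_class S a \<zero> \<ominus>\<^bsub>grothendieck_ring S\<^esub> groth_class S b \<zero> =
    groth_class S a b \<oplus>\<^bsub>grothendieck_ring S\<^esub> groth_class S b \<zero> \<ominus>\<^bsub>grothendieck_ring S\<^esub> groth_class S b \<zero>"
    by simp
  also have "\<dots> = groth_class S a b"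
    using assms by (simp add: A.minus_eq A.a_assoc A.r_neg groth_class_closed)
  finally show ?thesis .
qed

end

context group begin

lemma comm_semiring_gset: "comm_semiring (gset_semiring G)"
  by (simp add: comm_semiring_def semiring_gset_semiring comm_monoid_gset_semiring)

lemma cring_burnside_ring: "cring (burnside_ring G)"
  unfolding burnside_ring_def by (rule comm_semiring.cring_grothendieck_ring[OF comm_semiring_gset])

lemma fixed_points_iso:
  assumes "(U, V) \<in> gset_iso G" "H \<subseteq> carrier G"
  shows "card (fixed_points H U) = card (fixed_points H V)"
proof -
  obtain f f' where f: "\<And>x. x \<in> fst U \<Longrightarrow> f x \<in> fst V \<and> f' (f x) = x"
    "\<And>y. y \<in> fst V \<Longrightarrow> f' y \<in> fst U \<and> f (f' y) = y"
    "\<And>g x. g \<in> carrier G \<Longrightarrow> x \<in> fst U \<Longrightarrow> f (snd U g x) = snd V g (f x)"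
    "finite_gset G U" "finite_gset G V" by (rule gset_isoE[OF assms(1)]) blast
  have "bij_betw f (fixed_points H U) (fixed_points H V)"
  proof (rule bij_betw_byWitness[where f' = f'])
    have "snd U h (f' y) = f' y" if h: "h \<in> H" and y: "y \<in> fst V" "snd V h y = y" for h y
    proof -
      have hG: "h \<in> carrier G" using h assms(2) by blast
      have y': "f' y \<in> fst U" "f (f' y) = y" using f(2)[OF y(1)] by auto
      have "f (snd U h (f' y)) = y" using f(3)[OF hG y'(1)] y' y by simp
      thus ?thesis using f(1)[OF finite_gsetD(3)[OF f(4) hG y'(1)]] by simp
    qed
    thus "f' ` fixed_points H V \<subseteq> fixed_points H U" using f(2) by (auto simp: fixed_points_def)
    have "snd V h (f x) = f x" if h: "h \<in> H" and x: "x \<in> fst U" "snd U h x = x" for h x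
      using f(3)[of h x] h x assms(2) by auto
    thus "f ` fixed_points H U \<subseteq> fixed_points H V"
      using f(1) by (auto simp: fixed_points_def)
  qed (use f in \<open>auto simp: fixed_points_def\<close>)
  thus ?thesis by (rule bij_betw_same_card)
qed

lemma fixed_points_sum:
  assumes "finite_gset G U" "finite_gset G V"
  shows "card (fixed_points H (gset_sum U V)) = card (fixed_points H U) + card (fixed_points H V)"
proof -
  have "fixed_points H (gset_sum U V) = sum_encode ` Sum_Type.Plus (fixed_points H U) (fixed_points H V)"
    by (auto simp: fixed_points_def fst_gset_sum sum_encode_eq intro!: imageI)
  thus ?thesis using finite_gsetD(1)[OF assms(1)] finite_gsetD(1)[OF assms(2)]
    by (simp add: card_image[OF inj_sum_encode] card_Plus fixed_points_def)
qed

lemma fixed_points_prod: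
  shows "card (fixed_points H (gset_prod U V)) = card (fixed_points H U) * card (fixed_points H V)"
proof -
  have "fixed_points H (gset_prod U V) = prod_encode ` (fixed_points H U \<times> fixed_points H V)"
    by (auto simp: fixed_points_def fst_gset_prod prod_encode_eq intro!: imageI)
  thus ?thesis 
    by (simp add: card_image[OF inj_prod_encode] card_cartesian_product)
qed

lemma mark_groth_class:
  assumes "finite_gset G U" "finite_gset G V" "H \<subseteq> carrier G"
  shows "mark G H (groth_class (gset_semiring G) (gset_class G U) (gset_class G V)) =
    int (card (fixed_points H U)) - int (card (fixed_points H V))"
proof -
  interpret comm_semiring "gset_semiring G" by (rule comm_semiring_gset)
  have d: "burnside_class G U \<ominus>\<^bsub>burnside_ring G\<^esub> burnside_class G V =
    groth_class (gset_semiring G) (gset_class G U) (gset_class G V)"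
    if "finite_gset G U" "finite_gset G V" for U V
    using that by (simp add: burnside_class_def burnside_ring_def groth_diff gset_class_closed)
  have u: "int (card (fixed_points H U)) - int (card (fixed_points H V)) =
      int (card (fixed_points H U')) - int (card (fixed_points H V'))"
    if fin: "finite_gset G U'" "finite_gset G V'"
      and eq: "groth_class (gset_semiring G) (gset_class G U) (gset_class G V) =
        groth_class (gset_semiring G) (gset_class G U') (gset_class G V')" for U' V'
  proof -
    have "\<exists>k\<in>carrier (gset_semiring G).
       gset_class G U \<oplus>\<^bsub>gset_semiring G\<^esub> gset_class G V' \<oplus>\<^bsub>gset_semiring G\<^esub> k =
       gset_class G U' \<oplus>\<^bsub>gset_semiring G\<^esub> gset_class G V \<oplus>\<^bsub>gset_semiring G\<^esub> k"
      by (rule iffD1[OF groth_class_eq_iff eq]) (rule gset_class_closed fin assms)+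
    then obtain k where k: "k \<in> carrier (gset_semiring G)"
      "gset_class G U \<oplus>\<^bsub>gset_semiring G\<^esub> gset_class G V' \<oplus>\<^bsub>gset_semiring G\<^esub> k =
       gset_class G U' \<oplus>\<^bsub>gset_semiring G\<^esub> gset_class G V \<oplus>\<^bsub>gset_semiring G\<^esub> k" by blast
    from k(1) obtain W where W: "finite_gset G W" "k = gset_class G W"
      by (rule gset_semiring_carrierE)
    have "(gset_sum (gset_sum U V') W, gset_sum (gset_sum U' V) W) \<in> gset_iso G"
      using k(2) W fin assms
      by (simp add: gset_semiring_ops(1) finite_gset_sum gset_class_eq_iff)
    from fixed_points_iso[OF this assms(3)] show ?thesis
      using W fin assms by (simp add: fixed_points_sum finite_gset_sum)
  qed
  show ?thesis unfolding mark_def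
  proof (rule the_equality)
    show "\<exists>U' V'. finite_gset G U' \<and> finite_gset G V' \<and>
      groth_class (gset_semiring G) (gset_class G U) (gset_class G V) =
        burnside_class G U' \<ominus>\<^bsub>burnside_ring G\<^esub> burnside_class G V' \<and>
      int (card (fixed_points H U)) - int (card (fixed_points H V)) =
        int (card (fixed_points H U')) - int (card (fixed_points H V'))"
      using assms d[OF assms(1,2)] by metis
  next
    fix n assume "\<exists>U' V'. finite_gset G U' \<and> finite_gset G V' \<and>
      groth_class (gset_semiring G) (gset_class G U) (gset_class G V) =
        burnside_class G U' \<ominus>\<^bsub>burnside_ring G\<^esub> burnside_class G V' \<and>
      n = int (card (fixed_points H U')) - int (card (fixed_points H V'))"
    then obtain U' V' where "finite_gset G U'" "finite_gset G V'"
      "groth_class (gset_semiring G) (gset_class G U) (gset_class G V) =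
        burnside_class G U' \<ominus>\<^bsub>burnside_ring G\<^esub> burnside_class G V'"
      and n: "n = int (card (fixed_points H U')) - int (card (fixed_points H V'))" by blast
    from u[OF this(1,2)] d[OF this(1,2)] this(3) n
    show "n = int (card (fixed_points H U)) - int (card (fixed_points H V))" by simp
  qed
qed

lemma mark_burnside_class:
  assumes "finite_gset G U" "H \<subseteq> carrier G"
  shows "mark G H (burnside_class G U) = int (card (fixed_points H U))"
proof -
  have "\<zero>\<^bsub>gset_semiring G\<^esub> = gset_class G (trivial_gset {})" by (simp add: gset_semiring_def)
  thus ?thesis
    using mark_groth_class[OF assms(1) finite_gset_trivial assms(2), of "{}"]
    by (simp add: burnside_class_def fixed_points_def)
qed

lemma mark_ring_hom:
  assumes "H \<subseteq> carrier G"
  shows "mark G H \<in> ring_hom (burnside_ring G) \<lparr>carrier = UNIV, monoid.mult = (*), one = 1, zero = 0, add = (+)\<rparr>"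
    (is "_ \<in> ring_hom _ ?Z")
proof (rule ring_hom_memI)
  interpret comm_semiring "gset_semiring G" by (rule comm_semiring_gset)
  note simps = burnside_ring_def groth_ops(1,2) gset_class_closed finite_gset_sum finite_gset_prod
    gset_semiring_ops(1,2) mark_groth_class assms fixed_points_sum fixed_points_prod
  show "mark G H (x \<otimes>\<^bsub>burnside_ring G\<^esub> y) = mark G H x \<otimes>\<^bsub>?Z\<^esub> mark G H y"
    if "x \<in> carrier (burnside_ring G)" "y \<in> carrier (burnside_ring G)" for x y
    using that[unfolded burnside_ring_def]
    by (elim groth_carrierE gset_semiring_carrierE) (simp add: simps algebra_simps)
  show "mark G H (x \<oplus>\<^bsub>burnside_ring G\<^esub> y) = mark G H x \<oplus>\<^bsub>?Z\<^esub> mark G H y"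
    if "x \<in> carrier (burnside_ring G)" "y \<in> carrier (burnside_ring G)" for x y
    using that[unfolded burnside_ring_def]
    by (elim groth_carrierE gset_semiring_carrierE) (simp add: simps algebra_simps)
  have "\<one>\<^bsub>burnside_ring G\<^esub> = burnside_class G (trivial_gset {0})"
    by (simp add: burnside_ring_def grothendieck_ring_def burnside_class_def gset_semiring_def)
  moreover have "fixed_points H (trivial_gset {0} :: 'a gset) = {0}" by (auto simp: fixed_points_def)
  ultimately show "mark G H \<one>\<^bsub>burnside_ring G\<^esub> = \<one>\<^bsub>?Z\<^esub>"
    using mark_burnside_class[OF finite_gset_trivial assms, of "{0}"] by simp
qed simp

lemma module_mark_module:
  assumes "H \<subseteq> carrier G"
  shows "Module.module (burnside_ring G) (mark_module G H)"
proof (rule moduleI)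
  show "abelian_group (mark_module G H)"
    by (rule abelian_groupI) (auto simp: mark_module_def intro: exI[of _ "- _"])
qed (use ring_hom_mult[OF mark_ring_hom[OF assms]] ring_hom_add[OF mark_ring_hom[OF assms]]
    ring_hom_one[OF mark_ring_hom[OF assms]] in
    \<open>auto simp: mark_module_def algebra_simps cring_burnside_ring\<close>)

end

section \<open>Freeness and exactness of the canonical resolution\<close>

lemma (in cring) module_free_module:
  fixes B :: "'i set"
  shows "Module.module R (free_module R B)"
proof -
  have fin: "finite {b. f b \<oplus> g b \<noteq> \<zero>}"
    if "finite {b. f b \<noteq> \<zero>}" "finite {b. g b \<noteq> \<zero>}" for f g :: "'i \<Rightarrow> 'a"
    by (rule finite_subset[OF _ finite_UnI[OF that]]) auto
  have fin': "finite {b. r \<otimes> f b \<noteq> \<zero>}"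
    if "r \<in> carrier R" "finite {b. f b \<noteq> \<zero>}" for r and f :: "'i \<Rightarrow> 'a"
    by (rule finite_subset[OF _ that(2)]) (use that(1) in auto)
  have c: "f b \<in> carrier R" if "\<forall>b\<in>B. f b \<in> carrier R" "\<forall>b. b \<notin> B \<longrightarrow> f b = \<zero>" for f b
    using that by (cases "b \<in> B") auto
  have "abelian_group (free_module R B)"
  proof (rule abelian_groupI)
    fix f assume f: "f \<in> carrier (free_module R B)"
    have "finite {b. \<ominus> f b \<noteq> \<zero>}"
      by (rule finite_subset[of _ "{b. f b \<noteq> \<zero>}"]) (use f in \<open>auto simp: free_module_def\<close>)
    thus "\<exists>g\<in>carrier (free_module R B). g \<oplus>\<^bsub>free_module R B\<^esub> f = \<zero>\<^bsub>free_module R B\<^esub>"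
      using f c[of f] by (intro bexI[of _ "\<lambda>b. \<ominus> f b"]) (auto simp: free_module_def l_neg)
  qed (auto simp: free_module_def fin fun_eq_iff c a_ac)
  thus ?thesis
    by (intro moduleI is_cring) (auto simp: free_module_def fin fin' fun_eq_iff c l_distr r_distr m_assoc)
qed

lemma (in ring) free_module_carrier_cong:
  "f \<in> carrier (free_module R B) \<longleftrightarrow> f \<in> carrier (free_module R UNIV) \<and> (\<forall>b. b \<notin> B \<longrightarrow> f b = \<zero>)"
  by (auto simp: free_module_def)

context Module.module begin

lemma lin_ext_superset:
  assumes "finite A" "{b. f b \<noteq> \<zero>} \<subseteq> A" "\<And>b. b \<in> A \<Longrightarrow> f b \<in> carrier R" "\<And>b. b \<in> A \<Longrightarrow> v b \<in> carrier M"
  shows "lin_ext R M v f = (\<Oplus>\<^bsub>M\<^esub>b\<in>A. f b \<odot>\<^bsub>M\<^esub> v b)"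
  unfolding lin_ext_def
  using assms by (intro M.add.finprod_mono_neutral_cong_left) (auto simp: subset_eq)

lemma lin_ext_closed:
  assumes "f \<in> carrier (free_module R B)" "\<And>b. b \<in> B \<Longrightarrow> v b \<in> carrier M"
  shows "lin_ext R M v f \<in> carrier M"
  unfolding lin_ext_def
  by (intro M.finsum_closed Pi_I smult_closed; use assms in \<open>auto simp: free_module_def\<close>)

lemma lin_ext_add:
  assumes "f \<in> carrier (free_module R B)" "g \<in> carrier (free_module R B)"
    "\<And>b. b \<in> B \<Longrightarrow> v b \<in> carrier M"
  shows "lin_ext R M v (f \<oplus>\<^bsub>free_module R B\<^esub> g) = lin_ext R M v f \<oplus>\<^bsub>M\<^esub> lin_ext R M v g"
proof -
  let ?A = "{b. f b \<noteq> \<zero>} \<union> {b. g b \<noteq> \<zero>}"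
  have A: "finite ?A" "?A \<subseteq> B" using assms by (auto simp: free_module_def)
  have c: "f b \<in> carrier R" "g b \<in> carrier R" "v b \<in> carrier M" if "b \<in> ?A" for b
    using that A assms by (auto simp: free_module_def)
  have "lin_ext R M v (f \<oplus>\<^bsub>free_module R B\<^esub> g) = (\<Oplus>\<^bsub>M\<^esub>b\<in>?A. (f b \<oplus> g b) \<odot>\<^bsub>M\<^esub> v b)"
    using A c by (subst lin_ext_superset[of ?A]) (auto simp: free_module_def)
  also have "\<dots> = (\<Oplus>\<^bsub>M\<^esub>b\<in>?A. f b \<odot>\<^bsub>M\<^esub> v b \<oplus>\<^bsub>M\<^esub> g b \<odot>\<^bsub>M\<^esub> v b)"
    using c by (intro M.finsum_cong') (auto simp: smult_l_distr)
  also have "\<dots> = (\<Oplus>\<^bsub>M\<^esub>b\<in>?A. f b \<odot>\<^bsub>M\<^esub> v b) \<oplus>\<^bsub>M\<^esub> (\<Oplus>\<^bsub>M\<^esub>b\<in>?A. g b \<odot>\<^bsub>M\<^esub> v b)"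
    using c by (intro M.finsum_addf) auto
  also have "\<dots> = lin_ext R M v f \<oplus>\<^bsub>M\<^esub> lin_ext R M v g"
    using A c by (subst (1 2) lin_ext_superset[of ?A]) auto
  finally show ?thesis .
qed

lemma lin_ext_smult:
  assumes "r \<in> carrier R" "f \<in> carrier (free_module R B)" "\<And>b. b \<in> B \<Longrightarrow> v b \<in> carrier M"
  shows "lin_ext R M v (r \<odot>\<^bsub>free_module R B\<^esub> f) = r \<odot>\<^bsub>M\<^esub> lin_ext R M v f"
proof -
  let ?A = "{b. f b \<noteq> \<zero>}"
  have A: "finite ?A" "?A \<subseteq> B" using assms by (auto simp: free_module_def)
  have c: "f b \<in> carrier R" "v b \<in> carrier M" if "b \<in> ?A" for b
    using that A assms by (auto simp: free_module_def)
  have "lin_ext R M v (r \<odot>\<^bsub>free_module R B\<^esub> f) = (\<Oplus>\<^bsub>M\<^esub>b\<in>?A. (r \<otimes> f b) \<odot>\<^bsub>M\<^esub> v b)"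
    using A c assms(1) by (subst lin_ext_superset[of ?A]) (auto simp: free_module_def)
  also have "\<dots> = (\<Oplus>\<^bsub>M\<^esub>b\<in>?A. r \<odot>\<^bsub>M\<^esub> (f b \<odot>\<^bsub>M\<^esub> v b))"
    using c assms(1) by (intro M.finsum_cong') (auto simp: smult_assoc1)
  also have "\<dots> = r \<odot>\<^bsub>M\<^esub> lin_ext R M v f"
    unfolding lin_ext_def using A c assms(1) by (intro finsum_smult_ldistr[symmetric]) auto
  finally show ?thesis .
qed

lemma lin_ext_basis:
  assumes "v b \<in> carrier M"
  shows "lin_ext R M v (\<lambda>x. if x = b then \<one> else \<zero>) = v b"
  using assms by (subst lin_ext_superset[of "{b}"]) auto

end

context cring begin

lemma formal_comb_simps [simp]:
  "formal_comb R [] = (\<lambda>b. \<zero>)"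
  "formal_comb R ((r, b) # xs) = (formal_comb R xs)(b := r \<oplus> formal_comb R xs b)"
  by (simp_all add: formal_comb_def)

lemma formal_comb_closed:
  assumes "set xs \<subseteq> carrier R \<times> B"
  shows "formal_comb R xs \<in> carrier (free_module R B)"
  using assms
proof (induction xs)
  case (Cons y ys)
  obtain r b where y: "y = (r, b)" by (cases y)
  have "finite {x. formal_comb R (y # ys) x \<noteq> \<zero>}"
    by (rule finite_subset[of _ "insert b {x. formal_comb R ys x \<noteq> \<zero>}"])
       (use Cons y in \<open>auto simp: free_module_def\<close>)
  thus ?case using Cons y by (auto simp: free_module_def)
qed (auto simp: free_module_def)

lemma formal_comb_surj:
  assumes "f \<in> carrier (free_module R B)"
  obtains xs where "set xs \<subseteq> carrier R \<times> B" "formal_comb R xs = f"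
proof -
  obtain bs where bs: "set bs = {b. f b \<noteq> \<zero>}" "distinct bs"
    using finite_distinct_list[of "{b. f b \<noteq> \<zero>}"] assms by (auto simp: free_module_def)
  have c: "f b \<in> carrier R" for b using assms by (cases "b \<in> B") (auto simp: free_module_def)
  have "formal_comb R (map (\<lambda>b. (f b, b)) bs) = (\<lambda>b. if b \<in> set bs then f b else \<zero>)"
    using bs(2) by (induction bs) (auto simp: fun_eq_iff c)
  hence "formal_comb R (map (\<lambda>b. (f b, b)) bs) = f" using bs(1) by (auto simp: fun_eq_iff)
  moreover have "set (map (\<lambda>b. (f b, b)) bs) \<subseteq> carrier R \<times> B"
    using bs(1) assms by (auto simp: free_module_def)
  ultimately show thesis using that by blast
qed

end

context Module.module begin

lemma res_aug_closed: "f \<in> carrier (res_module R M 0) \<Longrightarrow> res_aug R M f \<in> carrier M"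
  unfolding res_aug_def res_module_def by (rule lin_ext_closed) auto

lemma res_aug_add:
  "f \<in> carrier (res_module R M 0) \<Longrightarrow> g \<in> carrier (res_module R M 0) \<Longrightarrow>
   res_aug R M (f \<oplus>\<^bsub>res_module R M 0\<^esub> g) = res_aug R M f \<oplus>\<^bsub>M\<^esub> res_aug R M g"
  unfolding res_aug_def res_module_def by (rule lin_ext_add) auto

lemma res_aug_smult:
  "r \<in> carrier R \<Longrightarrow> f \<in> carrier (res_module R M 0) \<Longrightarrow>
   res_aug R M (r \<odot>\<^bsub>res_module R M 0\<^esub> f) = r \<odot>\<^bsub>M\<^esub> res_aug R M f"
  unfolding res_aug_def res_module_def by (rule lin_ext_smult) auto

lemma res_aug_surj: "res_aug R M ` carrier (res_module R M 0) = carrier M"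
proof
  show "res_aug R M ` carrier (res_module R M 0) \<subseteq> carrier M" using res_aug_closed by auto
  show "carrier M \<subseteq> res_aug R M ` carrier (res_module R M 0)"
  proof
    fix m assume m: "m \<in> carrier M"
    let ?e = "\<lambda>x. if x = Elt m then \<one> else \<zero> :: 'a"
    have "finite {x. ?e x \<noteq> \<zero>}" by (rule finite_subset[of _ "{Elt m}"]) auto
    hence "?e \<in> carrier (res_module R M 0)"
      using m by (auto simp: res_module_def free_module_def)
    moreover have "res_aug R M ?e = m"
      unfolding res_aug_def using m by (subst lin_ext_basis) auto
    ultimately show "m \<in> res_aug R M ` carrier (res_module R M 0)" by (metis image_eqI)
  qed
qed

lemma res_bd_closed: "f \<in> carrier (res_module R M (Suc n)) \<Longrightarrow> res_bd R f \<in> carrier (res_module R M n)"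
  and res_bd_add: "f \<in> carrier (res_module R M (Suc n)) \<Longrightarrow> g \<in> carrier (res_module R M (Suc n)) \<Longrightarrow>
   res_bd R (f \<oplus>\<^bsub>res_module R M (Suc n)\<^esub> g) = res_bd R f \<oplus>\<^bsub>res_module R M n\<^esub> res_bd R g"
  and res_bd_smult: "r \<in> carrier R \<Longrightarrow> f \<in> carrier (res_module R M (Suc n)) \<Longrightarrow>
   res_bd R (r \<odot>\<^bsub>res_module R M (Suc n)\<^esub> f) = r \<odot>\<^bsub>res_module R M n\<^esub> res_bd R f"
  and res_bd_basis: "Syz xs \<in> res_gens R M (Suc n) \<Longrightarrow>
   res_bd R (\<lambda>x. if x = Syz xs then \<one> else \<zero>) = formal_comb R xs"
proof -
  let ?v = "\<lambda>b :: ('a, 'c) gen. case b of Elt m \<Rightarrow> (\<lambda>_. \<zero>) | Syz xs \<Rightarrow> formal_comb R xs"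
  interpret U: Module.module R "free_module R (UNIV :: ('a, 'c) gen set)"
    by (rule R.module_free_module)
  interpret P: Module.module R "res_module R M n"
    unfolding res_module_def by (rule R.module_free_module)
  have v: "?v b \<in> carrier (res_module R M n)" if "b \<in> res_gens R M (Suc n)" for b
    using that R.formal_comb_closed by (auto simp: res_module_def)
  have sub: "carrier (res_module R M n) \<subseteq> carrier (free_module R UNIV)"
    unfolding res_module_def using R.free_module_carrier_cong by blast
  have add_eq: "x \<oplus>\<^bsub>res_module R M n\<^esub> y = x \<oplus>\<^bsub>free_module R UNIV\<^esub> y"
    "\<zero>\<^bsub>res_module R M n\<^esub> = \<zero>\<^bsub>free_module R UNIV\<^esub>"
    "r \<odot>\<^bsub>res_module R M n\<^esub> x = r \<odot>\<^bsub>free_module R UNIV\<^esub> x" for x y r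
    by (simp_all add: res_module_def free_module_def)
  have vU: "?v b \<in> carrier (free_module R UNIV)" if "b \<in> res_gens R M (Suc n)" for b
    using v[OF that] sub by blast
  show "res_bd R f \<in> carrier (res_module R M n)" if f: "f \<in> carrier (res_module R M (Suc n))"
  proof -
    have eq: "finsum (free_module R UNIV) h A = finsum (res_module R M n) h A"
      if "finite A" "h \<in> A \<rightarrow> carrier (res_module R M n)" for A and h :: "('a, 'c) gen \<Rightarrow> _"
      using that
    proof (induction A)
      case (insert x F)
      hence "h \<in> F \<rightarrow> carrier (free_module R UNIV)" "h x \<in> carrier (free_module R UNIV)"
        using sub by auto
      thus ?case using insert by (simp add: add_eq)
    qed (simp add: add_eq)
    have "lin_ext R (res_module R M n) ?v f \<in> carrier (res_module R M n)"
      using P.lin_ext_closed f v unfolding res_module_def by blast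
    moreover have "lin_ext R (res_module R M n) ?v f = res_bd R f"
      unfolding res_bd_def lin_ext_def
    proof (subst eq)
      have "finite {b. f b \<noteq> \<zero>}" "\<And>b. f b \<noteq> \<zero> \<Longrightarrow> b \<in> res_gens R M (Suc n)"
        "\<And>b. f b \<noteq> \<zero> \<Longrightarrow> f b \<in> carrier R"
        using f unfolding res_module_def free_module_def by (auto simp del: res_gens.simps)
      thus "finite {b. f b \<noteq> \<zero>}"
        "(\<lambda>b. f b \<odot>\<^bsub>free_module R UNIV\<^esub> ?v b) \<in> {b. f b \<noteq> \<zero>} \<rightarrow> carrier (res_module R M n)"
        using v unfolding add_eq(3)[symmetric] by (auto simp del: res_gens.simps intro!: P.smult_closed)
    qed (simp add: add_eq)
    ultimately show ?thesis by simp
  qed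
  show "res_bd R (f \<oplus>\<^bsub>res_module R M (Suc n)\<^esub> g) = res_bd R f \<oplus>\<^bsub>res_module R M n\<^esub> res_bd R g"
    if "f \<in> carrier (res_module R M (Suc n))" "g \<in> carrier (res_module R M (Suc n))"
    using that vU unfolding res_bd_def add_eq unfolding res_module_def by (intro U.lin_ext_add) blast+
  show "res_bd R (r \<odot>\<^bsub>res_module R M (Suc n)\<^esub> f) = r \<odot>\<^bsub>res_module R M n\<^esub> res_bd R f"
    if "r \<in> carrier R" "f \<in> carrier (res_module R M (Suc n))"
    using that vU unfolding res_bd_def add_eq unfolding res_module_def by (intro U.lin_ext_smult) blast+
  show "res_bd R (\<lambda>x. if x = Syz xs then \<one> else \<zero>) = formal_comb R xs"
    if "Syz xs \<in> res_gens R M (Suc n)"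
    unfolding res_bd_def using vU[OF that] by (subst U.lin_ext_basis) auto
qed

lemma res_exact:
  assumes f: "f \<in> carrier (res_module R M n)"
  shows "(if n = 0 then res_aug R M f = \<zero>\<^bsub>M\<^esub> else res_bd R f = (\<lambda>_. \<zero>)) \<longleftrightarrow>
    f \<in> res_bd R ` carrier (res_module R M (Suc n))"
    (is "?Z f \<longleftrightarrow> _")
proof
  assume Z: "?Z f"
  obtain xs where xs: "set xs \<subseteq> carrier R \<times> res_gens R M n" "formal_comb R xs = f"
    using R.formal_comb_surj f unfolding res_module_def by metis
  hence g: "Syz xs \<in> res_gens R M (Suc n)" using Z by simp
  let ?e = "\<lambda>x. if x = Syz xs then \<one> else \<zero> :: 'a"
  have "finite {x. ?e x \<noteq> \<zero>}" by (rule finite_subset[of _ "{Syz xs}"]) auto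
  hence "?e \<in> carrier (res_module R M (Suc n))"
    using g by (auto simp: res_module_def free_module_def simp del: res_gens.simps)
  moreover have "res_bd R ?e = f" using res_bd_basis[OF g] xs by simp
  ultimately show "f \<in> res_bd R ` carrier (res_module R M (Suc n))" by (metis image_eqI)
next
  assume "f \<in> res_bd R ` carrier (res_module R M (Suc n))"
  then obtain g where g: "g \<in> carrier (res_module R M (Suc n))" "f = res_bd R g" by blast
  interpret Q: Module.module R "res_module R M n"
    unfolding res_module_def by (rule R.module_free_module)
  interpret U: Module.module R "free_module R (UNIV :: ('a, 'c) gen set)"
    by (rule R.module_free_module)
  let ?v = "\<lambda>b :: ('a, 'c) gen. case b of Elt m \<Rightarrow> (\<lambda>_. \<zero>) | Syz xs \<Rightarrow> formal_comb R xs"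
  let ?K = "{f \<in> carrier (res_module R M n). ?Z f}"
  have eqs: "x \<oplus>\<^bsub>res_module R M k\<^esub> y = x \<oplus>\<^bsub>free_module R UNIV\<^esub> y"
    "\<zero>\<^bsub>res_module R M k\<^esub> = \<zero>\<^bsub>free_module R UNIV\<^esub>"
    "r \<odot>\<^bsub>res_module R M k\<^esub> x = r \<odot>\<^bsub>free_module R UNIV\<^esub> x"
    "\<zero>\<^bsub>free_module R UNIV\<^esub> = (\<lambda>_. \<zero>)" for x y r k
    by (simp_all add: res_module_def free_module_def)
  have K0: "\<zero>\<^bsub>free_module R UNIV\<^esub> \<in> ?K"
    using Q.zero_closed
    by (auto simp: eqs res_aug_def res_bd_def lin_ext_def)
  have Ka: "x \<oplus>\<^bsub>free_module R UNIV\<^esub> y \<in> ?K" if "x \<in> ?K" "y \<in> ?K" for x y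
  proof (cases n)
    case 0
    thus ?thesis using that Q.a_closed[of x y] res_aug_add[of x y] by (simp add: eqs)
  next
    case (Suc m)
    thus ?thesis using that Q.a_closed[of x y] res_bd_add[of x m y]
      by (simp add: eqs) (simp add: free_module_def)
  qed
  have Ks: "r \<odot>\<^bsub>free_module R UNIV\<^esub> x \<in> ?K" if "r \<in> carrier R" "x \<in> ?K" for r x
  proof (cases n)
    case 0
    thus ?thesis using that Q.smult_closed[of r x] res_aug_smult[of r x] by (simp add: eqs)
  next
    case (Suc m)
    thus ?thesis using that Q.smult_closed[of r x] res_bd_smult[of r x m]
      by (simp add: eqs) (simp add: free_module_def)
  qed
  have sub: "?K \<subseteq> carrier (free_module R UNIV)"
    unfolding res_module_def using R.free_module_carrier_cong by blast
  have Kf: "finsum (free_module R UNIV) h A \<in> ?K"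
    if "finite A" "h \<in> A \<rightarrow> ?K" for A and h :: "('a, 'c) gen \<Rightarrow> _"
    using that
  proof (induction A)
    case empty
    show ?case using K0 by simp
  next
    case (insert x F)
    hence "h \<in> F \<rightarrow> carrier (free_module R UNIV)" "h x \<in> carrier (free_module R UNIV)"
      using sub by blast+
    moreover have "h x \<oplus>\<^bsub>free_module R UNIV\<^esub> finsum (free_module R UNIV) h F \<in> ?K"
      using insert by (intro Ka) auto
    ultimately show ?case using insert.hyps by simp
  qed
  have "finsum (free_module R UNIV) (\<lambda>b. g b \<odot>\<^bsub>free_module R UNIV\<^esub> ?v b) {b. g b \<noteq> \<zero>} \<in> ?K"
  proof (rule Kf)
    have "finite {b. g b \<noteq> \<zero>}" "\<And>b. g b \<noteq> \<zero> \<Longrightarrow> b \<in> res_gens R M (Suc n)"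
      "\<And>b. g b \<noteq> \<zero> \<Longrightarrow> g b \<in> carrier R"
      using g(1) unfolding res_module_def free_module_def by (auto simp del: res_gens.simps)
    moreover have "?v b \<in> ?K" if "b \<in> res_gens R M (Suc n)" for b
      using that R.formal_comb_closed by (auto simp: res_module_def)
    ultimately show "finite {b. g b \<noteq> \<zero>}"
      "(\<lambda>b. g b \<odot>\<^bsub>free_module R UNIV\<^esub> ?v b) \<in> {b. g b \<noteq> \<zero>} \<rightarrow> ?K"
      using Ks by blast+
  qed
  thus "?Z f" using g(2) unfolding res_bd_def lin_ext_def by simp
qed

end

section \<open>Ext is a module\<close>

lemma (in Module.module) quot_module_smult:
  assumes S: "submodule S R M" and r: "r \<in> carrier R" and x: "x \<in> carrier M"
  shows "r \<odot>\<^bsub>quot_module M S\<^esub> (S +>\<^bsub>M\<^esub> x) = S +>\<^bsub>M\<^esub> (r \<odot>\<^bsub>M\<^esub> x)"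
proof -
  interpret S: submodule S R M by (rule S)
  interpret Sg: subgroup S "add_monoid M" by (rule S.subgroup_axioms)
  have S0: "\<zero>\<^bsub>M\<^esub> \<in> S" using S.one_closed by simp
  have "S +>\<^bsub>M\<^esub> (r \<odot>\<^bsub>M\<^esub> y) = S +>\<^bsub>M\<^esub> (r \<odot>\<^bsub>M\<^esub> x)" if y: "y \<in> S +>\<^bsub>M\<^esub> x" for y
  proof -
    obtain s where s: "s \<in> S" "y = s \<oplus>\<^bsub>M\<^esub> x" using y by (auto simp: a_r_coset_def')
    have sc: "s \<in> carrier M" using s S.subset by auto
    have "r \<odot>\<^bsub>M\<^esub> y = (r \<odot>\<^bsub>M\<^esub> s) \<oplus>\<^bsub>M\<^esub> (r \<odot>\<^bsub>M\<^esub> x)"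
      using s sc r x by (simp add: smult_r_distr)
    hence "r \<odot>\<^bsub>M\<^esub> y \<in> S +>\<^bsub>M\<^esub> (r \<odot>\<^bsub>M\<^esub> x)"
      using S.smult_closed[OF r s(1)] by (auto simp: a_r_coset_def')
    thus ?thesis
      using M.add.repr_independence[of "r \<odot>\<^bsub>M\<^esub> y" S "r \<odot>\<^bsub>M\<^esub> x"] r x S.subgroup_axioms
      by (simp add: a_r_coset_def)
  qed
  moreover have "x \<in> S +>\<^bsub>M\<^esub> x"
    unfolding a_r_coset_def' using S0 x M.l_zero[OF x] by (metis (mono_tags, lifting) UN_I singletonI)
  ultimately have "(\<Union>y\<in>S +>\<^bsub>M\<^esub> x. S +>\<^bsub>M\<^esub> (r \<odot>\<^bsub>M\<^esub> y)) = S +>\<^bsub>M\<^esub> (r \<odot>\<^bsub>M\<^esub> x)"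
    by (intro UN_constant_eq) blast+
  thus ?thesis by (simp add: quot_module_def)
qed

lemma (in Module.module) module_quot_module:
  assumes S: "submodule S R M"
  shows "Module.module R (quot_module M S)"
proof -
  interpret S: submodule S R M by (rule S)
  interpret Q: comm_group "add_monoid M Mod S"
    by (rule M.add.abelian_FactGroup[OF S.subgroup_axioms])
  have eq: "carrier (quot_module M S) = carrier (add_monoid M Mod S)"
    "x \<oplus>\<^bsub>quot_module M S\<^esub> y = x \<otimes>\<^bsub>add_monoid M Mod S\<^esub> y"
    "\<zero>\<^bsub>quot_module M S\<^esub> = \<one>\<^bsub>add_monoid M Mod S\<^esub>" for x y
    by (simp_all add: quot_module_def FactGroup_def A_RCOSETS_def set_add_def)
  have ag: "abelian_group (quot_module M S)"
  proof (rule abelian_groupI, unfold eq)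
    fix x assume "x \<in> carrier (add_monoid M Mod S)"
    thus "\<exists>y\<in>carrier (add_monoid M Mod S). y \<otimes>\<^bsub>add_monoid M Mod S\<^esub> x = \<one>\<^bsub>add_monoid M Mod S\<^esub>"
      using Q.inv_closed Q.l_inv by blast
  qed (simp_all only: Q.m_closed Q.one_closed Q.m_ac Q.l_one Q.r_one)
  have E: "\<exists>x\<in>carrier M. C = S +>\<^bsub>M\<^esub> x" if "C \<in> carrier (quot_module M S)" for C
    using that by (auto simp: quot_module_def A_RCOSETS_def')
  have I: "S +>\<^bsub>M\<^esub> x \<in> carrier (quot_module M S)" if "x \<in> carrier M" for x
    using that by (auto simp: quot_module_def A_RCOSETS_def')
  have nS: "S \<lhd> add_monoid M" by (rule M.add.subgroup_imp_normal[OF S.subgroup_axioms])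
  have add: "(S +>\<^bsub>M\<^esub> x) \<oplus>\<^bsub>quot_module M S\<^esub> (S +>\<^bsub>M\<^esub> y) = S +>\<^bsub>M\<^esub> (x \<oplus>\<^bsub>M\<^esub> y)"
    if "x \<in> carrier M" "y \<in> carrier M" for x y
    using normal.rcos_sum[OF nS] that by (simp add: quot_module_def set_add_def a_r_coset_def)
  note q = quot_module_smult[OF S]
  show ?thesis
  proof (rule moduleI[OF R.is_cring ag])
    fix a C assume a: "a \<in> carrier R" and "C \<in> carrier (quot_module M S)"
    with E obtain x where x: "x \<in> carrier M" "C = S +>\<^bsub>M\<^esub> x" by blast
    show "a \<odot>\<^bsub>quot_module M S\<^esub> C \<in> carrier (quot_module M S)"
      using a x by (simp add: q I)
    fix b assume b: "b \<in> carrier R"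
    show "(a \<oplus> b) \<odot>\<^bsub>quot_module M S\<^esub> C = a \<odot>\<^bsub>quot_module M S\<^esub> C \<oplus>\<^bsub>quot_module M S\<^esub> b \<odot>\<^bsub>quot_module M S\<^esub> C"
      using a b x by (simp add: q add smult_l_distr)
    show "(a \<otimes> b) \<odot>\<^bsub>quot_module M S\<^esub> C = a \<odot>\<^bsub>quot_module M S\<^esub> (b \<odot>\<^bsub>quot_module M S\<^esub> C)"
      using a b x by (simp add: q smult_assoc1)
  next
    fix a C D assume a: "a \<in> carrier R" and "C \<in> carrier (quot_module M S)" "D \<in> carrier (quot_module M S)"
    with E obtain x y where "x \<in> carrier M" "C = S +>\<^bsub>M\<^esub> x" "y \<in> carrier M" "D = S +>\<^bsub>M\<^esub> y" by blast
    thus "a \<odot>\<^bsub>quot_module M S\<^esub> (C \<oplus>\<^bsub>quot_module M S\<^esub> D) =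
        a \<odot>\<^bsub>quot_module M S\<^esub> C \<oplus>\<^bsub>quot_module M S\<^esub> a \<odot>\<^bsub>quot_module M S\<^esub> D"
      using a by (simp add: q add smult_r_distr)
  next
    fix C assume "C \<in> carrier (quot_module M S)"
    with E obtain x where "x \<in> carrier M" "C = S +>\<^bsub>M\<^esub> x" by blast
    thus "\<one> \<odot>\<^bsub>quot_module M S\<^esub> C = C" by (simp add: q)
  qed
qed

lemma module_hom_module:
  assumes "Module.module R M" "Module.module R N"
  shows "Module.module R (hom_module R M N)"
proof -
  interpret M: Module.module R M by fact
  interpret N: Module.module R N by fact
  have c: "f x \<in> carrier N" if "f \<in> lin_maps R M N" "x \<in> carrier M" for f x
    using that by (auto simp: lin_maps_def)
  have und: "f x = undefined" if "f \<in> lin_maps R M N" "x \<notin> carrier M" for f x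
    using that by (auto simp: lin_maps_def PiE_def extensional_def)
  have add: "(\<lambda>x\<in>carrier M. f x \<oplus>\<^bsub>N\<^esub> g x) \<in> lin_maps R M N"
    if "f \<in> lin_maps R M N" "g \<in> lin_maps R M N" for f g
    using that c[OF that(1)] c[OF that(2)]
    by (auto simp: lin_maps_def N.a_ac N.smult_r_distr)
  have zero: "(\<lambda>x\<in>carrier M. \<zero>\<^bsub>N\<^esub>) \<in> lin_maps R M N"
    by (auto simp: lin_maps_def)
  have smult: "(\<lambda>x\<in>carrier M. r \<odot>\<^bsub>N\<^esub> f x) \<in> lin_maps R M N"
    if "r \<in> carrier R" "f \<in> lin_maps R M N" for r f
    using that c[OF that(2)]
    by (auto simp: lin_maps_def N.smult_r_distr M.R.m_comm simp flip: N.smult_assoc1)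
  have "abelian_group (hom_module R M N)"
  proof (rule abelian_groupI)
    fix f assume f: "f \<in> carrier (hom_module R M N)"
    thus "\<exists>g\<in>carrier (hom_module R M N). g \<oplus>\<^bsub>hom_module R M N\<^esub> f = \<zero>\<^bsub>hom_module R M N\<^esub>"
      using c smult[of "\<ominus>\<^bsub>R\<^esub> \<one>\<^bsub>R\<^esub>" f]
      by (intro bexI[of _ "\<lambda>x\<in>carrier M. (\<ominus>\<^bsub>R\<^esub> \<one>\<^bsub>R\<^esub>) \<odot>\<^bsub>N\<^esub> f x"])
         (auto simp: hom_module_def fun_eq_iff N.smult_l_minus N.l_neg)
  qed (auto simp: hom_module_def add zero c fun_eq_iff und N.a_ac)
  thus ?thesis
    by (intro moduleI M.R.is_cring)
       (auto simp: hom_module_def smult add c und fun_eq_iff N.smult_l_distr N.smult_r_distr N.smult_assoc1)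
qed

lemma (in Module.module) submoduleI_smult:
  assumes "H \<subseteq> carrier M" "\<zero>\<^bsub>M\<^esub> \<in> H" "\<And>a b. a \<in> H \<Longrightarrow> b \<in> H \<Longrightarrow> a \<oplus>\<^bsub>M\<^esub> b \<in> H"
    "\<And>a x. a \<in> carrier R \<Longrightarrow> x \<in> H \<Longrightarrow> a \<odot>\<^bsub>M\<^esub> x \<in> H"
  shows "submodule H R M"
proof (rule submoduleI)
  fix a assume a: "a \<in> H"
  hence "\<ominus>\<^bsub>M\<^esub> a = (\<ominus> \<one>) \<odot>\<^bsub>M\<^esub> a" using assms(1) by (auto simp: smult_l_minus)
  thus "\<ominus>\<^bsub>M\<^esub> a \<in> H" using assms(4)[of "\<ominus> \<one>" a] a by simp
qed (use assms in auto)

theorem module_Ext: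
  assumes "Module.module R M" "Module.module R N"
  shows "Module.module R (Ext R l M N)"
proof -
  let ?P = "res_module R M"
  interpret M: Module.module R M by fact
  interpret N: Module.module R N by fact
  have P: "Module.module R (?P n)" for n
    unfolding res_module_def by (rule M.R.module_free_module)
  note Pa = abelian_monoid.a_closed[OF abelian_group.axioms(1)[OF Module.module.axioms(2)[OF P]]]
  note Ps = Module.module.smult_closed[OF P]
  interpret H: Module.module R "hom_module R (?P l) N"
    by (rule module_hom_module[OF P assms(2)])
  let ?Z = "{f \<in> lin_maps R (?P l) N. \<forall>x\<in>carrier (?P (Suc l)). f (res_bd R x) = \<zero>\<^bsub>N\<^esub>}"
  let ?B = "case l of 0 \<Rightarrow> {\<zero>\<^bsub>hom_module R (?P 0) N\<^esub>}
      | Suc k \<Rightarrow> (\<lambda>g. \<lambda>x\<in>carrier (?P (Suc k)). g (res_bd R x)) ` lin_maps R (?P k) N"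
  have c: "f x \<in> carrier N" if "f \<in> lin_maps R (?P n) N" "x \<in> carrier (?P n)" for f x n
    using that by (auto simp: lin_maps_def)
  have Hs: "carrier (hom_module R (?P n) N) = lin_maps R (?P n) N"
    "\<zero>\<^bsub>hom_module R (?P n) N\<^esub> = (\<lambda>x\<in>carrier (?P n). \<zero>\<^bsub>N\<^esub>)"
    "f \<oplus>\<^bsub>hom_module R (?P n) N\<^esub> g = (\<lambda>x\<in>carrier (?P n). f x \<oplus>\<^bsub>N\<^esub> g x)"
    "r \<odot>\<^bsub>hom_module R (?P n) N\<^esub> f = (\<lambda>x\<in>carrier (?P n). r \<odot>\<^bsub>N\<^esub> f x)" for n f g r
    by (simp_all add: hom_module_def)
  have Z: "submodule ?Z R (hom_module R (?P l) N)"
    using H.zero_closed H.a_closed H.smult_closed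
    by (intro H.submoduleI_smult) (auto simp: Hs M.res_bd_closed)
  interpret Z: Module.module R "(hom_module R (?P l) N)\<lparr>carrier := ?Z\<rparr>"
    by (rule submodule.submodule_is_module[OF Z H.module_axioms])
  have B: "submodule ?B R ((hom_module R (?P l) N)\<lparr>carrier := ?Z\<rparr>)"
  proof (cases l)
    case 0
    show ?thesis
      using Z.zero_closed Z.r_zero[OF Z.zero_closed] Z.smult_r_null
      by (intro Z.submoduleI_smult) (simp_all add: 0 del: res_gens.simps)
  next
    case (Suc k)
    interpret K: Module.module R "hom_module R (?P k) N"
      by (rule module_hom_module[OF P assms(2)])
    let ?d = "\<lambda>g. \<lambda>x\<in>carrier (?P (Suc k)). g (res_bd R x)"
    have bc: "res_bd R x \<in> carrier (?P k)" if "x \<in> carrier (?P (Suc k))" for x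
      using that by (rule M.res_bd_closed)
    have dZ: "?d g \<in> ?Z" if g: "g \<in> lin_maps R (?P k) N" for g
    proof -
      have g0: "g \<zero>\<^bsub>?P k\<^esub> = \<zero>\<^bsub>N\<^esub>"
      proof -
        interpret Pk: Module.module R "?P k" by (rule P)
        have "g (\<zero>\<^bsub>?P k\<^esub> \<oplus>\<^bsub>?P k\<^esub> \<zero>\<^bsub>?P k\<^esub>) = g \<zero>\<^bsub>?P k\<^esub> \<oplus>\<^bsub>N\<^esub> g \<zero>\<^bsub>?P k\<^esub>"
          using g Pk.zero_closed unfolding lin_maps_def by blast
        hence "g \<zero>\<^bsub>?P k\<^esub> \<oplus>\<^bsub>N\<^esub> g \<zero>\<^bsub>?P k\<^esub> = g \<zero>\<^bsub>?P k\<^esub>"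
          by (simp only: Pk.l_zero[OF Pk.zero_closed])
        thus ?thesis using N.add.l_cancel_one[OF c[OF g Pk.zero_closed] c[OF g Pk.zero_closed]] by simp
      qed
      have "?d g \<in> lin_maps R (?P (Suc k)) N"
        using g c[OF g] bc
        by (auto simp: lin_maps_def M.res_bd_add M.res_bd_smult Pa Ps simp del: res_gens.simps)
      moreover have "?d g (res_bd R x) = \<zero>\<^bsub>N\<^esub>" if x: "x \<in> carrier (?P (Suc (Suc k)))" for x
      proof -
        have 1: "res_bd R x \<in> carrier (?P (Suc k))" using x by (rule M.res_bd_closed)
        have "res_bd R (res_bd R x) = (\<lambda>_. \<zero>\<^bsub>R\<^esub>)"
          using M.res_exact[OF 1] x by auto
        also have "\<dots> = \<zero>\<^bsub>?P k\<^esub>" by (simp add: res_module_def free_module_def)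
        finally show ?thesis using 1 g0 by simp
      qed
      ultimately show ?thesis using Suc by blast
    qed
    have B: "?B = ?d ` carrier (hom_module R (?P k) N)" by (simp add: Suc Hs)
    show ?thesis unfolding B
    proof (rule Z.submoduleI_smult)
      show "?d ` carrier (hom_module R (?P k) N) \<subseteq> carrier (hom_module R (?P l) N\<lparr>carrier := ?Z\<rparr>)"
        using dZ by (auto simp: Hs)
      have "\<zero>\<^bsub>hom_module R (?P l) N\<^esub> = ?d \<zero>\<^bsub>hom_module R (?P k) N\<^esub>"
        using bc by (auto simp: Hs Suc fun_eq_iff)
      thus "\<zero>\<^bsub>hom_module R (?P l) N\<lparr>carrier := ?Z\<rparr>\<^esub> \<in> ?d ` carrier (hom_module R (?P k) N)"
        using K.zero_closed by auto
    next
      fix a b assume "a \<in> ?d ` carrier (hom_module R (?P k) N)" "b \<in> ?d ` carrier (hom_module R (?P k) N)"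
      then obtain f g where f: "f \<in> carrier (hom_module R (?P k) N)" "a = ?d f"
        "g \<in> carrier (hom_module R (?P k) N)" "b = ?d g" by blast
      have "a \<oplus>\<^bsub>hom_module R (?P l) N\<^esub> b = ?d (f \<oplus>\<^bsub>hom_module R (?P k) N\<^esub> g)"
        using bc f by (auto simp: Hs Suc fun_eq_iff)
      thus "a \<oplus>\<^bsub>hom_module R (?P l) N\<lparr>carrier := ?Z\<rparr>\<^esub> b \<in> ?d ` carrier (hom_module R (?P k) N)"
        using K.a_closed[OF f(1,3)] by auto
    next
      fix r a assume r: "r \<in> carrier R" and "a \<in> ?d ` carrier (hom_module R (?P k) N)"
      then obtain f where f: "f \<in> carrier (hom_module R (?P k) N)" "a = ?d f" by blast
      have "r \<odot>\<^bsub>hom_module R (?P l) N\<^esub> a = ?d (r \<odot>\<^bsub>hom_module R (?P k) N\<^esub> f)"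
        using bc f by (auto simp: Hs Suc fun_eq_iff)
      thus "r \<odot>\<^bsub>hom_module R (?P l) N\<lparr>carrier := ?Z\<rparr>\<^esub> a \<in> ?d ` carrier (hom_module R (?P k) N)"
        using K.smult_closed[OF r f(1)] by auto
    qed
  qed
  show ?thesis
    unfolding Ext_def hom_cohomology_def by (rule Z.module_quot_module[OF B])
qed

end

theory Submission
  imports Defs "HOL-Algebra.Multiplicative_Group" "HOL-Algebra.Sylow"
begin

text \<open>
  If \<open>H\<close> and \<open>J\<close> are not \<open>p\<close>-equivalent, some element of \<open>A(G)\<close> has mark \<open>0\<close> at \<open>H\<close> and
  mark prime to \<open>p\<close> at \<open>J\<close>. It acts on \<open>Ext(Z_H, Z_J)\<close> both as \<open>0\<close> and as an integer prime
  to \<open>p\<close>, so the \<open>p\<close>-part vanishes.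

  If \<open>{(H), (J)}\<close> is a class of size two, choose \<open>e, u, v\<close> whose marks vanish outside this class,
  where \<open>e\<close> has marks prime to \<open>p\<close> on it, \<open>u\<close> has mark \<open>0\<close> at \<open>H\<close> and \<open>p\<close> times an integer
  prime to \<open>p\<close> at \<open>J\<close>, and \<open>v\<close> is as \<open>u\<close> with \<open>H\<close> and \<open>J\<close> exchanged. This is possible because
  \<open>p\<^sup>2\<close> does not divide \<open>|G|\<close>. Marks are jointly injective, so the periodic complex
  \<open>\<dots> \<rightarrow> A(G) \<rightarrow> A(G) \<rightarrow> A(G)\<close> with differentials \<open>u, v, u, v, \<dots>\<close> (starting from degree \<open>0\<close>)
  resolves \<open>Z_H\<close> up to powers of \<open>e\<close>. Hence, up to integers prime to \<open>p\<close>, \<open>Ext\<close> is the cohomology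
  of a complex of copies of the integers with differentials alternately \<open>0\<close> and \<open>p\<close>. If \<open>(H)\<close> is
  alone in its class, one may take \<open>u = v = 0\<close> and the complex is concentrated in degree \<open>0\<close>.

  Classes have at most two elements because of two non-conjugate \<open>p\<close>-equivalent subgroups exactly
  one has order divisible by \<open>p\<close>.
\<close>

section \<open>Linear maps out of free modules\<close>

text \<open>Ext is defined by one canonical resolution, so the periodic complex cannot simply be
  substituted for it. The two are compared by maps in both directions, \<open>q\<close> into the
  canonical resolution and \<open>\<beta>\<close> out of it, and A(G) is never localized at p. In
  place of a p-local idempotent there is \<open>e\<close>: the composite of the two maps is
  homotopic not to the identity but to a power of \<open>e\<close>, which is harmless on the p-part
  because \<open>e\<close> acts on the coefficients as an integer prime to p. The order of G enters
  through coset spaces. If J is not conjugate to H and at least as large, J has no fixed point on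
  G/H while H has |N(H)|/|H| of them. So the marks of G/H differ by a divisor of |G|; under
  p-equivalence it is p times an integer prime to p, the source of the factor p in \<open>u\<close>
  and \<open>v\<close>. Also p divides |N(H)|/|H|, hence not |H|. If p did not divide |J| either,
  take HQ with Q of order p in N(H): it is p-equivalent to H and J, so J fixes a point of G/HQ and
  is conjugate into HQ. Elements of HQ of order prime to p lie in H, so J would be conjugate to
  H.\<close>

definition linear_on :: "('r, 'a) ring_scheme \<Rightarrow> ('r, 'm, 'b) module_scheme \<Rightarrow>
    ('r, 'n, 'c) module_scheme \<Rightarrow> ('m \<Rightarrow> 'n) \<Rightarrow> bool" where
  "linear_on R M N f \<longleftrightarrow> f \<in> carrier M \<rightarrow> carrier N \<and>
     (\<forall>x\<in>carrier M. \<forall>y\<in>carrier M. f (x \<oplus>\<^bsub>M\<^esub> y) = f x \<oplus>\<^bsub>N\<^esub> f y) \<and>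
     (\<forall>r\<in>carrier R. \<forall>x\<in>carrier M. f (r \<odot>\<^bsub>M\<^esub> x) = r \<odot>\<^bsub>N\<^esub> f x)"

lemma linear_onI:
  assumes "\<And>x. x \<in> carrier M \<Longrightarrow> f x \<in> carrier N"
    "\<And>x y. x \<in> carrier M \<Longrightarrow> y \<in> carrier M \<Longrightarrow> f (x \<oplus>\<^bsub>M\<^esub> y) = f x \<oplus>\<^bsub>N\<^esub> f y"
    "\<And>r x. r \<in> carrier R \<Longrightarrow> x \<in> carrier M \<Longrightarrow> f (r \<odot>\<^bsub>M\<^esub> x) = r \<odot>\<^bsub>N\<^esub> f x"
  shows "linear_on R M N f"
  using assms by (auto simp: linear_on_def)

lemma linear_onD:
  assumes "linear_on R M N f"
  shows "x \<in> carrier M \<Longrightarrow> f x \<in> carrier N"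
    "x \<in> carrier M \<Longrightarrow> y \<in> carrier M \<Longrightarrow> f (x \<oplus>\<^bsub>M\<^esub> y) = f x \<oplus>\<^bsub>N\<^esub> f y"
    "r \<in> carrier R \<Longrightarrow> x \<in> carrier M \<Longrightarrow> f (r \<odot>\<^bsub>M\<^esub> x) = r \<odot>\<^bsub>N\<^esub> f x"
  using assms by (auto simp: linear_on_def)

text \<open>Members of \<open>lin_maps\<close> are extensional, a property that composites and
  pointwise sums lack. \<open>linear_on\<close> drops it, and restricting to the carrier recovers
  it.\<close>

lemma lin_maps_iff: "f \<in> lin_maps R M N \<longleftrightarrow> linear_on R M N f \<and> f \<in> extensional (carrier M)"
  by (auto simp: lin_maps_def linear_on_def PiE_def)

lemma linear_on_compose:
  "linear_on R M N f \<Longrightarrow> linear_on R N P g \<Longrightarrow> linear_on R M P (\<lambda>x. g (f x))"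
  by (rule linear_onI) (simp_all add: linear_onD)

lemma linear_on_cong:
  assumes "Module.module R M" "\<And>x. x \<in> carrier M \<Longrightarrow> f x = g x" "linear_on R M N g"
  shows "linear_on R M N f"
proof -
  interpret M: Module.module R M by fact
  show ?thesis by (rule linear_onI) (simp_all add: assms(2) linear_onD[OF assms(3)])
qed

lemma linear_on_diff:
  assumes "Module.module R M" "Module.module R N" "linear_on R M N f" "linear_on R M N g"
  shows "linear_on R M N (\<lambda>x. f x \<ominus>\<^bsub>N\<^esub> g x)"
proof -
  interpret M: Module.module R M by fact
  interpret N: Module.module R N by fact
  show ?thesis
    by (rule linear_onI)
      (use assms(3,4) in \<open>auto simp: linear_onD N.minus_eq N.minus_add N.a_ac N.smult_r_distr N.smult_r_minus\<close>)
qed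

lemma linear_on_scale:
  assumes "Module.module R M" "Module.module R N" "linear_on R M N f" "a \<in> carrier R"
  shows "linear_on R M N (\<lambda>x. a \<odot>\<^bsub>N\<^esub> f x)"
proof -
  interpret M: Module.module R M by fact
  interpret N: Module.module R N by fact
  show ?thesis
    by (rule linear_onI)
      (use assms(3,4) in \<open>auto simp: linear_onD N.smult_r_distr M.R.m_comm simp flip: N.smult_assoc1\<close>)
qed

lemma linear_on_add:
  assumes "Module.module R M" "Module.module R N" "linear_on R M N f" "linear_on R M N g"
  shows "linear_on R M N (\<lambda>x. f x \<oplus>\<^bsub>N\<^esub> g x)"
proof -
  interpret M: Module.module R M by fact
  interpret N: Module.module R N by fact
  show ?thesis
    by (rule linear_onI)
      (use assms(3,4) in \<open>auto simp: linear_onD N.a_ac N.smult_r_distr\<close>)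
qed

lemma linear_on_zero:
  assumes "Module.module R M" "Module.module R N" "linear_on R M N f"
  shows "f \<zero>\<^bsub>M\<^esub> = \<zero>\<^bsub>N\<^esub>"
proof -
  interpret M: Module.module R M by fact
  interpret N: Module.module R N by fact
  have "f (\<zero>\<^bsub>R\<^esub> \<odot>\<^bsub>M\<^esub> \<zero>\<^bsub>M\<^esub>) = \<zero>\<^bsub>R\<^esub> \<odot>\<^bsub>N\<^esub> f \<zero>\<^bsub>M\<^esub>"
    by (rule linear_onD(3)[OF assms(3)]) auto
  thus ?thesis using linear_onD(1)[OF assms(3) M.zero_closed] by simp
qed

definition unit_vec :: "('r, 'a) ring_scheme \<Rightarrow> 'b \<Rightarrow> 'b \<Rightarrow> 'r" where
  "unit_vec R b = (\<lambda>x. if x = b then \<one>\<^bsub>R\<^esub> else \<zero>\<^bsub>R\<^esub>)"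

lemma free_module_simps [simp]:
  "(f \<oplus>\<^bsub>free_module R B\<^esub> g) = (\<lambda>b. f b \<oplus>\<^bsub>R\<^esub> g b)"
  "(r \<odot>\<^bsub>free_module R B\<^esub> f) = (\<lambda>b. r \<otimes>\<^bsub>R\<^esub> f b)"
  "\<zero>\<^bsub>free_module R B\<^esub> = (\<lambda>b. \<zero>\<^bsub>R\<^esub>)"
  by (simp_all add: free_module_def)

context cring begin

lemma unit_vec_closed: "b \<in> B \<Longrightarrow> unit_vec R b \<in> carrier (free_module R B)"
  using finite_subset[of "{x. x = b \<and> \<one> \<noteq> \<zero>}" "{b}"]
  by (auto simp: free_module_def unit_vec_def)

text \<open>Elements of a free module are values of \<open>formal_comb\<close>, so induction on a
  list replaces induction on the finite support.\<close>

lemma free_module_linear_eqI: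
  assumes "Module.module R N" "linear_on R (free_module R B) N f" "linear_on R (free_module R B) N g"
    and eq: "\<And>b. b \<in> B \<Longrightarrow> f (unit_vec R b) = g (unit_vec R b)"
    and x: "x \<in> carrier (free_module R B)"
  shows "f x = g x"
proof -
  obtain xs where xs: "set xs \<subseteq> carrier R \<times> B" "formal_comb R xs = x"
    using formal_comb_surj[OF x] by blast
  interpret F: Module.module R "free_module R B" by (rule module_free_module)
  have "f (formal_comb R xs) = g (formal_comb R xs)" using xs(1)
  proof (induction xs)
    case Nil
    show ?case
      using linear_on_zero[OF F.module_axioms assms(1,2)] linear_on_zero[OF F.module_axioms assms(1,3)]
      by simp
  next
    case (Cons y ys)
    obtain r b where y: "y = (r, b)" by (cases y)
    hence rb: "r \<in> carrier R" "b \<in> B" "set ys \<subseteq> carrier R \<times> B" using Cons by auto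
    have c: "formal_comb R ys \<in> carrier (free_module R B)" by (rule formal_comb_closed[OF rb(3)])
    have u: "unit_vec R b \<in> carrier (free_module R B)" by (rule unit_vec_closed[OF rb(2)])
    have cc: "formal_comb R ys z \<in> carrier R" for z
      using c by (cases "z \<in> B") (auto simp: free_module_def)
    have "formal_comb R (y # ys) = (r \<odot>\<^bsub>free_module R B\<^esub> unit_vec R b) \<oplus>\<^bsub>free_module R B\<^esub> formal_comb R ys"
      using rb cc by (auto simp: y fun_eq_iff unit_vec_def)
    thus ?case
      using Cons.IH[OF rb(3)] rb c u F.smult_closed[OF rb(1) u]
      by (simp only: linear_onD(2,3)[OF assms(2)] linear_onD(2,3)[OF assms(3)] eq)
  qed
  thus ?thesis using xs by simp
qed

text \<open>Projectivity of free modules: preimages are chosen on the basis and extended by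
  \<open>lin_ext\<close>. Exactness of a target complex enters through the last hypothesis.\<close>

lemma free_module_lift:
  assumes "Module.module R N" "Module.module R N'" "linear_on R N N' \<delta>"
    "linear_on R (free_module R B) N' T"
    "\<And>x. x \<in> carrier (free_module R B) \<Longrightarrow> T x \<in> \<delta> ` carrier N"
  obtains s where "linear_on R (free_module R B) N s"
    "\<And>x. x \<in> carrier (free_module R B) \<Longrightarrow> \<delta> (s x) = T x"
proof -
  interpret N: Module.module R N by fact
  have "\<forall>b. \<exists>v. b \<in> B \<longrightarrow> v \<in> carrier N \<and> \<delta> v = T (unit_vec R b)"
  proof
    fix b
    show "\<exists>v. b \<in> B \<longrightarrow> v \<in> carrier N \<and> \<delta> v = T (unit_vec R b)"
    proof (cases "b \<in> B")
      case True
      from assms(5)[OF unit_vec_closed[OF True]] show ?thesis by (auto simp: image_iff)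
    qed simp
  qed
  then obtain v where v: "\<And>b. b \<in> B \<Longrightarrow> v b \<in> carrier N \<and> \<delta> (v b) = T (unit_vec R b)" by metis
  have s: "linear_on R (free_module R B) N (lin_ext R N v)"
  proof (rule linear_onI)
    show "lin_ext R N v x \<in> carrier N" if "x \<in> carrier (free_module R B)" for x
      using N.lin_ext_closed[OF that] v by blast
    show "lin_ext R N v (x \<oplus>\<^bsub>free_module R B\<^esub> y) = lin_ext R N v x \<oplus>\<^bsub>N\<^esub> lin_ext R N v y"
      if "x \<in> carrier (free_module R B)" "y \<in> carrier (free_module R B)" for x y
      using N.lin_ext_add[OF that] v by blast
    show "lin_ext R N v (r \<odot>\<^bsub>free_module R B\<^esub> x) = r \<odot>\<^bsub>N\<^esub> lin_ext R N v x"
      if "r \<in> carrier R" "x \<in> carrier (free_module R B)" for r x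
      using N.lin_ext_smult[OF that] v by blast
  qed
  show thesis
  proof (rule that[OF s])
    show "\<delta> (lin_ext R N v x) = T x" if "x \<in> carrier (free_module R B)" for x
      by (rule free_module_linear_eqI[OF assms(2) linear_on_compose[OF s assms(3)] assms(4) _ that])
        (use v N.lin_ext_basis[of v] in \<open>simp add: unit_vec_def\<close>)
  qed
qed

end

definition regular_module :: "('r, 'a) ring_scheme \<Rightarrow> ('r, 'r) module" where
  "regular_module R = \<lparr>carrier = carrier R, monoid.mult = undefined, one = undefined,
     zero = \<zero>\<^bsub>R\<^esub>, add = add R, smult = monoid.mult R\<rparr>"

lemma regular_module_simps [simp]:
  "carrier (regular_module R) = carrier R" "\<zero>\<^bsub>regular_module R\<^esub> = \<zero>\<^bsub>R\<^esub>"
  "x \<oplus>\<^bsub>regular_module R\<^esub> y = x \<oplus>\<^bsub>R\<^esub> y" "x \<odot>\<^bsub>regular_module R\<^esub> y = x \<otimes>\<^bsub>R\<^esub> y"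
  by (simp_all add: regular_module_def)

lemma (in cring) module_regular_module: "Module.module R (regular_module R)"
proof (rule moduleI)
  show "abelian_group (regular_module R)"
    by (rule abelian_groupI) (auto simp: a_ac intro: bexI[of _ "\<ominus> _"] l_neg)
qed (auto simp: is_cring m_assoc l_distr r_distr)

text \<open>Abstracts from \<open>mark_module\<close>, so that Ext can be computed over any
  commutative ring with characters to the integers.\<close>

definition int_module :: "('r \<Rightarrow> int) \<Rightarrow> ('r, int) module" where
  "int_module k = \<lparr>carrier = UNIV, monoid.mult = (*), one = 1, zero = 0, add = (+),
     smult = (\<lambda>a n. k a * n)\<rparr>"

lemma int_module_simps [simp]:
  "carrier (int_module k) = UNIV" "\<zero>\<^bsub>int_module k\<^esub> = 0"
  "x \<oplus>\<^bsub>int_module k\<^esub> y = x + y" "a \<odot>\<^bsub>int_module k\<^esub> y = k a * y"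
  by (simp_all add: int_module_def)

section \<open>Modules of rank one over the integers\<close>

locale int_character = cring R for R :: "('r, 'a) ring_scheme" (structure) +
  fixes k :: "'r \<Rightarrow> int"
  assumes char_add: "x \<in> carrier R \<Longrightarrow> y \<in> carrier R \<Longrightarrow> k (x \<oplus> y) = k x + k y"
    and char_mult: "x \<in> carrier R \<Longrightarrow> y \<in> carrier R \<Longrightarrow> k (x \<otimes> y) = k x * k y"
    and char_one: "k \<one> = 1"
begin

lemma module_int_module: "Module.module R (int_module k)"
proof (rule moduleI)
  show "abelian_group (int_module k)"
    by (rule abelian_groupI) (auto intro: exI[of _ "- _"])
qed (auto simp: is_cring char_add char_mult char_one algebra_simps)

lemma char_zero: "k \<zero> = 0"
  using char_add[of \<zero> \<zero>] by simp

lemma char_neg: "x \<in> carrier R \<Longrightarrow> k (\<ominus> x) = - k x"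
  using char_add[of x "\<ominus> x"] by (simp add: r_neg char_zero)

lemma char_pow: "x \<in> carrier R \<Longrightarrow> k (x [^] (n::nat)) = k x ^ n"
  by (induction n) (simp_all add: char_one char_mult)

lemma linear_on_char: "linear_on R (regular_module R) (int_module k) k"
  by (rule linear_onI) (auto simp: char_add char_mult)

end

text \<open>The n-fold sum of \<one>. A single \<open>r\<close> works for all characters at once, so
  it can shift or scale all marks simultaneously.\<close>

lemma (in cring) int_multipleE:
  fixes n :: int
  obtains r where "r \<in> carrier R" "\<And>k. int_character R k \<Longrightarrow> k r = n"
proof -
  have nat: "\<exists>r\<in>carrier R. \<forall>k. int_character R k \<longrightarrow> k r = int m" for m
  proof (induction m)
    case 0
    show ?case by (auto intro!: bexI[of _ \<zero>] simp: int_character.char_zero)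
  next
    case (Suc m)
    then obtain r where "r \<in> carrier R" "\<forall>k. int_character R k \<longrightarrow> k r = int m" by blast
    thus ?case
      by (auto intro!: bexI[of _ "\<one> \<oplus> r"] simp: int_character.char_add int_character.char_one)
  qed
  show thesis
  proof (cases n rule: int_cases2)
    case (nonneg m)
    thus ?thesis using nat[of m] that by auto
  next
    case (nonpos m)
    obtain r where "r \<in> carrier R" "\<forall>k. int_character R k \<longrightarrow> k r = int m" using nat by blast
    thus ?thesis using nonpos that[of "\<ominus> r"] by (simp add: int_character.char_neg)
  qed
qed

lemma (in int_character) char_surj:
  obtains r where "r \<in> carrier R" "k r = n"
  using int_multipleE[of n] int_character_axioms by blast

section \<open>Homotopies on the canonical resolution\<close>

context Module.module begin

lemma module_res_module: "Module.module R (res_module R M n)"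
  unfolding res_module_def by (rule R.module_free_module)

lemma linear_res_bd: "linear_on R (res_module R M (Suc n)) (res_module R M n) (res_bd R)"
  by (intro linear_onI res_bd_closed res_bd_add res_bd_smult)

lemma linear_res_aug: "linear_on R (res_module R M 0) M (res_aug R M)"
  by (intro linear_onI res_aug_closed res_aug_add res_aug_smult)

lemma res_module_zero: "\<zero>\<^bsub>res_module R M n\<^esub> = (\<lambda>_. \<zero>)"
  by (simp add: res_module_def)

lemma res_bd_exact:
  assumes "f \<in> carrier (res_module R M (Suc n))"
  shows "res_bd R f = \<zero>\<^bsub>res_module R M n\<^esub> \<longleftrightarrow> f \<in> res_bd R ` carrier (res_module R M (Suc (Suc n)))"
  using res_exact[OF assms] by (simp add: res_module_zero)

lemma res_aug_exact:
  assumes "f \<in> carrier (res_module R M 0)"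
  shows "res_aug R M f = \<zero>\<^bsub>M\<^esub> \<longleftrightarrow> f \<in> res_bd R ` carrier (res_module R M (Suc 0))"
  using res_exact[OF assms] by simp

lemma res_bd_bd:
  assumes "f \<in> carrier (res_module R M (Suc (Suc n)))"
  shows "res_bd R (res_bd R f) = \<zero>\<^bsub>res_module R M n\<^esub>"
  using res_bd_exact[of "res_bd R f" n] assms res_bd_closed by blast

lemma res_aug_bd:
  assumes "f \<in> carrier (res_module R M (Suc 0))"
  shows "res_aug R M (res_bd R f) = \<zero>\<^bsub>M\<^esub>"
  using res_aug_exact[of "res_bd R f"] assms res_bd_closed by blast

lemma res_lift:
  assumes "Module.module R N" "Module.module R N'" "linear_on R N N' \<delta>"
    "linear_on R (res_module R M n) N' T"
    "\<And>x. x \<in> carrier (res_module R M n) \<Longrightarrow> T x \<in> \<delta> ` carrier N"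
  obtains s where "linear_on R (res_module R M n) N s"
    "\<And>x. x \<in> carrier (res_module R M n) \<Longrightarrow> \<delta> (s x) = T x"
  using R.free_module_lift[OF assms(1-3), of "res_gens R M n" T] assms(4,5)
  unfolding res_module_def by blast

end

lemma linear_on_neg:
  assumes "Module.module R M" "Module.module R N" "linear_on R M N f" "x \<in> carrier M"
  shows "f (\<ominus>\<^bsub>M\<^esub> x) = \<ominus>\<^bsub>N\<^esub> f x"
proof -
  interpret M: Module.module R M by fact
  interpret N: Module.module R N by fact
  have c: "f (\<ominus>\<^bsub>M\<^esub> x) \<in> carrier N" "f x \<in> carrier N"
    using linear_onD(1)[OF assms(3)] assms(4) by auto
  have "f (\<ominus>\<^bsub>M\<^esub> x) \<oplus>\<^bsub>N\<^esub> f x = f (\<ominus>\<^bsub>M\<^esub> x \<oplus>\<^bsub>M\<^esub> x)"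
    using linear_onD(2)[OF assms(3)] assms(4) by simp
  hence "f (\<ominus>\<^bsub>M\<^esub> x) \<oplus>\<^bsub>N\<^esub> f x = \<zero>\<^bsub>N\<^esub>"
    using linear_on_zero[OF assms(1-3)] assms(4) by (simp add: M.l_neg)
  from N.minus_equality[OF this c(2,1)] show ?thesis by simp
qed

lemma linear_on_minus:
  assumes "Module.module R M" "Module.module R N" "linear_on R M N f" "x \<in> carrier M" "y \<in> carrier M"
  shows "f (x \<ominus>\<^bsub>M\<^esub> y) = f x \<ominus>\<^bsub>N\<^esub> f y"
proof -
  interpret M: Module.module R M by fact
  interpret N: Module.module R N by fact
  show ?thesis
    using assms(4,5) linear_onD(2)[OF assms(3), of x "\<ominus>\<^bsub>M\<^esub> y"] linear_on_neg[OF assms(1-3,5)]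
    by (simp add: M.minus_eq N.minus_eq)
qed

lemma linear_on_id: "linear_on R M M (\<lambda>x. x)"
  by (simp add: linear_on_def)

lemma (in abelian_group) minus_self: "x \<in> carrier G \<Longrightarrow> x \<ominus> x = \<zero>"
  by (simp add: minus_eq r_neg)

lemma (in abelian_group) minus_eq_iff:
  "x \<in> carrier G \<Longrightarrow> y \<in> carrier G \<Longrightarrow> z \<in> carrier G \<Longrightarrow> x \<ominus> y = z \<longleftrightarrow> x = y \<oplus> z"
  by (metis a_minus_def a_lcomm add.inv_closed l_neg r_neg r_zero a_comm)

text \<open>Since \<open>T\<close> is a chain map only up to \<open>e\<close>, each degree costs another factor \<open>e\<close>.\<close>

lemma (in Module.module) res_homotopy:
  assumes e: "e \<in> carrier R"
    and T: "\<And>n. linear_on R (res_module R M n) (res_module R M n) (T n)"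
    and link: "\<And>n x. x \<in> carrier (res_module R M (Suc n)) \<Longrightarrow>
      e \<odot>\<^bsub>res_module R M n\<^esub> T n (res_bd R x) = res_bd R (T (Suc n) x)"
    and base: "\<And>x. x \<in> carrier (res_module R M 0) \<Longrightarrow> res_aug R M (T 0 x) = e \<odot>\<^bsub>M\<^esub> res_aug R M x"
  obtains t s where "linear_on R (res_module R M n) (res_module R M (Suc n)) t"
    "linear_on R (res_module R M (Suc n)) (res_module R M (Suc (Suc n))) s"
    "\<And>x. x \<in> carrier (res_module R M (Suc n)) \<Longrightarrow>
      (e [^] Suc (Suc n)) \<odot>\<^bsub>res_module R M (Suc n)\<^esub> x =
      T (Suc n) x \<oplus>\<^bsub>res_module R M (Suc n)\<^esub> t (res_bd R x) \<oplus>\<^bsub>res_module R M (Suc n)\<^esub> res_bd R (s x)"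
proof -
  let ?P = "res_module R M"
  \<comment> \<open>The homotopy identity is required on boundaries only. There the term applying
    the previous homotopy to \<open>res_bd R (res_bd R y)\<close> vanishes, so the invariant has a
    single homotopy term and passes to the next degree.\<close>
  define S where "S n s \<longleftrightarrow> linear_on R (?P n) (?P (Suc n)) s \<and> (\<forall>y\<in>carrier (?P (Suc n)).
    (e [^] Suc n) \<odot>\<^bsub>?P n\<^esub> res_bd R y = T n (res_bd R y) \<oplus>\<^bsub>?P n\<^esub> res_bd R (s (res_bd R y)))" for n s
  note mP = module_res_module
  have step: "\<exists>s'. linear_on R (?P (Suc n)) (?P (Suc (Suc n))) s' \<and> (\<forall>x\<in>carrier (?P (Suc n)).
      (e [^] Suc (Suc n)) \<odot>\<^bsub>?P (Suc n)\<^esub> x =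
      T (Suc n) x \<oplus>\<^bsub>?P (Suc n)\<^esub> e \<odot>\<^bsub>?P (Suc n)\<^esub> s (res_bd R x) \<oplus>\<^bsub>?P (Suc n)\<^esub> res_bd R (s' x))"
    if s: "S n s" for n s
  proof -
    interpret P: Module.module R "?P n" by (rule mP)
    interpret P1: Module.module R "?P (Suc n)" by (rule mP)
    have sl: "linear_on R (?P n) (?P (Suc n)) s" using s by (simp add: S_def)
    let ?U = "\<lambda>x. T (Suc n) x \<oplus>\<^bsub>?P (Suc n)\<^esub> e \<odot>\<^bsub>?P (Suc n)\<^esub> s (res_bd R x)"
    let ?D = "\<lambda>x. (e [^] Suc (Suc n)) \<odot>\<^bsub>?P (Suc n)\<^esub> x \<ominus>\<^bsub>?P (Suc n)\<^esub> ?U x"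
    have eN: "e [^] k \<in> carrier R" for k :: nat using e by simp
    have lU: "linear_on R (?P (Suc n)) (?P (Suc n)) ?U"
      by (intro linear_on_add mP T linear_on_scale linear_on_compose[OF linear_res_bd sl] e)
    have lD: "linear_on R (?P (Suc n)) (?P (Suc n)) ?D"
      by (intro linear_on_diff mP lU linear_on_scale linear_on_id eN)
    \<comment> \<open>\<open>link\<close> turns the boundary of \<open>T (Suc n) x\<close> into
      \<open>e\<close> times the lower \<open>T\<close>, so the invariant for \<open>s\<close>,
      multiplied by \<open>e\<close>, shows that \<open>?D x\<close> is a cycle; exactness makes it
      a boundary.\<close>
    have im: "?D x \<in> res_bd R ` carrier (?P (Suc (Suc n)))" if x: "x \<in> carrier (?P (Suc n))" for x
    proof -
      have bx: "res_bd R x \<in> carrier (?P n)" using x by (rule res_bd_closed)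
      have sx: "s (res_bd R x) \<in> carrier (?P (Suc n))" using linear_onD(1)[OF sl bx] .
      have Tx: "T (Suc n) x \<in> carrier (?P (Suc n))" "T n (res_bd R x) \<in> carrier (?P n)"
        using linear_onD(1)[OF T] x bx by auto
      have "res_bd R (?U x) = e \<odot>\<^bsub>?P n\<^esub> T n (res_bd R x) \<oplus>\<^bsub>?P n\<^esub> e \<odot>\<^bsub>?P n\<^esub> res_bd R (s (res_bd R x))"
        using Tx sx e P1.smult_closed[OF e sx]
        by (simp only: res_bd_add res_bd_smult link[OF x])
      also have "\<dots> = e \<odot>\<^bsub>?P n\<^esub> ((e [^] Suc n) \<odot>\<^bsub>?P n\<^esub> res_bd R x)"
        using s x res_bd_closed[OF sx] Tx(2) e by (simp add: S_def P.smult_r_distr)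
      also have "\<dots> = (e [^] Suc (Suc n)) \<odot>\<^bsub>?P n\<^esub> res_bd R x"
        using eN[of "Suc n"] e bx by (simp add: R.m_ac flip: P.smult_assoc1)
      also have "\<dots> = res_bd R ((e [^] Suc (Suc n)) \<odot>\<^bsub>?P (Suc n)\<^esub> x)"
        using x eN by (simp only: res_bd_smult)
      finally have eq: "res_bd R (?U x) = res_bd R ((e [^] Suc (Suc n)) \<odot>\<^bsub>?P (Suc n)\<^esub> x)" .
      have "res_bd R (?D x) = \<zero>\<^bsub>?P n\<^esub>"
        using linear_on_minus[OF mP mP linear_res_bd P1.smult_closed[OF eN x] linear_onD(1)[OF lU x],
            of "Suc (Suc n)"] eq
          P.minus_self[OF res_bd_closed[OF linear_onD(1)[OF lU x]]]
        by simp
      thus ?thesis using res_bd_exact[OF linear_onD(1)[OF lD x]] by simp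
    qed
    obtain s' where s': "linear_on R (?P (Suc n)) (?P (Suc (Suc n))) s'"
      "\<And>x. x \<in> carrier (?P (Suc n)) \<Longrightarrow> res_bd R (s' x) = ?D x"
      using res_lift[OF mP mP linear_res_bd lD im] by blast
    have "(e [^] Suc (Suc n)) \<odot>\<^bsub>?P (Suc n)\<^esub> x = ?U x \<oplus>\<^bsub>?P (Suc n)\<^esub> res_bd R (s' x)"
      if x: "x \<in> carrier (?P (Suc n))" for x
      using P1.minus_eq_iff[THEN iffD1, OF P1.smult_closed[OF eN x] linear_onD(1)[OF lU x]
          res_bd_closed[OF linear_onD(1)[OF s'(1) x]] s'(2)[OF x, symmetric]] .
    thus ?thesis using s'(1) by blast
  qed
  have "\<exists>s. S n s" for n
  proof (induction n)
    case 0
    interpret P: Module.module R "?P 0" by (rule mP)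
    \<comment> \<open>In degree 0 the augmentation takes the place of the boundary, and
      \<open>base\<close> that of \<open>link\<close>.\<close>
    let ?D = "\<lambda>x. e \<odot>\<^bsub>?P 0\<^esub> x \<ominus>\<^bsub>?P 0\<^esub> T 0 x"
    have lD: "linear_on R (?P 0) (?P 0) ?D"
      by (intro linear_on_diff mP linear_on_scale linear_on_id T e)
    have im: "?D x \<in> res_bd R ` carrier (?P (Suc 0))" if x: "x \<in> carrier (?P 0)" for x
    proof -
      have "res_aug R M (?D x) = res_aug R M (e \<odot>\<^bsub>?P 0\<^esub> x) \<ominus>\<^bsub>M\<^esub> res_aug R M (T 0 x)"
        by (rule linear_on_minus[OF mP module_axioms linear_res_aug P.smult_closed[OF e x]
              linear_onD(1)[OF T x]])
      also have "\<dots> = \<zero>\<^bsub>M\<^esub>"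
        using e x res_aug_closed[OF x] by (simp add: base res_aug_smult M.minus_self)
      finally show ?thesis using res_aug_exact[OF linear_onD(1)[OF lD x]] by simp
    qed
    obtain s where s: "linear_on R (?P 0) (?P (Suc 0)) s"
      "\<And>x. x \<in> carrier (?P 0) \<Longrightarrow> res_bd R (s x) = ?D x"
      using res_lift[OF mP mP linear_res_bd lD im] by blast
    have "e \<odot>\<^bsub>?P 0\<^esub> x = T 0 x \<oplus>\<^bsub>?P 0\<^esub> res_bd R (s x)" if x: "x \<in> carrier (?P 0)" for x
      using P.minus_eq_iff[THEN iffD1, OF P.smult_closed[OF e x] linear_onD(1)[OF T x]
          res_bd_closed[OF linear_onD(1)[OF s(1) x]] s(2)[OF x, symmetric]] .
    hence "S 0 s" using s(1) res_bd_closed e by (simp add: S_def)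
    thus ?case by blast
  next
    case (Suc n)
    then obtain s where s: "S n s" by blast
    hence sl: "linear_on R (?P n) (?P (Suc n)) s" by (simp add: S_def)
    interpret P1: Module.module R "?P (Suc n)" by (rule mP)
    obtain s' where s': "linear_on R (?P (Suc n)) (?P (Suc (Suc n))) s'"
      "\<And>x. x \<in> carrier (?P (Suc n)) \<Longrightarrow> (e [^] Suc (Suc n)) \<odot>\<^bsub>?P (Suc n)\<^esub> x =
      T (Suc n) x \<oplus>\<^bsub>?P (Suc n)\<^esub> e \<odot>\<^bsub>?P (Suc n)\<^esub> s (res_bd R x) \<oplus>\<^bsub>?P (Suc n)\<^esub> res_bd R (s' x)"
      using step[OF s] by blast
    have "S (Suc n) s'" unfolding S_def
    proof (intro conjI ballI s'(1))
      fix y assume y: "y \<in> carrier (?P (Suc (Suc n)))"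
      have dy: "res_bd R y \<in> carrier (?P (Suc n))" using y by (rule res_bd_closed)
      have "e \<odot>\<^bsub>?P (Suc n)\<^esub> s (res_bd R (res_bd R y)) = \<zero>\<^bsub>?P (Suc n)\<^esub>"
        using res_bd_bd[OF y] linear_on_zero[OF mP mP sl] e by simp
      thus "(e [^] Suc (Suc n)) \<odot>\<^bsub>?P (Suc n)\<^esub> res_bd R y =
        T (Suc n) (res_bd R y) \<oplus>\<^bsub>?P (Suc n)\<^esub> res_bd R (s' (res_bd R y))"
        using s'(2)[OF dy] linear_onD(1)[OF T dy] by simp
    qed
    thus ?case by blast
  qed
  then obtain s where s: "S n s" by blast
  hence sl: "linear_on R (?P n) (?P (Suc n)) s" by (simp add: S_def)
  \<comment> \<open>\<open>t\<close> is the homotopy one degree lower, scaled by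
    \<open>e\<close>.\<close>
  from step[OF s] linear_on_scale[OF mP mP sl e] that show thesis by blast
qed

section \<open>Ext as cocycles modulo coboundaries\<close>

lemma quot_module_class:
  assumes "abelian_group A" "subgroup B (add_monoid A)"
  shows "carrier (quot_module A B) = (\<lambda>x. B +>\<^bsub>A\<^esub> x) ` carrier A"
    and "x \<in> carrier A \<Longrightarrow> y \<in> carrier A \<Longrightarrow>
      (B +>\<^bsub>A\<^esub> x) \<oplus>\<^bsub>quot_module A B\<^esub> (B +>\<^bsub>A\<^esub> y) = B +>\<^bsub>A\<^esub> (x \<oplus>\<^bsub>A\<^esub> y)"
    and "x \<in> carrier A \<Longrightarrow> B +>\<^bsub>A\<^esub> x = \<zero>\<^bsub>quot_module A B\<^esub> \<longleftrightarrow> x \<in> B"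
proof -
  interpret A: abelian_group A by fact
  interpret B: subgroup B "add_monoid A" by fact
  have nB: "B \<lhd> add_monoid A" by (rule A.add.subgroup_imp_normal[OF assms(2)])
  show "carrier (quot_module A B) = (\<lambda>x. B +>\<^bsub>A\<^esub> x) ` carrier A"
    by (auto simp: quot_module_def A_RCOSETS_def')
  show "(B +>\<^bsub>A\<^esub> x) \<oplus>\<^bsub>quot_module A B\<^esub> (B +>\<^bsub>A\<^esub> y) = B +>\<^bsub>A\<^esub> (x \<oplus>\<^bsub>A\<^esub> y)"
    if "x \<in> carrier A" "y \<in> carrier A"
    using normal.rcos_sum[OF nB] that by (simp add: quot_module_def set_add_def a_r_coset_def)
  show "B +>\<^bsub>A\<^esub> x = \<zero>\<^bsub>quot_module A B\<^esub> \<longleftrightarrow> x \<in> B" if "x \<in> carrier A"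
    using A.add.coset_join1[of B x] A.add.coset_join2[of x B] that assms(2) B.subset
    by (auto simp: quot_module_def a_r_coset_def)
qed

definition cocycles :: "('r, 'a) ring_scheme \<Rightarrow> ('r, 'm, 'b) module_scheme \<Rightarrow>
    ('r, 'n, 'c) module_scheme \<Rightarrow> nat \<Rightarrow> ((('r, 'm) gen \<Rightarrow> 'r) \<Rightarrow> 'n) set" where
  "cocycles R M N l = {f \<in> lin_maps R (res_module R M l) N.
     \<forall>x\<in>carrier (res_module R M (Suc l)). f (res_bd R x) = \<zero>\<^bsub>N\<^esub>}"

definition coboundaries :: "('r, 'a) ring_scheme \<Rightarrow> ('r, 'm, 'b) module_scheme \<Rightarrow>
    ('r, 'n, 'c) module_scheme \<Rightarrow> nat \<Rightarrow> ((('r, 'm) gen \<Rightarrow> 'r) \<Rightarrow> 'n) set" where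
  "coboundaries R M N n = (\<lambda>g. \<lambda>x\<in>carrier (res_module R M (Suc n)). g (res_bd R x)) `
     lin_maps R (res_module R M n) N"

lemma lin_maps_restrict:
  assumes "Module.module R M" "linear_on R M N f"
  shows "restrict f (carrier M) \<in> lin_maps R M N"
  using linear_on_cong[OF assms(1) _ assms(2), of "restrict f (carrier M)"]
  by (simp add: lin_maps_iff)

lemma cocyclesI:
  assumes "Module.module R M" "linear_on R (res_module R M l) N f"
    "\<And>x. x \<in> carrier (res_module R M (Suc l)) \<Longrightarrow> f (res_bd R x) = \<zero>\<^bsub>N\<^esub>"
  shows "restrict f (carrier (res_module R M l)) \<in> cocycles R M N l"
  using lin_maps_restrict[OF module.module_res_module[OF assms(1)] assms(2)]
    assms(3) module.res_bd_closed[OF assms(1)]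
  by (auto simp: cocycles_def)

lemma cocyclesD:
  assumes "f \<in> cocycles R M N l"
  shows "linear_on R (res_module R M l) N f"
    "x \<in> carrier (res_module R M (Suc l)) \<Longrightarrow> f (res_bd R x) = \<zero>\<^bsub>N\<^esub>"
    "restrict f (carrier (res_module R M l)) = f"
  using assms by (auto simp: cocycles_def lin_maps_iff extensional_restrict)

lemma coboundaries_iff:
  assumes "Module.module R M" "f \<in> extensional (carrier (res_module R M (Suc n)))"
  shows "f \<in> coboundaries R M N n \<longleftrightarrow> (\<exists>g. linear_on R (res_module R M n) N g \<and>
    (\<forall>x\<in>carrier (res_module R M (Suc n)). f x = g (res_bd R x)))"
proof
  assume "f \<in> coboundaries R M N n"
  thus "\<exists>g. linear_on R (res_module R M n) N g \<and>
    (\<forall>x\<in>carrier (res_module R M (Suc n)). f x = g (res_bd R x))"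
    by (force simp: coboundaries_def lin_maps_iff)
next
  assume "\<exists>g. linear_on R (res_module R M n) N g \<and>
    (\<forall>x\<in>carrier (res_module R M (Suc n)). f x = g (res_bd R x))"
  then obtain g where g: "linear_on R (res_module R M n) N g"
    "\<And>x. x\<in>carrier (res_module R M (Suc n)) \<Longrightarrow> f x = g (res_bd R x)" by blast
  have "f = (\<lambda>x\<in>carrier (res_module R M (Suc n)). restrict g (carrier (res_module R M n)) (res_bd R x))"
    using assms(2) g(2) module.res_bd_closed[OF assms(1)]
    by (auto simp: fun_eq_iff extensional_def)
  thus "f \<in> coboundaries R M N n"
    using lin_maps_restrict[OF module.module_res_module[OF assms(1)] g(1)]
    unfolding coboundaries_def by blast
qed

text \<open>Hides the cosets: what follows uses Ext only through this class map. In degree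
  \<open>Suc n\<close> the coboundaries come from degree \<open>n\<close>, so the special case of
  degree 0 never arises.\<close>

lemma Ext_class:
  assumes M: "Module.module R M" and N: "Module.module R N"
  obtains cl where
    "cl ` cocycles R M N (Suc n) = carrier (Ext R (Suc n) M N)"
    "\<And>f g. f \<in> cocycles R M N (Suc n) \<Longrightarrow> g \<in> cocycles R M N (Suc n) \<Longrightarrow>
      cl (\<lambda>x\<in>carrier (res_module R M (Suc n)). f x \<oplus>\<^bsub>N\<^esub> g x) = cl f \<oplus>\<^bsub>Ext R (Suc n) M N\<^esub> cl g"
    "\<And>f. f \<in> cocycles R M N (Suc n) \<Longrightarrow> cl f = \<zero>\<^bsub>Ext R (Suc n) M N\<^esub> \<longleftrightarrow> f \<in> coboundaries R M N n"
proof -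
  interpret M: Module.module R M by fact
  interpret N: Module.module R N by fact
  let ?P = "res_module R M"
  let ?Z = "cocycles R M N (Suc n)" and ?B = "coboundaries R M N n"
  note mP = M.module_res_module
  interpret H: Module.module R "hom_module R (?P (Suc n)) N" by (rule module_hom_module[OF mP N])
  have Hs: "carrier (hom_module R (?P n) N) = lin_maps R (?P n) N"
    "\<zero>\<^bsub>hom_module R (?P n) N\<^esub> = (\<lambda>x\<in>carrier (?P n). \<zero>\<^bsub>N\<^esub>)"
    "f \<oplus>\<^bsub>hom_module R (?P n) N\<^esub> g = (\<lambda>x\<in>carrier (?P n). f x \<oplus>\<^bsub>N\<^esub> g x)"
    "r \<odot>\<^bsub>hom_module R (?P n) N\<^esub> f = (\<lambda>x\<in>carrier (?P n). r \<odot>\<^bsub>N\<^esub> f x)" for n f g r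
    by (simp_all add: hom_module_def)
  have lz: "linear_on R (?P m) N (\<lambda>x. \<zero>\<^bsub>N\<^esub>)" for m by (simp add: linear_on_def)
  have Z: "submodule ?Z R (hom_module R (?P (Suc n)) N)"
  proof (rule H.submoduleI_smult)
    show "?Z \<subseteq> carrier (hom_module R (?P (Suc n)) N)" by (auto simp: cocycles_def Hs)
    show "\<zero>\<^bsub>hom_module R (?P (Suc n)) N\<^esub> \<in> ?Z" unfolding Hs
      by (rule cocyclesI[OF M lz]) simp
    show "f \<oplus>\<^bsub>hom_module R (?P (Suc n)) N\<^esub> g \<in> ?Z" if "f \<in> ?Z" "g \<in> ?Z" for f g
      unfolding Hs
      by (rule cocyclesI[OF M linear_on_add[OF mP N]])
        (simp_all add: cocyclesD[OF that(1)] cocyclesD[OF that(2)])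
    show "r \<odot>\<^bsub>hom_module R (?P (Suc n)) N\<^esub> f \<in> ?Z" if "r \<in> carrier R" "f \<in> ?Z" for f r
      unfolding Hs
      by (rule cocyclesI[OF M linear_on_scale[OF mP N]])
        (simp_all add: cocyclesD[OF that(2)] that)
  qed
  let ?A = "(hom_module R (?P (Suc n)) N)\<lparr>carrier := ?Z\<rparr>"
  interpret A: Module.module R ?A by (rule submodule.submodule_is_module[OF Z H.module_axioms])
  have As: "carrier ?A = ?Z" "f \<oplus>\<^bsub>?A\<^esub> g = (\<lambda>x\<in>carrier (?P (Suc n)). f x \<oplus>\<^bsub>N\<^esub> g x)"
     "\<zero>\<^bsub>?A\<^esub> = (\<lambda>x\<in>carrier (?P (Suc n)). \<zero>\<^bsub>N\<^esub>)" 
     "r \<odot>\<^bsub>?A\<^esub> f = (\<lambda>x\<in>carrier (?P (Suc n)). r \<odot>\<^bsub>N\<^esub> f x)" for f g r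
    by (simp_all add: Hs)
  have ext: "f \<in> extensional (carrier (?P (Suc n)))" if "f \<in> ?B" for f
    using that by (auto simp: coboundaries_def)
  have B: "submodule ?B R ?A"
  proof (rule A.submoduleI_smult)
    show "?B \<subseteq> carrier ?A"
    proof
      fix f assume f: "f \<in> ?B"
      then obtain g where g: "linear_on R (?P n) N g"
        "\<And>x. x\<in>carrier (?P (Suc n)) \<Longrightarrow> f x = g (res_bd R x)"
        using coboundaries_iff[OF M ext[OF f]] by blast
      have "f = restrict (\<lambda>x. g (res_bd R x)) (carrier (?P (Suc n)))"
        using g ext[OF f] by (auto simp: extensional_def)
      moreover have "restrict (\<lambda>x. g (res_bd R x)) (carrier (?P (Suc n))) \<in> ?Z"
        by (rule cocyclesI[OF M linear_on_compose[OF M.linear_res_bd g(1)]])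
          (simp add: M.res_bd_bd linear_on_zero[OF mP N g(1)])
      ultimately show "f \<in> carrier ?A" by (simp add: As)
    qed
    show "\<zero>\<^bsub>?A\<^esub> \<in> ?B" unfolding As
      by (subst coboundaries_iff[OF M]) (use lz in auto)
    show "f \<oplus>\<^bsub>?A\<^esub> f' \<in> ?B" if ff: "f \<in> ?B" "f' \<in> ?B" for f f'
    proof -
      obtain g g' where "linear_on R (?P n) N g" "linear_on R (?P n) N g'"
        "\<And>x. x\<in>carrier (?P (Suc n)) \<Longrightarrow> f x = g (res_bd R x)"
        "\<And>x. x\<in>carrier (?P (Suc n)) \<Longrightarrow> f' x = g' (res_bd R x)"
        using coboundaries_iff[OF M ext[OF ff(1)]] coboundaries_iff[OF M ext[OF ff(2)]] ff by blast
      thus ?thesis unfolding As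
        by (subst coboundaries_iff[OF M])
          (auto intro!: exI[of _ "\<lambda>x. g x \<oplus>\<^bsub>N\<^esub> g' x"] linear_on_add[OF mP N])
    qed
    show "r \<odot>\<^bsub>?A\<^esub> f \<in> ?B" if rf: "r \<in> carrier R" "f \<in> ?B" for f r
    proof -
      obtain g where "linear_on R (?P n) N g"
        "\<And>x. x\<in>carrier (?P (Suc n)) \<Longrightarrow> f x = g (res_bd R x)"
        using coboundaries_iff[OF M ext[OF rf(2)]] rf by blast
      thus ?thesis unfolding As
        by (subst coboundaries_iff[OF M])
          (auto intro!: exI[of _ "\<lambda>x. r \<odot>\<^bsub>N\<^esub> g x"] linear_on_scale[OF mP N] rf)
    qed
  qed
  have E: "Ext R (Suc n) M N = quot_module ?A ?B"
    by (simp add: Ext_def hom_cohomology_def cocycles_def coboundaries_def)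
  have sB: "subgroup ?B (add_monoid ?A)" using B by (simp add: submodule_def)
  note q = quot_module_class[OF A.M.abelian_group_axioms sB]
  show thesis
  proof (rule that[of "\<lambda>f. ?B +>\<^bsub>?A\<^esub> f"], unfold E)
    show "(\<lambda>f. ?B +>\<^bsub>?A\<^esub> f) ` ?Z = carrier (quot_module ?A ?B)" using q(1) by (simp only: As)
    show "?B +>\<^bsub>?A\<^esub> (\<lambda>x\<in>carrier (?P (Suc n)). f x \<oplus>\<^bsub>N\<^esub> g x) =
      (?B +>\<^bsub>?A\<^esub> f) \<oplus>\<^bsub>quot_module ?A ?B\<^esub> (?B +>\<^bsub>?A\<^esub> g)" if "f \<in> ?Z" "g \<in> ?Z" for f g
      using q(2)[of f g] that by (simp only: As)
    show "(?B +>\<^bsub>?A\<^esub> f = \<zero>\<^bsub>quot_module ?A ?B\<^esub>) = (f \<in> ?B)" if "f \<in> ?Z" for f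
      using q(3)[of f] that by (simp only: As)
  qed
qed

section \<open>The p-part of Ext between modules of rank one\<close>

lemma p_part_simps [simp]:
  "\<zero>\<^bsub>p_part p A\<^esub> = \<zero>\<^bsub>A\<^esub>" "x \<oplus>\<^bsub>p_part p A\<^esub> y = x \<oplus>\<^bsub>A\<^esub> y"
  "x \<in> carrier (p_part p A) \<longleftrightarrow> x \<in> carrier A \<and> (\<exists>k::nat. add_pow A (p ^ k) x = \<zero>\<^bsub>A\<^esub>)"
  by (simp_all add: p_part_def)

lemma p_part_closed:
  assumes "abelian_group A" "x \<in> carrier (p_part p A)" "y \<in> carrier (p_part p A)"
  shows "x \<oplus>\<^bsub>A\<^esub> y \<in> carrier (p_part p A)"
proof -
  interpret A: abelian_group A by fact
  obtain i j :: nat where x: "x \<in> carrier A" "add_pow A (p ^ i) x = \<zero>\<^bsub>A\<^esub>"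
    and y: "y \<in> carrier A" "add_pow A (p ^ j) y = \<zero>\<^bsub>A\<^esub>"
    using assms by auto
  have "add_pow A (p ^ i * p ^ j) x = \<zero>\<^bsub>A\<^esub>" "add_pow A (p ^ j * p ^ i) y = \<zero>\<^bsub>A\<^esub>"
    using x y by (simp_all flip: A.add.nat_pow_pow)
  hence "add_pow A (p ^ (i + j)) (x \<oplus>\<^bsub>A\<^esub> y) = \<zero>\<^bsub>A\<^esub>"
    using x y by (simp add: A.add.nat_pow_distrib power_add mult.commute)
  thus ?thesis using x y by auto
qed

text \<open>The additive order of \<open>x\<close> divides both multipliers, hence is 1.\<close>

lemma (in abelian_group) add_pow_coprime_zero:
  fixes c d :: nat
  assumes "x \<in> carrier G" "[c] \<cdot> x = \<zero>" "[d] \<cdot> x = \<zero>" "coprime c d"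
  shows "x = \<zero>"
proof -
  have G: "group (add_monoid G)" by unfold_locales
  have "group.ord (add_monoid G) x dvd c" "group.ord (add_monoid G) x dvd d"
    using assms group.pow_eq_id[OF G, of x] by (simp_all add: add_pow_def)
  hence "group.ord (add_monoid G) x = 1" using assms(4) by (metis coprime_common_divisor_nat)
  thus ?thesis using group.pow_eq_id[OF G, of x 1] assms(1) by simp
qed

locale int_module_cocycles = M: Module.module R M + int_character R k
  for R :: "('r, 'a) ring_scheme" (structure) and M :: "('r, 'm, 'b) module_scheme" (structure) and k +
  fixes n :: nat
begin

abbreviation "E \<equiv> Ext R (Suc n) M (int_module k)"
abbreviation "P \<equiv> carrier (res_module R M (Suc n))"
abbreviation "Z \<equiv> cocycles R M (int_module k) (Suc n)"
abbreviation "B \<equiv> coboundaries R M (int_module k) n"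

lemma abelian_group_E: "abelian_group E"
  by (rule Module.module.axioms(2)[OF module_Ext[OF M.module_axioms module_int_module]])

lemma linear_scale_int:
  "linear_on R A (int_module k) f \<Longrightarrow> linear_on R A (int_module k) (\<lambda>x. c * f x)"
  by (simp add: linear_on_def algebra_simps)

lemma cocycle_scale: "f \<in> Z \<Longrightarrow> (\<lambda>x\<in>P. c * f x) \<in> Z"
  using cocyclesI[OF M.module_axioms linear_scale_int[OF cocyclesD(1)], of f "Suc n" c]
  by (simp add: cocyclesD)

lemma coboundary_scale:
  assumes "f \<in> B"
  shows "(\<lambda>x\<in>P. c * f x) \<in> B"
proof -
  have e: "f \<in> extensional P" using assms by (auto simp: coboundaries_def)
  obtain g where "linear_on R (res_module R M n) (int_module k) g" "\<And>x. x \<in> P \<Longrightarrow> f x = g (res_bd R x)"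
    using coboundaries_iff[OF M.module_axioms e] assms by blast
  thus ?thesis
    by (subst coboundaries_iff[OF M.module_axioms])
      (auto intro!: exI[of _ "\<lambda>x. c * g x"] linear_scale_int)
qed

text \<open>\<open>Ext_class\<close> only asserts existence; fixing one class map lets the lemmas of
  the locale refer to it.\<close>

definition cl where
  "cl = (SOME cl. cl ` Z = carrier E \<and>
     (\<forall>f\<in>Z. \<forall>g\<in>Z. cl (\<lambda>x\<in>P. f x + g x) = cl f \<oplus>\<^bsub>E\<^esub> cl g) \<and>
     (\<forall>f\<in>Z. cl f = \<zero>\<^bsub>E\<^esub> \<longleftrightarrow> f \<in> B))"

lemma cl: "cl ` Z = carrier E"
  and cl_add: "f \<in> Z \<Longrightarrow> g \<in> Z \<Longrightarrow> cl (\<lambda>x\<in>P. f x + g x) = cl f \<oplus>\<^bsub>E\<^esub> cl g"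
  and cl_zero_iff: "f \<in> Z \<Longrightarrow> cl f = \<zero>\<^bsub>E\<^esub> \<longleftrightarrow> f \<in> B"
proof -
  have "\<exists>cl. cl ` Z = carrier E \<and>
     (\<forall>f\<in>Z. \<forall>g\<in>Z. cl (\<lambda>x\<in>P. f x + g x) = cl f \<oplus>\<^bsub>E\<^esub> cl g) \<and>
     (\<forall>f\<in>Z. cl f = \<zero>\<^bsub>E\<^esub> \<longleftrightarrow> f \<in> B)"
  proof (rule Ext_class[OF M.module_axioms module_int_module, of n], unfold int_module_simps)
    fix cl assume "cl ` Z = carrier E"
      "\<And>f g. f \<in> Z \<Longrightarrow> g \<in> Z \<Longrightarrow> cl (\<lambda>x\<in>P. f x + g x) = cl f \<oplus>\<^bsub>E\<^esub> cl g"
      "\<And>f. f \<in> Z \<Longrightarrow> cl f = \<zero>\<^bsub>E\<^esub> \<longleftrightarrow> f \<in> B"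
    thus "\<exists>cl. cl ` Z = carrier E \<and>
     (\<forall>f\<in>Z. \<forall>g\<in>Z. cl (\<lambda>x\<in>P. f x + g x) = cl f \<oplus>\<^bsub>E\<^esub> cl g) \<and>
     (\<forall>f\<in>Z. cl f = \<zero>\<^bsub>E\<^esub> \<longleftrightarrow> f \<in> B)"
      by (intro exI[of _ cl] conjI ballI)
  qed
  from someI_ex[OF this] show "cl ` Z = carrier E"
    "f \<in> Z \<Longrightarrow> g \<in> Z \<Longrightarrow> cl (\<lambda>x\<in>P. f x + g x) = cl f \<oplus>\<^bsub>E\<^esub> cl g"
    "f \<in> Z \<Longrightarrow> cl f = \<zero>\<^bsub>E\<^esub> \<longleftrightarrow> f \<in> B" unfolding cl_def by blast+
qed

lemma cl_closed: "f \<in> Z \<Longrightarrow> cl f \<in> carrier E"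
  using cl by blast

lemma clE:
  assumes "x \<in> carrier E"
  obtains f where "f \<in> Z" "x = cl f"
  using assms unfolding cl[symmetric] by (rule imageE)

lemma cl_pow:
  assumes f: "f \<in> Z"
  shows "add_pow E (m::nat) (cl f) = cl (\<lambda>x\<in>P. int m * f x)"
proof -
  interpret E: abelian_group E by (rule abelian_group_E)
  show ?thesis
  proof (induction m)
    case 0
    have "(\<lambda>x\<in>P. int 0 * f x) \<in> B"
      by (subst coboundaries_iff[OF M.module_axioms])
        (auto intro!: exI[of _ "\<lambda>_. 0"] simp: linear_on_def)
    hence "cl (\<lambda>x\<in>P. int 0 * f x) = \<zero>\<^bsub>E\<^esub>"
      using cl_zero_iff[OF cocycle_scale[OF f]] by blast
    moreover have "add_pow E (0::nat) (cl f) = \<zero>\<^bsub>E\<^esub>" by simp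
    ultimately show ?case by (simp only:)
  next
    case (Suc m)
    have eq: "(\<lambda>x\<in>P. int (Suc m) * f x) = (\<lambda>x\<in>P. (\<lambda>x\<in>P. int m * f x) x + f x)"
      by (auto simp: fun_eq_iff algebra_simps)
    show ?case unfolding eq cl_add[OF cocycle_scale[OF f] f] Suc[symmetric]
      by simp
  qed
qed

text \<open>A class in the p-part is killed by a power of p; being killed by an integer prime to p
  as well, it vanishes.\<close>

lemma p_part_zero:
  assumes p: "prime p"
    and c: "\<And>f. f \<in> Z \<Longrightarrow> \<exists>c. \<not> int p dvd c \<and> (\<lambda>x\<in>P. c * f x) \<in> B"
  shows "carrier (p_part p E) = {\<zero>\<^bsub>p_part p E\<^esub>}"
proof -
  interpret E: abelian_group E by (rule abelian_group_E)
  have "x = \<zero>\<^bsub>E\<^esub>" if x: "x \<in> carrier (p_part p E)" for x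
  proof -
    obtain i where i: "x \<in> carrier E" "add_pow E (p ^ i :: nat) x = \<zero>\<^bsub>E\<^esub>" using x by auto
    obtain f where f: "f \<in> Z" "x = cl f" by (rule clE[OF i(1)])
    obtain c where c: "\<not> int p dvd c" "(\<lambda>x\<in>P. c * f x) \<in> B" using c[OF f(1)] by blast
    \<comment> \<open>\<open>add_pow\<close> is applied with a natural number, so
      \<open>sgn c\<close> turns the multiplier \<open>c\<close> into its absolute value.\<close>
    have "(\<lambda>x\<in>P. sgn c * (\<lambda>x\<in>P. c * f x) x) \<in> B" by (rule coboundary_scale[OF c(2)])
    also have "(\<lambda>x\<in>P. sgn c * (\<lambda>x\<in>P. c * f x) x) = (\<lambda>x\<in>P. int (nat \<bar>c\<bar>) * f x)"
      by (auto simp: fun_eq_iff sgn_if)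
    finally have "cl (\<lambda>x\<in>P. int (nat \<bar>c\<bar>) * f x) = \<zero>\<^bsub>E\<^esub>"
      using cl_zero_iff[OF cocycle_scale[OF f(1)]] by blast
    hence "add_pow E (nat \<bar>c\<bar>) x = \<zero>\<^bsub>E\<^esub>" unfolding f(2) cl_pow[OF f(1)] .
    moreover have "coprime (nat \<bar>c\<bar>) (p ^ i)"
      using p c(1) prime_imp_coprime[of p "nat \<bar>c\<bar>"] by (simp add: coprime_commute dvd_nat_abs_iff)
    ultimately show ?thesis using E.add_pow_coprime_zero[OF i(1) _ i(2)] by blast
  qed
  moreover have "\<zero>\<^bsub>E\<^esub> \<in> carrier (p_part p E)" by simp
  ultimately show ?thesis unfolding p_part_simps(1) by blast
qed

text \<open>The isomorphism evaluates cocycles at the chain \<open>q\<close>, modulo \<open>p\<close>.\<close>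

lemma p_part_cyclic:
  assumes p: "prime p" and q: "q \<in> P"
    and well: "\<And>f. f \<in> B \<Longrightarrow> int p dvd f q"
    and inj: "\<And>f i. f \<in> Z \<Longrightarrow> (\<lambda>x\<in>P. int p ^ i * f x) \<in> B \<Longrightarrow> int p dvd f q \<Longrightarrow>
      \<exists>c. \<not> int p dvd c \<and> (\<lambda>x\<in>P. c * f x) \<in> B"
    and surj: "\<exists>f i. f \<in> Z \<and> (\<lambda>x\<in>P. int p ^ i * f x) \<in> B \<and> \<not> int p dvd f q"
  shows "add_monoid (p_part p E) \<cong> integer_mod_group p"
proof -
  interpret E: abelian_group E by (rule abelian_group_E)
  have p0: "p > 0" using p by (simp add: prime_gt_0_nat)
  define X where "X = {f \<in> Z. \<exists>i. (\<lambda>x\<in>P. int p ^ i * f x) \<in> B}"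
  have cX: "cl ` X = carrier (p_part p E)"
  proof -
    have eq: "cl f \<in> carrier (p_part p E) \<longleftrightarrow> f \<in> X" if f: "f \<in> Z" for f
      using f cl_closed[OF f] by (auto simp: X_def cl_pow cl_zero_iff cocycle_scale)
    show ?thesis
    proof (intro equalityI subsetI)
      fix x assume "x \<in> cl ` X"
      then obtain f where "f \<in> X" "x = cl f" by blast
      thus "x \<in> carrier (p_part p E)" using eq[of f] by (simp only: X_def mem_Collect_eq)
    next
      fix x assume x: "x \<in> carrier (p_part p E)"
      then obtain f where "f \<in> Z" "x = cl f" by (auto elim: clE)
      thus "x \<in> cl ` X" using eq[of f] x by blast
    qed
  qed
  have sum: "(\<lambda>x\<in>P. f x + g x) \<in> Z" if "f \<in> Z" "g \<in> Z" for f g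
    using cocyclesI[OF M.module_axioms, of "Suc n" "int_module k" "\<lambda>x. f x + g x"] that
      linear_on_add[OF M.module_res_module module_int_module cocyclesD(1)[OF that(1)] cocyclesD(1)[OF that(2)]]
    by (simp add: cocyclesD)
  have diff: "(\<lambda>x\<in>P. f x - g x) \<in> B" if fg: "f \<in> Z" "g \<in> Z" "cl f = cl g" for f g
  proof -
    let ?h = "\<lambda>x\<in>P. f x - g x"
    have h: "?h = (\<lambda>x\<in>P. f x + (\<lambda>x\<in>P. -1 * g x) x)" by (auto simp: fun_eq_iff)
    have hZ: "?h \<in> Z" unfolding h by (rule sum[OF fg(1) cocycle_scale[OF fg(2)]])
    have "(\<lambda>x\<in>P. ?h x + g x) = restrict f P" by (auto simp: fun_eq_iff)
    hence "(\<lambda>x\<in>P. ?h x + g x) = f" using cocyclesD(3)[OF fg(1)] by simp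
    hence "cl ?h \<oplus>\<^bsub>E\<^esub> cl g = cl g" using cl_add[OF hZ fg(2)] fg(3) by simp
    hence "cl ?h = \<zero>\<^bsub>E\<^esub>" using cl_closed hZ fg(2) by (simp add: E.add.r_cancel_one)
    thus ?thesis using cl_zero_iff[OF hZ] by simp
  qed
  \<comment> \<open>\<open>SOME\<close> picks an arbitrary representative; by \<open>well\<close>,
    changing it by a coboundary does not change the value at \<open>q\<close> modulo p.\<close>
  define \<psi> where "\<psi> x = (SOME f. f \<in> Z \<and> cl f = x) q mod int p" for x
  have \<psi>: "\<psi> (cl f) = f q mod int p" if f: "f \<in> Z" for f
  proof -
    let ?g = "SOME g. g \<in> Z \<and> cl g = cl f"
    have g: "?g \<in> Z \<and> cl ?g = cl f" by (rule someI[of _ f]) (use f in simp)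
    have "int p dvd (\<lambda>x\<in>P. ?g x - f x) q" using g f by (intro well diff) blast+
    hence "int p dvd ?g q - f q" using q by (simp only: restrict_apply')
    thus ?thesis unfolding \<psi>_def by (simp add: mod_eq_dvd_iff)
  qed
  have add: "\<psi> (x \<oplus>\<^bsub>E\<^esub> y) = (\<psi> x + \<psi> y) mod int p" if xy: "x \<in> carrier E" "y \<in> carrier E" for x y
  proof -
    obtain f where f: "f \<in> Z" "x = cl f" by (rule clE[OF xy(1)])
    obtain g where g: "g \<in> Z" "y = cl g" by (rule clE[OF xy(2)])
    have "\<psi> (cl (\<lambda>x\<in>P. f x + g x)) = (f q + g q) mod int p" using \<psi>[OF sum[OF f(1) g(1)]] q by simp
    thus ?thesis using f g \<psi> cl_add[OF f(1) g(1)] by (simp add: mod_simps)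
  qed
  have hom: "\<psi> \<in> hom (add_monoid (p_part p E)) (integer_mod_group p)"
  proof (rule homI)
    fix x y assume "x \<in> carrier (add_monoid (p_part p E))" "y \<in> carrier (add_monoid (p_part p E))"
    thus "\<psi> (x \<otimes>\<^bsub>add_monoid (p_part p E)\<^esub> y) = \<psi> x \<otimes>\<^bsub>integer_mod_group p\<^esub> \<psi> y"
      using add by simp
  qed (use p0 in \<open>simp add: \<psi>_def carrier_integer_mod_group\<close>)
  have PE: "group (add_monoid (p_part p E))"
  proof (rule groupI)
    fix x assume "x \<in> carrier (add_monoid (p_part p E))"
    hence x: "x \<in> carrier (p_part p E)" by simp
    then obtain i :: nat where "x \<in> carrier E" "add_pow E (p ^ i) x = \<zero>\<^bsub>E\<^esub>" by auto
    hence "\<ominus>\<^bsub>E\<^esub> x \<in> carrier (p_part p E)"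
      using E.add.nat_pow_inv[of x "p ^ i"] by (auto intro!: exI[of _ i] simp: a_inv_def)
    thus "\<exists>y\<in>carrier (add_monoid (p_part p E)). y \<otimes>\<^bsub>add_monoid (p_part p E)\<^esub> x = \<one>\<^bsub>add_monoid (p_part p E)\<^esub>"
      using x by (intro bexI[of _ "\<ominus>\<^bsub>E\<^esub> x"]) (simp_all add: E.l_neg)
  qed (use p_part_closed[OF abelian_group_E] in \<open>simp_all add: E.a_assoc\<close>)
  interpret \<psi>: group_hom "add_monoid (p_part p E)" "integer_mod_group p" \<psi>
    using hom PE by (simp add: group_hom_def group_hom_axioms_def)
  have "inj_on \<psi> (carrier (add_monoid (p_part p E)))"
  proof (rule iffD2[OF \<psi>.inj_on_one_iff], intro allI impI)
    fix x assume "x \<in> carrier (add_monoid (p_part p E))" and \<psi>0: "\<psi> x = \<one>\<^bsub>integer_mod_group p\<^esub>"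
    hence "x \<in> cl ` X" unfolding cX by simp
    then obtain f where f: "f \<in> X" "x = cl f" by blast
    then obtain i where i: "f \<in> Z" "(\<lambda>x\<in>P. int p ^ i * f x) \<in> B" by (auto simp: X_def)
    have d: "int p dvd f q" using \<psi>0 \<psi>[OF i(1)] f by (simp add: dvd_eq_mod_eq_0)
    obtain c where c: "\<not> int p dvd c" "(\<lambda>x\<in>P. c * f x) \<in> B" using inj[OF i d] by blast
    \<comment> \<open>Bezout for \<open>c\<close> and \<open>p ^ i\<close> writes \<open>f\<close>
      as a combination of two multiples of itself that are coboundaries.\<close>
    obtain u v where "u * c + v * int p ^ i = 1"
      using p c(1) prime_imp_coprime[of "int p" c] bezout_int[of c "int p ^ i"]
      by (auto simp: coprime_commute)
    hence "f x = u * (c * f x) + v * (int p ^ i * f x)" for x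
      by (metis mult.assoc distrib_right mult_1)
    hence "restrict f P = (\<lambda>x\<in>P. (\<lambda>x\<in>P. u * (\<lambda>x\<in>P. c * f x) x) x + (\<lambda>x\<in>P. v * (\<lambda>x\<in>P. int p ^ i * f x) x) x)"
      by (auto simp: fun_eq_iff)
    hence feq: "f = (\<lambda>x\<in>P. (\<lambda>x\<in>P. u * (\<lambda>x\<in>P. c * f x) x) x + (\<lambda>x\<in>P. v * (\<lambda>x\<in>P. int p ^ i * f x) x) x)"
      using cocyclesD(3)[OF i(1)] by simp
    have "cl f = cl (\<lambda>x\<in>P. u * (\<lambda>x\<in>P. c * f x) x) \<oplus>\<^bsub>E\<^esub> cl (\<lambda>x\<in>P. v * (\<lambda>x\<in>P. int p ^ i * f x) x)"
      by (subst feq) (intro cl_add cocycle_scale i(1))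
    also have "\<dots> = \<zero>\<^bsub>E\<^esub>"
      using cl_zero_iff[OF cocycle_scale[OF cocycle_scale[OF i(1)]], THEN iffD2, OF coboundary_scale[OF c(2)]]
       cl_zero_iff[OF cocycle_scale[OF cocycle_scale[OF i(1)]], THEN iffD2, OF coboundary_scale[OF i(2)]]
      by simp
    finally show "x = \<one>\<^bsub>add_monoid (p_part p E)\<^esub>" using f by simp
  qed
  moreover have "\<psi> ` carrier (add_monoid (p_part p E)) = carrier (integer_mod_group p)"
  proof
    show "\<psi> ` carrier (add_monoid (p_part p E)) \<subseteq> carrier (integer_mod_group p)" using \<psi>.hom_closed by blast
    show "carrier (integer_mod_group p) \<subseteq> \<psi> ` carrier (add_monoid (p_part p E))"
    proof
      fix r assume "r \<in> carrier (integer_mod_group p)"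
      hence r: "r mod int p = r" using p0 by (simp add: carrier_integer_mod_group)
      obtain f i where f: "f \<in> Z" "(\<lambda>x\<in>P. int p ^ i * f x) \<in> B" "\<not> int p dvd f q" using surj by blast
      \<comment> \<open>\<open>u\<close> inverts \<open>f q\<close> modulo p, so the cocycle
        \<open>r * u * f\<close> has residue \<open>r\<close>.\<close>
      obtain u v where "u * f q + v * int p = 1"
        using p f(3) prime_imp_coprime[of "int p" "f q"] bezout_int[of "f q" "int p"]
        by (auto simp: coprime_commute)
      hence "(u * f q) mod int p = 1 mod int p" by (metis mod_mult_self1)
      hence "(r * (u * f q)) mod int p = r" using r by (metis mod_mult_right_eq mult.right_neutral)
      hence "\<psi> (cl (\<lambda>x\<in>P. (r * u) * f x)) = r"
        using \<psi>[OF cocycle_scale[OF f(1), of "r * u"]] q by (simp only: restrict_apply' mult.assoc)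
      moreover have "(\<lambda>x\<in>P. (r * u) * f x) \<in> X"
      proof -
        have "(\<lambda>x\<in>P. (r * u) * (\<lambda>x\<in>P. int p ^ i * f x) x) \<in> B" by (rule coboundary_scale[OF f(2)])
        also have "(\<lambda>x\<in>P. (r * u) * (\<lambda>x\<in>P. int p ^ i * f x) x) = (\<lambda>x\<in>P. int p ^ i * (\<lambda>x\<in>P. (r * u) * f x) x)"
          by (auto simp: fun_eq_iff)
        finally show ?thesis using cocycle_scale[OF f(1)] unfolding X_def by blast
      qed
      ultimately have "r \<in> \<psi> ` cl ` X" by (metis imageI)
      thus "r \<in> \<psi> ` carrier (add_monoid (p_part p E))" unfolding cX by simp
    qed
  qed
  ultimately have "\<psi> \<in> iso (add_monoid (p_part p E)) (integer_mod_group p)"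
    using hom by (simp add: iso_def bij_betw_def)
  thus ?thesis by (rule is_isoI)
qed

end

section \<open>Comparison of the canonical resolution with a complex of free modules of rank
  one\<close>

text \<open>
  The \<open>q n\<close> form a chain map to the canonical resolution from the rank one complex with differentials
  \<open>w n\<close>, and \<open>\<beta>\<close> is a map in the other direction that commutes with the differentials up to \<open>e\<close>.
  The choice \<open>q = 0\<close> covers the case where \<open>e\<close> annihilates the module.
\<close>

locale resolution_comparison = H: int_character R h
  for R :: "('r, 'a) ring_scheme" (structure) and h :: "'r \<Rightarrow> int" +
  fixes e :: 'r and w :: "nat \<Rightarrow> 'r" and q :: "nat \<Rightarrow> ('r, int) gen \<Rightarrow> 'r"
    and \<beta> :: "nat \<Rightarrow> (('r, int) gen \<Rightarrow> 'r) \<Rightarrow> 'r"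
  assumes e_closed: "e \<in> carrier R"
    and w_closed: "w n \<in> carrier R"
    and q_closed: "q n \<in> carrier (res_module R (int_module h) n)"
    and q_Suc: "res_bd R (q (Suc n)) = w n \<odot>\<^bsub>res_module R (int_module h) n\<^esub> q n"
    and beta_linear: "linear_on R (res_module R (int_module h) n) (regular_module R) (\<beta> n)"
    and beta_Suc: "x \<in> carrier (res_module R (int_module h) (Suc n)) \<Longrightarrow>
      e \<otimes> \<beta> n (res_bd R x) = w n \<otimes> \<beta> (Suc n) x"
    and beta_0: "x \<in> carrier (res_module R (int_module h) 0) \<Longrightarrow>
      h (\<beta> 0 x) * res_aug R (int_module h) (q 0) = h e * res_aug R (int_module h) x"
begin

abbreviation "M \<equiv> int_module h"

sublocale M: Module.module R M by (rule H.module_int_module)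

lemma beta_closed: "x \<in> carrier (res_module R M n) \<Longrightarrow> \<beta> n x \<in> carrier R"
  using linear_onD(1)[OF beta_linear] by simp

text \<open>\<open>res_homotopy\<close> applied to the composite of \<open>\<beta>\<close> with
  \<open>q\<close>: \<open>beta_Suc\<close> and \<open>q_Suc\<close> give its hypothesis
  \<open>link\<close>, and \<open>beta_0\<close> gives \<open>base\<close>.\<close>

lemma homotopy:
  obtains t s where "linear_on R (res_module R M n) (res_module R M (Suc n)) t"
    "linear_on R (res_module R M (Suc n)) (res_module R M (Suc (Suc n))) s"
    "\<And>x. x \<in> carrier (res_module R M (Suc n)) \<Longrightarrow>
      (e [^] Suc (Suc n)) \<odot>\<^bsub>res_module R M (Suc n)\<^esub> x =
      \<beta> (Suc n) x \<odot>\<^bsub>res_module R M (Suc n)\<^esub> q (Suc n)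
      \<oplus>\<^bsub>res_module R M (Suc n)\<^esub> t (res_bd R x) \<oplus>\<^bsub>res_module R M (Suc n)\<^esub> res_bd R (s x)"
proof (rule M.res_homotopy[OF e_closed, where T = "\<lambda>n x. \<beta> n x \<odot>\<^bsub>res_module R M n\<^esub> q n" and n = n])
  show "linear_on R (res_module R M n) (res_module R M n) (\<lambda>x. \<beta> n x \<odot>\<^bsub>res_module R M n\<^esub> q n)" for n
  proof -
    interpret P: Module.module R "res_module R M n" by (rule M.module_res_module)
    show ?thesis
      using linear_onD[OF beta_linear[of n]] q_closed[of n]
      by (intro linear_onI) (simp_all add: P.smult_l_distr P.smult_assoc1)
  qed
  show "e \<odot>\<^bsub>res_module R M n\<^esub> (\<beta> n (res_bd R x) \<odot>\<^bsub>res_module R M n\<^esub> q n) =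
      res_bd R (\<beta> (Suc n) x \<odot>\<^bsub>res_module R M (Suc n)\<^esub> q (Suc n))"
    if x: "x \<in> carrier (res_module R M (Suc n))" for n x
  proof -
    interpret P: Module.module R "res_module R M n" by (rule M.module_res_module)
    have "e \<odot>\<^bsub>res_module R M n\<^esub> (\<beta> n (res_bd R x) \<odot>\<^bsub>res_module R M n\<^esub> q n) =
      (e \<otimes> \<beta> n (res_bd R x)) \<odot>\<^bsub>res_module R M n\<^esub> q n"
      using e_closed q_closed beta_closed[OF M.res_bd_closed[OF x]] by (simp add: P.smult_assoc1)
    also have "\<dots> = (\<beta> (Suc n) x \<otimes> w n) \<odot>\<^bsub>res_module R M n\<^esub> q n"
      using beta_closed[OF x] w_closed by (simp only: beta_Suc[OF x] H.m_comm)
    also have "\<dots> = res_bd R (\<beta> (Suc n) x \<odot>\<^bsub>res_module R M (Suc n)\<^esub> q (Suc n))"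
      using beta_closed[OF x] w_closed q_closed
      by (simp only: M.res_bd_smult q_Suc P.smult_assoc1)
    finally show ?thesis .
  qed
  show "res_aug R M (\<beta> 0 x \<odot>\<^bsub>res_module R M 0\<^esub> q 0) = e \<odot>\<^bsub>M\<^esub> res_aug R M x"
    if x: "x \<in> carrier (res_module R M 0)" for x
    using beta_0[OF x] M.res_aug_smult[OF beta_closed[OF x] q_closed] by simp
qed (use that in blast)

end

locale resolution_comparison_coeff = resolution_comparison R h e w q \<beta> +
  C: int_module_cocycles R "int_module h" k n
  for R :: "('r, 'a) ring_scheme" (structure) and h e w q \<beta> k n
begin

text \<open>A cocycle kills the boundary term of the homotopy identity, so up to a power of
  \<open>k e\<close> and a coboundary only its value at \<open>q (Suc n)\<close> matters.\<close>

lemma cocycle_decomp: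
  assumes f: "f \<in> C.Z"
  obtains g where "linear_on R (res_module R M n) (int_module k) g"
    "\<And>x. x \<in> C.P \<Longrightarrow> k e ^ Suc (Suc n) * f x = k (\<beta> (Suc n) x) * f (q (Suc n)) + g (res_bd R x)"
proof -
  interpret P1: Module.module R "res_module R M (Suc n)" by (rule M.module_res_module)
  obtain t s where ts: "linear_on R (res_module R M n) (res_module R M (Suc n)) t"
    "linear_on R (res_module R M (Suc n)) (res_module R M (Suc (Suc n))) s"
    "\<And>x. x \<in> carrier (res_module R M (Suc n)) \<Longrightarrow>
      (e [^] Suc (Suc n)) \<odot>\<^bsub>res_module R M (Suc n)\<^esub> x =
      \<beta> (Suc n) x \<odot>\<^bsub>res_module R M (Suc n)\<^esub> q (Suc n)
      \<oplus>\<^bsub>res_module R M (Suc n)\<^esub> t (res_bd R x) \<oplus>\<^bsub>res_module R M (Suc n)\<^esub> res_bd R (s x)"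
    using homotopy[of n] by blast
  show thesis
  proof (rule that[of "\<lambda>x. f (t x)"])
    show "linear_on R (res_module R M n) (int_module k) (\<lambda>x. f (t x))"
      by (rule linear_on_compose[OF ts(1) cocyclesD(1)[OF f]])
    fix x assume x: "x \<in> C.P"
    have c: "\<beta> (Suc n) x \<in> carrier R" "q (Suc n) \<in> C.P" "t (res_bd R x) \<in> C.P"
      "res_bd R (s x) \<in> C.P" "e [^] Suc (Suc n) \<in> carrier R"
      using beta_closed[OF x] q_closed linear_onD(1)[OF ts(1) M.res_bd_closed[OF x]]
        M.res_bd_closed[OF linear_onD(1)[OF ts(2) x]] e_closed by auto
    have "f ((e [^] Suc (Suc n)) \<odot>\<^bsub>res_module R M (Suc n)\<^esub> x) =
      f (\<beta> (Suc n) x \<odot>\<^bsub>res_module R M (Suc n)\<^esub> q (Suc n)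
      \<oplus>\<^bsub>res_module R M (Suc n)\<^esub> t (res_bd R x) \<oplus>\<^bsub>res_module R M (Suc n)\<^esub> res_bd R (s x))"
      by (simp only: ts(3)[OF x])
    thus "k e ^ Suc (Suc n) * f x = k (\<beta> (Suc n) x) * f (q (Suc n)) + f (t (res_bd R x))"
      using c x e_closed cocyclesD(2)[OF f linear_onD(1)[OF ts(2) x]]
      by (simp only: linear_onD(2,3)[OF cocyclesD(1)[OF f]] P1.a_closed P1.smult_closed
          int_module_simps C.char_pow add_0_right)
  qed
qed

lemma beta_link:
  assumes "x \<in> C.P"
  shows "k e * k (\<beta> n (res_bd R x)) = k (w n) * k (\<beta> (Suc n) x)"
  using arg_cong[OF beta_Suc[OF assms], of k] assms e_closed w_closed
    beta_closed[OF assms] beta_closed[OF M.res_bd_closed[OF assms]]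
  by (simp add: C.char_mult)

lemma linear_char_beta: "linear_on R (res_module R M m) (int_module k) (\<lambda>x. k (\<beta> m x))"
  by (rule linear_on_compose[OF beta_linear C.linear_on_char])

text \<open>The main term in the decomposition of \<open>f\<close> contains
  \<open>k (w n) * k (\<beta> (Suc n) x)\<close>, which \<open>beta_link\<close> rewrites as a
  function of \<open>res_bd R x\<close>; so the main term is a coboundary too.\<close>

lemma cocycle_power_coboundary:
  assumes f: "f \<in> C.Z" and z: "f (q (Suc n)) = k (w n) * z"
  shows "(\<lambda>x\<in>C.P. k e ^ Suc (Suc n) * f x) \<in> C.B"
proof -
  obtain g where g: "linear_on R (res_module R M n) (int_module k) g"
    "\<And>x. x \<in> C.P \<Longrightarrow> k e ^ Suc (Suc n) * f x = k (\<beta> (Suc n) x) * f (q (Suc n)) + g (res_bd R x)"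
    by (rule cocycle_decomp[OF f]) blast
  let ?g = "\<lambda>x. (k e * z) * k (\<beta> n x) \<oplus>\<^bsub>int_module k\<^esub> g x"
  have "linear_on R (res_module R M n) (int_module k) ?g"
    by (intro linear_on_add M.module_res_module C.module_int_module g C.linear_scale_int linear_char_beta)
  moreover have "k e ^ Suc (Suc n) * f x = ?g (res_bd R x)" if x: "x \<in> C.P" for x
  proof -
    have "k (\<beta> (Suc n) x) * f (q (Suc n)) = z * (k (w n) * k (\<beta> (Suc n) x))"
      by (simp add: z algebra_simps)
    also have "\<dots> = (k e * z) * k (\<beta> n (res_bd R x))"
      by (simp only: beta_link[OF x, symmetric] mult_ac)
    finally show ?thesis using g(2)[OF x] by simp
  qed
  ultimately show ?thesis
    by (subst coboundaries_iff[OF M.module_axioms]) (auto intro!: exI[of _ ?g])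
qed

text \<open>\<open>w (Suc n)\<close> times \<open>q (Suc n)\<close> is the boundary of the next
  \<open>q\<close>, and cocycles vanish there.\<close>

lemma cocycle_q:
  assumes f: "f \<in> C.Z"
  shows "k (w (Suc n)) * f (q (Suc n)) = 0"
  using cocyclesD(2)[OF f q_closed] linear_onD(3)[OF cocyclesD(1)[OF f] w_closed q_closed]
  by (simp add: q_Suc)

lemma p_part_Ext_zero:
  assumes p: "prime p" "\<not> int p dvd k e" and 0: "\<And>f. f \<in> C.Z \<Longrightarrow> f (q (Suc n)) = 0"
  shows "carrier (p_part p C.E) = {\<zero>\<^bsub>p_part p C.E\<^esub>}"
proof (rule C.p_part_zero[OF p(1)])
  fix f assume f: "f \<in> C.Z"
  have "\<not> int p dvd k e ^ Suc (Suc n)" using p by (metis prime_dvd_power prime_nat_int_transfer)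
  moreover have "(\<lambda>x\<in>C.P. k e ^ Suc (Suc n) * f x) \<in> C.B"
    by (rule cocycle_power_coboundary[OF f, of 0]) (simp add: 0[OF f])
  ultimately show "\<exists>c. \<not> int p dvd c \<and> (\<lambda>x\<in>C.P. c * f x) \<in> C.B" by blast
qed

text \<open>In the rank one complex the outgoing differential is 0 and the incoming one is
  \<open>int p * \<mu>\<close>, so the cohomology is the quotient of the integers by
  \<open>int p * \<mu>\<close>, whose p-part has order p. The hypothesis on \<open>\<beta>\<close>
  makes evaluation at \<open>q (Suc n)\<close> surjective modulo p.\<close>

lemma p_part_Ext_cyclic:
  assumes p: "prime p" "\<not> int p dvd k e"
    and w: "k (w (Suc n)) = 0" "k (w n) = int p * \<mu>" "\<not> int p dvd \<mu>"
    and \<beta>: "\<not> int p dvd k (\<beta> (Suc n) (q (Suc n)))"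
  shows "add_monoid (p_part p C.E) \<cong> integer_mod_group p"
proof (rule C.p_part_cyclic[OF p(1), of "q (Suc n)"])
  have pp: "prime (int p)" using p(1) by simp
  show q: "q (Suc n) \<in> C.P" by (rule q_closed)
  have bd: "\<exists>z. f (q (Suc n)) = int p * \<mu> * z" if f: "f \<in> C.B" for f
  proof -
    have "f \<in> extensional C.P" using f by (auto simp: coboundaries_def)
    then obtain g where g: "linear_on R (res_module R M n) (int_module k) g"
      "\<And>x. x \<in> C.P \<Longrightarrow> f x = g (res_bd R x)"
      using coboundaries_iff[OF M.module_axioms] f by blast
    show ?thesis
      using g(2)[OF q] linear_onD(3)[OF g(1) w_closed q_closed] w(2) by (simp add: q_Suc)
  qed
  show "int p dvd f (q (Suc n))" if "f \<in> C.B" for f using bd[OF that] by auto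
  show "\<exists>c. \<not> int p dvd c \<and> (\<lambda>x\<in>C.P. c * f x) \<in> C.B"
    if f: "f \<in> C.Z" "(\<lambda>x\<in>C.P. int p ^ i * f x) \<in> C.B" "int p dvd f (q (Suc n))" for f i
  proof -
    have cop: "coprime \<mu> (int p)" using pp w(3) prime_imp_coprime coprime_commute by blast
    obtain z where "int p ^ i * f (q (Suc n)) = int p * \<mu> * z" using bd[OF f(2)] q by auto
    \<comment> \<open>\<open>\<mu>\<close> is prime to p, so it already divides
      \<open>f (q (Suc n))\<close>; together with the factor p this is divisibility by
      \<open>k (w n)\<close>.\<close>
    hence "\<mu> dvd int p ^ i * f (q (Suc n))" by simp
    hence "\<mu> dvd f (q (Suc n))" using cop by (simp add: coprime_dvd_mult_right_iff)
    hence "int p * \<mu> dvd f (q (Suc n))" using f(3) cop by (simp add: divides_mult coprime_commute)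
    then obtain y where "f (q (Suc n)) = k (w n) * y" using w(2) by (auto simp: dvd_def)
    from cocycle_power_coboundary[OF f(1) this]
    show ?thesis using p prime_dvd_power[OF pp, of "k e" "Suc (Suc n)"] by blast
  qed
  \<comment> \<open>The factor \<open>\<mu>\<close> puts the class into the p-part: p times this
    cochain is \<open>k (w n) * k (\<beta> (Suc n) x)\<close>, a coboundary by
    \<open>beta_link\<close>.\<close>
  let ?f = "\<lambda>x\<in>C.P. \<mu> * k (\<beta> (Suc n) x)"
  have "?f \<in> C.Z"
  proof (rule cocyclesI[OF M.module_axioms C.linear_scale_int[OF linear_char_beta]])
    fix x assume x: "x \<in> carrier (res_module R M (Suc (Suc n)))"
    have "k e * k (\<beta> (Suc n) (res_bd R x)) = 0"
      using arg_cong[OF beta_Suc[OF x], of k] x e_closed w_closed w(1)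
        beta_closed[OF x] beta_closed[OF M.res_bd_closed[OF x]]
      by (simp add: C.char_mult)
    moreover have "k e \<noteq> 0" using p(2) by auto
    ultimately show "\<mu> * k (\<beta> (Suc n) (res_bd R x)) = \<zero>\<^bsub>int_module k\<^esub>" by simp
  qed
  moreover have "(\<lambda>x\<in>C.P. int p ^ 1 * ?f x) \<in> C.B"
  proof -
    have "int p ^ 1 * ?f x = k e * k (\<beta> n (res_bd R x))" if "x \<in> C.P" for x
      using beta_link[OF that] w(2) that by simp
    thus ?thesis
      by (subst coboundaries_iff[OF M.module_axioms])
        (auto intro!: exI[of _ "\<lambda>x. k e * k (\<beta> n x)"] C.linear_scale_int linear_char_beta)
  qed
  moreover have "\<not> int p dvd ?f (q (Suc n))"
    using q w(3) \<beta> prime_dvd_multD[OF pp] by auto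
  ultimately show "\<exists>f i. f \<in> C.Z \<and> (\<lambda>x\<in>C.P. int p ^ i * f x) \<in> C.B \<and> \<not> int p dvd f (q (Suc n))"
    by blast
qed

end

section \<open>The p-part of Ext between characters: vanishing and periodicity\<close>

abbreviation Ext_p_part :: "('r, 'a) ring_scheme \<Rightarrow> nat \<Rightarrow> ('r \<Rightarrow> int) \<Rightarrow> ('r \<Rightarrow> int) \<Rightarrow> nat \<Rightarrow>
    ('r, ((('r, int) gen \<Rightarrow> 'r) \<Rightarrow> int) set) module" where
  "Ext_p_part R p h k l \<equiv> p_part p (Ext R l (int_module h) (int_module k))"

lemma Ext_p_part_zeroI:
  assumes h: "int_character R h" and k: "int_character R k" and p: "prime p"
    and a: "a \<in> carrier R" "h a = 0" "\<not> int p dvd k a" and l: "l \<ge> 1"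
  shows "carrier (Ext_p_part R p h k l) = {\<zero>\<^bsub>Ext_p_part R p h k l\<^esub>}"
proof -
  interpret H: int_character R h by fact
  interpret K: int_character R k by fact
  interpret M: Module.module R "int_module h" by (rule H.module_int_module)
  obtain n where n: "l = Suc n" using l by (cases l) auto
  let ?P = "res_module R (int_module h)"
  \<comment> \<open>With \<open>h a = 0\<close> both sides of \<open>beta_0\<close> vanish, so zero
    maps in both directions are a valid comparison.\<close>
  interpret RC: resolution_comparison R h a "\<lambda>_. \<zero>\<^bsub>R\<^esub>" "\<lambda>n. \<zero>\<^bsub>?P n\<^esub>" "\<lambda>_ _. \<zero>\<^bsub>R\<^esub>"
  proof
    fix m
    interpret P: Module.module R "?P m" by (rule M.module_res_module)
    interpret P1: Module.module R "?P (Suc m)" by (rule M.module_res_module)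
    show "\<zero>\<^bsub>?P m\<^esub> \<in> carrier (?P m)" by simp
    show "res_bd R \<zero>\<^bsub>?P (Suc m)\<^esub> = \<zero>\<^bsub>R\<^esub> \<odot>\<^bsub>?P m\<^esub> \<zero>\<^bsub>?P m\<^esub>"
      using linear_on_zero[OF P1.module_axioms P.module_axioms M.linear_res_bd] by simp
    show "linear_on R (?P m) (regular_module R) (\<lambda>_. \<zero>\<^bsub>R\<^esub>)" by (simp add: linear_on_def)
  qed (simp_all add: a H.char_zero)
  interpret resolution_comparison_coeff R h a "\<lambda>_. \<zero>\<^bsub>R\<^esub>" "\<lambda>n. \<zero>\<^bsub>?P n\<^esub>" "\<lambda>_ _. \<zero>\<^bsub>R\<^esub>" k n ..
  show ?thesis unfolding n
    by (rule p_part_Ext_zero[OF p a(3)])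
      (rule linear_on_zero[OF M.module_res_module K.module_int_module cocyclesD(1), simplified])
qed

text \<open>\<open>k\<close> maps onto the integers because it sends \<one> to 1; projectivity then
  lifts the scaled augmentation through \<open>k\<close>.\<close>

lemma (in int_character) lift_aug:
  assumes c: "c \<in> carrier R"
  obtains f where "linear_on R (res_module R (int_module k) 0) (regular_module R) f"
    "\<And>x. x \<in> carrier (res_module R (int_module k) 0) \<Longrightarrow> k (f x) = k c * res_aug R (int_module k) x"
proof -
  interpret M: Module.module R "int_module k" by (rule module_int_module)
  have "linear_on R (res_module R (int_module k) 0) (int_module k) (\<lambda>x. c \<odot>\<^bsub>int_module k\<^esub> res_aug R (int_module k) x)"
    by (rule linear_on_scale[OF M.module_res_module module_int_module M.linear_res_aug c])
  hence T: "linear_on R (res_module R (int_module k) 0) (int_module k) (\<lambda>x. k c * res_aug R (int_module k) x)"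
    by simp
  have "z \<in> k ` carrier (regular_module R)" for z
    using char_surj[of z] by (metis imageI regular_module_simps(1))
  from M.res_lift[OF module_regular_module module_int_module linear_on_char T this] that
  show thesis by blast
qed

lemma Ext_p_part_self_zeroI:
  assumes h: "int_character R h" and p: "prime p"
    and e: "e \<in> carrier R" "\<not> int p dvd h e" "\<And>a. a \<in> carrier R \<Longrightarrow> h a = 0 \<Longrightarrow> e \<otimes>\<^bsub>R\<^esub> a = \<zero>\<^bsub>R\<^esub>"
    and l: "l \<ge> 1"
  shows "carrier (Ext_p_part R p h h l) = {\<zero>\<^bsub>Ext_p_part R p h h l\<^esub>}"
proof -
  interpret H: int_character R h by fact
  interpret M: Module.module R "int_module h" by (rule H.module_int_module)
  obtain n where n: "l = Suc n" using l by (cases l) auto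
  let ?P = "res_module R (int_module h)"
  obtain q0 where q0: "q0 \<in> carrier (?P 0)" "res_aug R (int_module h) q0 = 1"
    using M.res_aug_surj by (metis UNIV_I imageE int_module_simps(1))
  obtain f where f: "linear_on R (?P 0) (regular_module R) f"
    "\<And>x. x \<in> carrier (?P 0) \<Longrightarrow> h (f x) = h e * res_aug R (int_module h) x"
    using H.lift_aug[OF e(1)] by blast
  let ?q = "\<lambda>n. if n = 0 then q0 else \<zero>\<^bsub>?P n\<^esub>" and ?\<beta> = "\<lambda>n x. if n = 0 then f x else \<zero>\<^bsub>R\<^esub>"
  interpret RC: resolution_comparison R h e "\<lambda>_. \<zero>\<^bsub>R\<^esub>" ?q ?\<beta>
  proof
    fix m
    interpret P: Module.module R "?P m" by (rule M.module_res_module)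
    interpret P1: Module.module R "?P (Suc m)" by (rule M.module_res_module)
    show qm: "?q m \<in> carrier (?P m)" using q0 by simp
    show "res_bd R (?q (Suc m)) = \<zero>\<^bsub>R\<^esub> \<odot>\<^bsub>?P m\<^esub> ?q m"
      using linear_on_zero[OF P1.module_axioms P.module_axioms M.linear_res_bd] P.smult_l_null[OF qm] by simp
    show "linear_on R (?P m) (regular_module R) (?\<beta> m)"
      using f(1) by (cases m) (simp_all add: linear_on_def)
    show "e \<otimes>\<^bsub>R\<^esub> ?\<beta> m (res_bd R x) = \<zero>\<^bsub>R\<^esub> \<otimes>\<^bsub>R\<^esub> ?\<beta> (Suc m) x" if x: "x \<in> carrier (?P (Suc m))" for x
    proof (cases "m = 0")
      case True
      have x0: "x \<in> carrier (?P (Suc 0))" using x True by simp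
      have "f (res_bd R x) \<in> carrier R"
        using linear_onD(1)[OF f(1) M.res_bd_closed[OF x0]] by simp
      \<comment> \<open>The augmentation kills boundaries, so the lift sends them into the kernel of
        \<open>h\<close>, which \<open>e\<close> annihilates.\<close>
      moreover have "h (f (res_bd R x)) = 0"
        using f(2)[OF M.res_bd_closed[OF x0]] M.res_aug_bd[OF x0] by simp
      ultimately show ?thesis using e(3) True by simp
    qed (simp add: e)
    show "h (?\<beta> 0 x) * res_aug R (int_module h) (?q 0) = h e * res_aug R (int_module h) x"
      if "x \<in> carrier (?P 0)" for x using f(2)[OF that] q0 by simp
  qed (simp_all add: e)
  interpret resolution_comparison_coeff R h e "\<lambda>_. \<zero>\<^bsub>R\<^esub>" ?q ?\<beta> h n ..
  show ?thesis unfolding n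
  proof (rule p_part_Ext_zero[OF p e(2)])
    show "f (?q (Suc n)) = 0" if "f \<in> C.Z" for f
      using linear_on_zero[OF M.module_res_module H.module_int_module cocyclesD(1)[OF that]] by simp
  qed
qed

text \<open>The assumptions encode exactness up to \<open>e\<close> of the complex with
  differentials \<open>u, v, u, v, ...\<close>. If \<open>u \<otimes> a = \<zero>\<close> then
  \<open>j a = 0\<close>, since \<open>j u\<close> is nonzero, and \<open>ker_j\<close> makes
  \<open>e \<otimes> a\<close> a multiple of \<open>v\<close>; the same holds with the roles
  exchanged.\<close>

locale paired_characters = H: int_character R h + J: int_character R j
  for R :: "('r, 'a) ring_scheme" (structure) and h j :: "'r \<Rightarrow> int" +
  fixes p :: nat and e u v :: 'r and \<mu> \<nu> :: int
  assumes prime_p: "prime p"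
    and closed: "e \<in> carrier R" "u \<in> carrier R" "v \<in> carrier R"
    and cong_hj: "a \<in> carrier R \<Longrightarrow> [h a = j a] (mod int p)"
    and he: "\<not> int p dvd h e"
    and hu: "h u = 0" and ju: "j u = int p * \<mu>" "\<not> int p dvd \<mu>"
    and jv: "j v = 0" and hv: "h v = int p * \<nu>" "\<not> int p dvd \<nu>"
    and uv: "u \<otimes> v = \<zero>"
    and ker_h: "a \<in> carrier R \<Longrightarrow> h a = 0 \<Longrightarrow> \<exists>c\<in>carrier R. e \<otimes> a = u \<otimes> c"
    and ker_j: "a \<in> carrier R \<Longrightarrow> j a = 0 \<Longrightarrow> \<exists>c\<in>carrier R. e \<otimes> a = v \<otimes> c"
begin

definition w where "w (n::nat) = (if even n then u else v)"
text \<open>Up to \<open>e\<close>, the kernel of \<open>\<chi> n\<close> is the image of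
  multiplication by \<open>w n\<close>.\<close>

definition \<chi> where "\<chi> (n::nat) = (if even n then h else j)"

lemma w_closed: "w n \<in> carrier R"
  by (simp add: w_def closed)

lemma char_chi: "int_character R (\<chi> n)"
  by (simp add: \<chi>_def H.int_character_axioms J.int_character_axioms)

lemma chi_w: "\<chi> n (w n) = 0" "\<chi> (Suc n) (w n) \<noteq> 0"
  using ju hv prime_gt_0_nat[OF prime_p] by (auto simp: w_def \<chi>_def hu jv)

lemma w_w: "w (Suc n) \<otimes> w n = \<zero>"
  using uv closed H.m_comm by (simp add: w_def)

lemma ker_chi: "a \<in> carrier R \<Longrightarrow> \<chi> n a = 0 \<Longrightarrow> \<exists>c\<in>carrier R. e \<otimes> a = w n \<otimes> c"
  using ker_h ker_j by (auto simp: \<chi>_def w_def split: if_splits)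

lemma dvd_chi_iff: "a \<in> carrier R \<Longrightarrow> int p dvd \<chi> n a \<longleftrightarrow> int p dvd h a"
  using cong_hj cong_dvd_iff by (auto simp: \<chi>_def)

abbreviation "M \<equiv> int_module h"

sublocale M: Module.module R M by (rule H.module_int_module)

abbreviation "P \<equiv> res_module R M"

text \<open>Recursion on the degree, with the invariant that \<open>w n\<close> times
  \<open>q n\<close> is already a boundary. It propagates because
  \<open>w (Suc n) \<otimes> w n = \<zero>\<close> makes \<open>w (Suc n)\<close> times the next
  element a cycle.\<close>

lemma exists_q:
  obtains q where "\<And>n. q n \<in> carrier (P n)" "\<And>n. res_bd R (q (Suc n)) = w n \<odot>\<^bsub>P n\<^esub> q n"
    "res_aug R M (q 0) = 1"
proof -
  let ?I = "\<lambda>n x. x \<in> carrier (P n) \<and> (n = 0 \<longrightarrow> res_aug R M x = 1) \<and>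
    w n \<odot>\<^bsub>P n\<^esub> x \<in> res_bd R ` carrier (P (Suc n))"
  have "\<exists>q. \<forall>n. ?I n (q n) \<and> res_bd R (q (Suc n)) = w n \<odot>\<^bsub>P n\<^esub> q n"
  proof (rule dependent_nat_choice)
    interpret P: Module.module R "P 0" by (rule M.module_res_module)
    obtain x where x: "x \<in> carrier (P 0)" "res_aug R M x = 1"
      using M.res_aug_surj by (metis UNIV_I imageE int_module_simps(1))
    have "res_aug R M (w 0 \<odot>\<^bsub>P 0\<^esub> x) = 0"
      using M.res_aug_smult[OF w_closed x(1), of 0] by (simp add: w_def hu)
    hence "w 0 \<odot>\<^bsub>P 0\<^esub> x \<in> res_bd R ` carrier (P (Suc 0))"
      using M.res_aug_exact[OF P.smult_closed[OF w_closed x(1)], of 0] by (simp only: int_module_simps simp_thms)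
    hence "?I 0 x" using x by blast
    thus "\<exists>x. ?I 0 x" by blast
  next
    fix x n assume I: "?I n x"
    interpret P: Module.module R "P n" by (rule M.module_res_module)
    interpret P1: Module.module R "P (Suc n)" by (rule M.module_res_module)
    obtain y where y: "y \<in> carrier (P (Suc n))" "res_bd R y = w n \<odot>\<^bsub>P n\<^esub> x" using I by auto
    have "res_bd R (w (Suc n) \<odot>\<^bsub>P (Suc n)\<^esub> y) = (w (Suc n) \<otimes> w n) \<odot>\<^bsub>P n\<^esub> x"
      using y I w_closed by (simp add: M.res_bd_smult P.smult_assoc1)
    also have "\<dots> = \<zero>\<^bsub>P n\<^esub>" using I by (simp add: w_w)
    finally have "w (Suc n) \<odot>\<^bsub>P (Suc n)\<^esub> y \<in> res_bd R ` carrier (P (Suc (Suc n)))"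
      using M.res_bd_exact[OF P1.smult_closed[OF w_closed y(1)]] by blast
    thus "\<exists>y. ?I (Suc n) y \<and> res_bd R y = w n \<odot>\<^bsub>P n\<^esub> x" using y by auto
  qed
  thus thesis using that by blast
qed

text \<open>Recursion on the degree by projectivity. The invariant says that \<open>\<chi> n\<close>
  kills the values on boundaries; \<open>ker_chi\<close> then makes these values divisible by
  \<open>w n\<close>, but only after multiplication by \<open>e\<close>.\<close>

lemma exists_beta:
  obtains \<beta> where "\<And>n. linear_on R (P n) (regular_module R) (\<beta> n)"
    "\<And>n x. x \<in> carrier (P (Suc n)) \<Longrightarrow> e \<otimes> \<beta> n (res_bd R x) = w n \<otimes> \<beta> (Suc n) x"
    "\<And>x. x \<in> carrier (P 0) \<Longrightarrow> h (\<beta> 0 x) = h e * res_aug R M x"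
proof -
  let ?I = "\<lambda>n f. linear_on R (P n) (regular_module R) f \<and>
    (n = 0 \<longrightarrow> (\<forall>x\<in>carrier (P 0). h (f x) = h e * res_aug R M x)) \<and>
    (\<forall>x\<in>carrier (P (Suc n)). \<chi> n (f (res_bd R x)) = 0)"
  have "\<exists>\<beta>. \<forall>n. ?I n (\<beta> n) \<and> (\<forall>x\<in>carrier (P (Suc n)). e \<otimes> \<beta> n (res_bd R x) = w n \<otimes> \<beta> (Suc n) x)"
  proof (rule dependent_nat_choice)
    obtain f where f: "linear_on R (P 0) (regular_module R) f"
      "\<And>x. x \<in> carrier (P 0) \<Longrightarrow> h (f x) = h e * res_aug R M x"
      using H.lift_aug[OF closed(1)] by blast
    have "\<chi> 0 (f (res_bd R x)) = 0" if x: "x \<in> carrier (P (Suc 0))" for x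
      using f(2)[OF M.res_bd_closed[OF x]] M.res_aug_bd[OF x] by (simp add: \<chi>_def)
    hence "?I 0 f" using f by blast
    thus "\<exists>f. ?I 0 f" by blast
  next
    fix f n assume I: "?I n f"
    hence f: "linear_on R (P n) (regular_module R) f"
      "\<And>x. x \<in> carrier (P (Suc n)) \<Longrightarrow> \<chi> n (f (res_bd R x)) = 0" by blast+
    interpret P: Module.module R "P n" by (rule M.module_res_module)
    have fc: "f (res_bd R x) \<in> carrier R" if "x \<in> carrier (P (Suc n))" for x
      using linear_onD(1)[OF f(1) M.res_bd_closed[OF that]] by simp
    have \<delta>: "linear_on R (regular_module R) (regular_module R) (\<lambda>x. w n \<otimes> x)"
      using linear_on_scale[OF H.module_regular_module H.module_regular_module linear_on_id w_closed] by simp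
    have T: "linear_on R (P (Suc n)) (regular_module R) (\<lambda>x. e \<otimes> f (res_bd R x))"
      using linear_on_scale[OF M.module_res_module H.module_regular_module
          linear_on_compose[OF M.linear_res_bd f(1)] closed(1)] by simp
    have im: "e \<otimes> f (res_bd R x) \<in> (\<lambda>x. w n \<otimes> x) ` carrier (regular_module R)"
      if x: "x \<in> carrier (P (Suc n))" for x
      using ker_chi[OF fc[OF x] f(2)[OF x]] by auto
    obtain g where g: "linear_on R (P (Suc n)) (regular_module R) g"
      "\<And>x. x \<in> carrier (P (Suc n)) \<Longrightarrow> w n \<otimes> g x = e \<otimes> f (res_bd R x)"
      using M.res_lift[OF H.module_regular_module H.module_regular_module \<delta> T im] by blast
    \<comment> \<open>\<open>w n \<otimes> g (res_bd R x)\<close> is zero and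
      \<open>\<chi> (Suc n)\<close> is nonzero on \<open>w n\<close>, so the factor cancels once the
      character is applied.\<close>
    have "\<chi> (Suc n) (g (res_bd R x)) = 0" if x: "x \<in> carrier (P (Suc (Suc n)))" for x
    proof -
      interpret X: int_character R "\<chi> (Suc n)" by (rule char_chi)
      have "w n \<otimes> g (res_bd R x) = e \<otimes> f (res_bd R (res_bd R x))"
        by (rule g(2)[OF M.res_bd_closed[OF x]])
      also have "\<dots> = \<zero>"
        using M.res_bd_bd[OF x] linear_on_zero[OF M.module_res_module H.module_regular_module f(1)] closed
        by simp
      finally have "\<chi> (Suc n) (w n) * \<chi> (Suc n) (g (res_bd R x)) = 0"
        using X.char_mult[OF w_closed[of n], of "g (res_bd R x)"] linear_onD(1)[OF g(1) M.res_bd_closed[OF x]]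
        by (simp add: X.char_zero)
      thus ?thesis using chi_w(2) by simp
    qed
    thus "\<exists>g. ?I (Suc n) g \<and> (\<forall>x\<in>carrier (P (Suc n)). e \<otimes> f (res_bd R x) = w n \<otimes> g x)"
      using g(1) g(2)[symmetric] by (intro exI[of _ g] conjI impI ballI) simp_all
  qed
  then obtain \<beta> where \<beta>: "\<And>n. ?I n (\<beta> n)"
    "\<And>n. \<forall>x\<in>carrier (P (Suc n)). e \<otimes> \<beta> n (res_bd R x) = w n \<otimes> \<beta> (Suc n) x"
    by metis
  show thesis
  proof (rule that[of \<beta>])
    show "linear_on R (P n) (regular_module R) (\<beta> n)" for n using \<beta>(1)[of n] by blast
    show "e \<otimes> \<beta> n (res_bd R x) = w n \<otimes> \<beta> (Suc n) x" if "x \<in> carrier (P (Suc n))" for n x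
      using \<beta>(2)[of n] that by blast
    show "h (\<beta> 0 x) = h e * res_aug R M x" if "x \<in> carrier (P 0)" for x
      using \<beta>(1)[of 0] that by blast
  qed
qed

text \<open>Under Hom into the integers \<open>w n\<close> becomes the number
  \<open>k (w n)\<close>, which is 0 for one parity of \<open>n\<close> and p times an integer prime
  to p for the other. Passing from \<open>k = h\<close> to \<open>k = j\<close> exchanges the
  parities.\<close>

lemma Ext_p_part_pair:
  assumes l: "l \<ge> 1"
  shows "odd l \<Longrightarrow> carrier (Ext_p_part R p h h l) = {\<zero>\<^bsub>Ext_p_part R p h h l\<^esub>}"
    and "even l \<Longrightarrow> add_monoid (Ext_p_part R p h h l) \<cong> integer_mod_group p"
    and "odd l \<Longrightarrow> add_monoid (Ext_p_part R p h j l) \<cong> integer_mod_group p"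
    and "even l \<Longrightarrow> carrier (Ext_p_part R p h j l) = {\<zero>\<^bsub>Ext_p_part R p h j l\<^esub>}"
proof -
  obtain n where n: "l = Suc n" using l by (cases l) auto
  obtain q where q: "\<And>n. q n \<in> carrier (P n)" "\<And>n. res_bd R (q (Suc n)) = w n \<odot>\<^bsub>P n\<^esub> q n"
    "res_aug R M (q 0) = 1" by (rule exists_q) blast
  obtain \<beta> where \<beta>: "\<And>n. linear_on R (P n) (regular_module R) (\<beta> n)"
    "\<And>n x. x \<in> carrier (P (Suc n)) \<Longrightarrow> e \<otimes> \<beta> n (res_bd R x) = w n \<otimes> \<beta> (Suc n) x"
    "\<And>x. x \<in> carrier (P 0) \<Longrightarrow> h (\<beta> 0 x) = h e * res_aug R M x" by (rule exists_beta) blast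
  interpret RC: resolution_comparison R h e w q \<beta>
    by unfold_locales (simp_all add: closed w_closed q \<beta>)
  have bq: "\<beta> m (q m) \<in> carrier R" for m by (rule RC.beta_closed[OF q(1)])
  \<comment> \<open>In \<open>beta_Suc\<close> at \<open>q (Suc m)\<close> the factor
    \<open>w m\<close> is cancelled by a character nonzero on it. As \<open>h\<close> and
    \<open>j\<close> agree modulo p, each degree only contributes the factor \<open>h e\<close>, a
    unit modulo p.\<close>
  have unit: "\<not> int p dvd h (\<beta> m (q m))" for m
  proof (induction m)
    case 0
    show ?case using \<beta>(3)[OF q(1)] q(3) he by simp
  next
    case (Suc m)
    interpret X: int_character R "\<chi> (Suc m)" by (rule char_chi)
    have "e \<otimes> (w m \<otimes> \<beta> m (q m)) = w m \<otimes> \<beta> (Suc m) (q (Suc m))"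
      using \<beta>(2)[OF q(1), of m] linear_onD(3)[OF \<beta>(1) w_closed q(1), of m] q(2)[of m] by simp
    from arg_cong[OF this, of "\<chi> (Suc m)"]
    have "\<chi> (Suc m) e * \<chi> (Suc m) (\<beta> m (q m)) = \<chi> (Suc m) (\<beta> (Suc m) (q (Suc m)))"
      using bq closed w_closed chi_w(2)[of m] by (simp add: X.char_mult)
    moreover have "\<not> int p dvd \<chi> (Suc m) e * \<chi> (Suc m) (\<beta> m (q m))"
      using Suc he bq closed prime_p by (simp add: dvd_chi_iff prime_dvd_mult_iff)
    ultimately show ?case using dvd_chi_iff[OF bq] by metis
  qed
  have je: "\<not> int p dvd j e" and unitj: "\<not> int p dvd j (\<beta> m (q m))" for m
    using dvd_chi_iff[of _ 1] he unit bq closed by (simp_all add: \<chi>_def)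
  interpret HH: resolution_comparison_coeff R h e w q \<beta> h n ..
  interpret HJ: resolution_comparison_coeff R h e w q \<beta> j n ..
  have v0: "h v \<noteq> 0" and u0: "j u \<noteq> 0" using hv ju prime_gt_0_nat[OF prime_p] by auto
  \<comment> \<open>Here the outgoing differential is nonzero, which forces cocycles to vanish at
    \<open>q (Suc n)\<close>.\<close>
  show "carrier (Ext_p_part R p h h l) = {\<zero>\<^bsub>Ext_p_part R p h h l\<^esub>}" if "odd l"
    unfolding n by (rule HH.p_part_Ext_zero[OF prime_p he])
      (use HH.cocycle_q that v0 in \<open>simp add: n w_def\<close>)
  show "add_monoid (Ext_p_part R p h h l) \<cong> integer_mod_group p" if "even l"
    unfolding n by (rule HH.p_part_Ext_cyclic[OF prime_p he _ _ hv(2) unit])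
      (use that in \<open>simp_all add: n w_def hu hv\<close>)
  show "add_monoid (Ext_p_part R p h j l) \<cong> integer_mod_group p" if "odd l"
    unfolding n by (rule HJ.p_part_Ext_cyclic[OF prime_p je _ _ ju(2) unitj])
      (use that in \<open>simp_all add: n w_def jv ju\<close>)
  show "carrier (Ext_p_part R p h j l) = {\<zero>\<^bsub>Ext_p_part R p h j l\<^esub>}" if "even l"
    unfolding n by (rule HJ.p_part_Ext_zero[OF prime_p je])
      (use HJ.cocycle_q that u0 in \<open>simp add: n w_def\<close>)
qed

end

section \<open>Transitive G-sets\<close>

context group begin

text \<open>Carriers of a \<open>gset\<close> consist of natural numbers, so a finite G-set over
  another type is transported along an injection.\<close>

lemma gset_of_action:
  fixes act :: "'a \<Rightarrow> 'x \<Rightarrow> 'x"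
  assumes "finite E"
    "\<And>g x. g \<in> carrier G \<Longrightarrow> x \<in> E \<Longrightarrow> act g x \<in> E"
    "\<And>x. x \<in> E \<Longrightarrow> act \<one> x = x"
    "\<And>g h x. g \<in> carrier G \<Longrightarrow> h \<in> carrier G \<Longrightarrow> x \<in> E \<Longrightarrow> act (g \<otimes> h) x = act g (act h x)"
  obtains U f where "finite_gset G U" "bij_betw f E (fst U)"
    "\<And>g x. g \<in> carrier G \<Longrightarrow> x \<in> E \<Longrightarrow> snd U g (f x) = f (act g x)"
proof -
  obtain f :: "'x \<Rightarrow> nat" where f: "inj_on f E"
    using finite_imp_inj_to_nat_seg[OF assms(1)] by blast
  let ?U = "(f ` E, \<lambda>g. \<lambda>n\<in>f ` E. f (act g (inv_into E f n)))"
  have "finite_gset G ?U"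
    by (rule finite_gsetI) (use assms f in \<open>auto simp: inj_on_eq_iff[OF f]\<close>)
  thus thesis
    by (rule that[of _ f]) (use f in \<open>auto simp: bij_betw_def\<close>)
qed

text \<open>For finite \<open>G\<close> this is the normalizer of \<open>L\<close>.\<close>

definition conj_stable :: "'a set \<Rightarrow> 'a set" where
  "conj_stable L = {g \<in> carrier G. \<forall>l\<in>L. inv g \<otimes> l \<otimes> g \<in> L}"

lemma inv_mult_cancel:
  assumes "g \<in> carrier G" "z \<in> carrier G"
  shows "g \<otimes> (inv g \<otimes> z) = z" "inv g \<otimes> (g \<otimes> z) = z"
  using assms by (simp_all flip: m_assoc)

lemma conj_conj:
  assumes "g \<in> carrier G" "h \<in> carrier G" "x \<in> carrier G"
  shows "inv (g \<otimes> h) \<otimes> x \<otimes> (g \<otimes> h) = inv h \<otimes> (inv g \<otimes> x \<otimes> g) \<otimes> h"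
  using assms by (simp add: inv_mult_group m_assoc)

lemma conj_inv_conj:
  assumes "g \<in> carrier G" "x \<in> carrier G"
  shows "g \<otimes> (inv g \<otimes> x \<otimes> g) \<otimes> inv g = x" "inv g \<otimes> (g \<otimes> x \<otimes> inv g) \<otimes> g = x"
  using assms by (simp_all add: m_assoc inv_mult_cancel)

lemma inj_on_conj: "g \<in> carrier G \<Longrightarrow> L \<subseteq> carrier G \<Longrightarrow> inj_on (\<lambda>x. inv g \<otimes> x \<otimes> g) L"
  by (rule inj_on_inverseI[where g = "\<lambda>x. g \<otimes> x \<otimes> inv g"]) (auto simp: conj_inv_conj)

text \<open>Conjugation maps the finite set \<open>L\<close> injectively into itself, hence
  onto.\<close>

lemma conj_stable_inv:
  assumes "subgroup L G" "finite (carrier G)" "g \<in> conj_stable L" "l \<in> L"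
  shows "g \<otimes> l \<otimes> inv g \<in> L"
proof -
  interpret L: subgroup L G by fact
  have g: "g \<in> carrier G" "(\<lambda>x. inv g \<otimes> x \<otimes> g) ` L \<subseteq> L" using assms(3) by (auto simp: conj_stable_def)
  have "(\<lambda>x. inv g \<otimes> x \<otimes> g) ` L = L"
    by (rule endo_inj_surj[OF finite_subset[OF L.subset assms(2)] g(2) inj_on_conj[OF g(1) L.subset]])
  then obtain x where x: "x \<in> L" "l = inv g \<otimes> x \<otimes> g" using assms(4) by blast
  thus ?thesis using conj_inv_conj(1)[OF g(1), of x] by simp
qed

lemma subgroup_conj_stable:
  assumes "subgroup L G" "finite (carrier G)"
  shows "subgroup (conj_stable L) G"
proof -
  interpret L: subgroup L G by fact
  show ?thesis
  proof (rule subgroupI)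
    show "conj_stable L \<subseteq> carrier G" by (auto simp: conj_stable_def)
    have "\<one> \<in> conj_stable L" by (auto simp: conj_stable_def)
    thus "conj_stable L \<noteq> {}" by blast
    fix a assume a: "a \<in> conj_stable L"
    hence aG: "a \<in> carrier G" by (simp add: conj_stable_def)
    show "inv a \<in> conj_stable L"
      using conj_stable_inv[OF assms a] aG by (simp add: conj_stable_def)
    fix b assume b: "b \<in> conj_stable L"
    show "a \<otimes> b \<in> conj_stable L"
      using a b aG L.subset unfolding conj_stable_def by (auto simp: conj_conj subsetD)
  qed
qed

text \<open>The G-set G/L. The coset of \<open>g\<close> is fixed by \<open>K\<close> exactly when
  \<open>inv g \<otimes> k \<otimes> g\<close> lies in \<open>L\<close> for all \<open>k\<close> in
  \<open>K\<close>; for \<open>K = L\<close> the fixed cosets partition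
  \<open>conj_stable L\<close>, which gives the count.\<close>

lemma coset_gset:
  assumes L: "subgroup L G" and fin: "finite (carrier G)"
  obtains U where "finite_gset G U"
    "\<And>K. K \<subseteq> carrier G \<Longrightarrow> fixed_points K U \<noteq> {} \<Longrightarrow> \<exists>g\<in>carrier G. \<forall>k\<in>K. inv g \<otimes> k \<otimes> g \<in> L"
    "card L * card (fixed_points L U) = card (conj_stable L)"
proof -
  interpret L: subgroup L G by fact
  let ?C = "\<lambda>g. (\<lambda>l. g \<otimes> l) ` L"
  let ?E = "?C ` carrier G"
  have self: "g \<in> ?C g" if "g \<in> carrier G" for g using that L.one_closed by (auto intro!: image_eqI[of _ _ \<one>])
  have eq_iff: "?C g = ?C h \<longleftrightarrow> inv h \<otimes> g \<in> L" if gh: "g \<in> carrier G" "h \<in> carrier G" for g h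
  proof
    assume "?C g = ?C h"
    then obtain l where "l \<in> L" "g = h \<otimes> l" using self[OF gh(1)] by auto
    thus "inv h \<otimes> g \<in> L" using gh by (simp flip: m_assoc)
  next
    have sub: "?C g \<subseteq> ?C h" if "inv h \<otimes> g \<in> L" "g \<in> carrier G" "h \<in> carrier G" for g h
    proof
      fix x assume "x \<in> ?C g"
      then obtain l where l: "l \<in> L" "x = g \<otimes> l" by auto
      have "x = h \<otimes> ((inv h \<otimes> g) \<otimes> l)" using l that by (simp add: m_assoc[symmetric])
      thus "x \<in> ?C h" using L.m_closed[OF that(1) l(1)] by blast
    qed
    assume a: "inv h \<otimes> g \<in> L"
    have "inv g \<otimes> h = inv (inv h \<otimes> g)" using gh by (simp add: inv_mult_group)
    hence b: "inv g \<otimes> h \<in> L" using L.m_inv_closed[OF a] by simp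
    show "?C g = ?C h" using sub[OF a gh] sub[OF b gh(2,1)] by blast
  qed
  have act: "(\<lambda>x. k \<otimes> x) ` ?C g = ?C (k \<otimes> g)" if "k \<in> carrier G" "g \<in> carrier G" for k g
    using that by (auto simp: image_image m_assoc intro!: image_cong)
  have fixed: "(\<forall>k\<in>K. (\<lambda>x. k \<otimes> x) ` ?C g = ?C g) \<longleftrightarrow> (\<forall>k\<in>K. inv g \<otimes> k \<otimes> g \<in> L)"
    if "K \<subseteq> carrier G" "g \<in> carrier G" for K g
  proof (rule ball_cong[OF refl])
    fix k assume "k \<in> K"
    hence k: "k \<in> carrier G" using that(1) by blast
    show "((\<lambda>x. k \<otimes> x) ` ?C g = ?C g) = (inv g \<otimes> k \<otimes> g \<in> L)"
      using k that(2) by (simp only: act eq_iff m_closed m_assoc inv_closed)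
  qed
  obtain U f where U: "finite_gset G U" "bij_betw f ?E (fst U)"
    "\<And>g x. g \<in> carrier G \<Longrightarrow> x \<in> ?E \<Longrightarrow> snd U g (f x) = f ((\<lambda>y. g \<otimes> y) ` x)"
  proof (rule gset_of_action[of ?E "\<lambda>g x. (\<lambda>y. g \<otimes> y) ` x"])
    show "finite ?E" using fin by simp
    show "(\<lambda>y. \<one> \<otimes> y) ` x = x" if "x \<in> ?E" for x using that by (auto simp: act)
    show "(\<lambda>y. g \<otimes> y) ` x \<in> ?E" if "g \<in> carrier G" "x \<in> ?E" for g x using that by (auto simp: act)
    show "(\<lambda>y. g \<otimes> h \<otimes> y) ` x = (\<lambda>y. g \<otimes> y) ` (\<lambda>y. h \<otimes> y) ` x"
      if "g \<in> carrier G" "h \<in> carrier G" "x \<in> ?E" for g h x using that by (auto simp: act m_assoc)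
  qed blast
  let ?F = "\<lambda>K. {x \<in> ?E. \<forall>k\<in>K. (\<lambda>y. k \<otimes> y) ` x = x}"
  have bij: "bij_betw f (?F K) (fixed_points K U)" if K: "K \<subseteq> carrier G" for K
  proof -
    have inj: "inj_on f ?E" and im: "f ` ?E = fst U" using U(2) by (auto simp: bij_betw_def)
    have cl: "(\<lambda>y. k \<otimes> y) ` x \<in> ?E" if "k \<in> carrier G" "x \<in> ?E" for k x using that by (auto simp: act)
    have mem: "f x \<in> fixed_points K U \<longleftrightarrow> x \<in> ?F K" if x: "x \<in> ?E" for x
    proof -
      have "snd U k (f x) = f x \<longleftrightarrow> (\<lambda>y. k \<otimes> y) ` x = x" if "k \<in> K" for k
      proof -
        have k: "k \<in> carrier G" using that K by blast
        show ?thesis unfolding U(3)[OF k x] by (rule inj_on_eq_iff[OF inj cl[OF k x] x])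
      qed
      hence "(\<forall>k\<in>K. snd U k (f x) = f x) \<longleftrightarrow> (\<forall>k\<in>K. (\<lambda>y. k \<otimes> y) ` x = x)"
        by (rule ball_cong[OF refl])
      moreover have "f x \<in> fst U" using x unfolding im[symmetric] by (rule imageI)
      ultimately show ?thesis using x by (simp only: fixed_points_def mem_Collect_eq simp_thms)
    qed
    have "f ` ?F K = fixed_points K U"
    proof (intro equalityI subsetI)
      fix y assume "y \<in> f ` ?F K"
      then obtain x where "x \<in> ?F K" "y = f x" by blast
      thus "y \<in> fixed_points K U" using mem[of x] by blast
    next
      fix y assume y: "y \<in> fixed_points K U"
      hence "y \<in> f ` ?E" unfolding im by (simp add: fixed_points_def)
      then obtain x where x: "x \<in> ?E" "y = f x" by blast
      have "x \<in> ?F K" using mem[OF x(1)] y unfolding x(2) by (rule iffD1)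
      thus "y \<in> f ` ?F K" unfolding x(2) by (rule imageI)
    qed
    thus ?thesis by (rule bij_betw_subset[OF U(2) Collect_subset])
  qed
  show thesis
  proof (rule that[OF U(1)])
    fix K assume K: "K \<subseteq> carrier G" "fixed_points K U \<noteq> {}"
    hence "f ` ?F K \<noteq> {}" using bij_betw_imp_surj_on[OF bij[OF K(1)]] by (simp only: not_False_eq_True)
    then obtain x where "x \<in> ?F K" by blast
    then obtain g where g: "g \<in> carrier G" "\<forall>k\<in>K. (\<lambda>y. k \<otimes> y) ` ?C g = ?C g" by auto
    show "\<exists>g\<in>carrier G. \<forall>k\<in>K. inv g \<otimes> k \<otimes> g \<in> L"
      using fixed[OF K(1) g(1), THEN iffD1, OF g(2)] g(1) by (rule bexI)
  next
    have un: "\<Union>(?F L) = conj_stable L"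
    proof (intro equalityI subsetI)
      fix x assume "x \<in> \<Union>(?F L)"
      then obtain g l where g: "g \<in> carrier G" "\<forall>k\<in>L. (\<lambda>y. k \<otimes> y) ` ?C g = ?C g" "l \<in> L" "x = g \<otimes> l" by auto
      hence xG: "x \<in> carrier G" by simp
      have "?C x = ?C g" using g xG by (simp add: eq_iff flip: m_assoc)
      hence "\<forall>k\<in>L. (\<lambda>y. k \<otimes> y) ` ?C x = ?C x" using g(2) by simp
      from fixed[OF L.subset xG, THEN iffD1, OF this] show "x \<in> conj_stable L"
        using xG by (simp add: conj_stable_def)
    next
      fix x assume x: "x \<in> conj_stable L"
      hence xG: "x \<in> carrier G" by (simp add: conj_stable_def)
      have "\<forall>k\<in>L. inv x \<otimes> k \<otimes> x \<in> L" using x by (simp add: conj_stable_def)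
      from fixed[OF L.subset xG, THEN iffD2, OF this]
      have "?C x \<in> ?F L" using xG by (intro CollectI conjI imageI)
      thus "x \<in> \<Union>(?F L)" using self[OF xG] by (rule UnionI)
    qed
    have "card L * card (?F L) = card (\<Union>(?F L))"
    proof (rule card_partition)
      show "finite (?F L)" using fin by simp
      show "finite (\<Union>(?F L))" unfolding un by (rule finite_subset[OF _ fin]) (auto simp: conj_stable_def)
      show "card c = card L" if "c \<in> ?F L" for c
        using that L.subset by (auto simp: subsetD intro!: card_image inj_onI)
      show "c1 \<inter> c2 = {}" if c: "c1 \<in> ?F L" "c2 \<in> ?F L" "c1 \<noteq> c2" for c1 c2
      proof (rule ccontr)
        obtain g h where gh: "g \<in> carrier G" "c1 = ?C g" "h \<in> carrier G" "c2 = ?C h" using c by auto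
        assume "c1 \<inter> c2 \<noteq> {}"
        then obtain l m where lm: "l \<in> L" "m \<in> L" "g \<otimes> l = h \<otimes> m" using gh by auto
        have "?C (x \<otimes> y) = ?C x" if "x \<in> carrier G" "y \<in> L" for x y
          using that by (simp add: eq_iff flip: m_assoc)
        hence "?C (g \<otimes> l) = ?C g" "?C (h \<otimes> m) = ?C h" using gh(1,3) lm(1,2) by blast+
        hence "?C g = ?C h" unfolding lm(3) by simp
        thus False using c(3) gh by simp
      qed
    qed
    thus "card L * card (fixed_points L U) = card (conj_stable L)"
      using bij_betw_same_card[OF bij[OF L.subset]] un by simp
  qed
qed

lemma card_subgroup_dvd: "subgroup H G \<Longrightarrow> card H dvd order G"
  using lagrange[of H] by (metis dvd_triv_right)

end

section \<open>Fixed points\<close>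

text \<open>Orbit sizes divide p, and an orbit of size 1 is a fixed point, so the remaining points
  fall into orbits of size p.\<close>

lemma (in group_action) card_fixed_cong:
  assumes p: "prime p" "order G = p" and fin: "finite E"
  shows "[card E = card {x \<in> E. \<forall>g\<in>carrier G. \<phi> g x = x}] (mod p)"
proof -
  let ?F = "{x \<in> E. \<forall>g\<in>carrier G. \<phi> g x = x}"
  let ?O = "orbit G \<phi>"
  let ?C = "?O ` (E - ?F)"
  have sub: "?O x \<subseteq> E" if "x \<in> E" for x using that element_image by (auto simp: orbit_def)
  have one: "?O x = {x}" if x: "x \<in> E" and y: "y \<in> ?O x" "y \<in> ?F" for x y
  proof -
    have "?O y = {y}" using orbit_refl[of y] y(2) by (auto simp: orbit_def)
    moreover have "x \<in> ?O y" using orbit_sym[of x y] x y by auto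
    ultimately show ?thesis using y(1) orbit_refl[OF x] \<open>?O y = {y}\<close> by auto
  qed
  have fixI: "x \<in> ?F" if x: "x \<in> E" "?O x = {x}" for x
    using x by (auto simp: orbit_def)
  have un: "\<Union>?C = E - ?F"
  proof
    show "\<Union>?C \<subseteq> E - ?F"
    proof
      fix z assume "z \<in> \<Union>?C"
      then obtain x where x: "x \<in> E" "x \<notin> ?F" "z \<in> ?O x" by (elim UnionE imageE DiffE) simp
      have "z \<notin> ?F" using one[OF x(1,3)] fixI[OF x(1)] x(2) by argo
      thus "z \<in> E - ?F" using sub[OF x(1)] x(3) by (intro DiffI) (rule subsetD)
    qed
    show "E - ?F \<subseteq> \<Union>?C"
    proof
      fix x assume x: "x \<in> E - ?F"
      show "x \<in> \<Union>?C" by (rule UnionI[OF imageI[OF x]]) (rule orbit_refl[OF DiffD1[OF x]])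
    qed
  qed
  have "p * card ?C = card (\<Union>?C)"
  proof (rule card_partition)
    show "finite ?C" using fin by simp
    show "finite (\<Union>?C)" unfolding un using fin by simp
    show "card c = p" if "c \<in> ?C" for c
    proof -
      obtain x where x: "x \<in> E" "x \<notin> ?F" "c = ?O x" using \<open>c \<in> ?C\<close> by blast
      have "card c dvd p" using orbit_stabilizer_theorem[OF x(1)] p(2) x(3) by (metis dvd_triv_left)
      moreover have "card c \<noteq> 1"
      proof
        assume "card c = 1"
        then obtain y where "c = {y}" by (auto simp: card_1_singleton_iff)
        hence "?O x = {x}" using orbit_refl[OF x(1)] x(3) by auto
        thus False using fixI[OF x(1)] x(2) by blast
      qed
      ultimately show ?thesis using p(1) by (auto simp: prime_nat_iff)
    qed
    show "c1 \<inter> c2 = {}" if c: "c1 \<in> ?C" "c2 \<in> ?C" "c1 \<noteq> c2" for c1 c2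
      using disjoint_union[of c1 c2] c by (auto simp: orbits_def)
  qed
  hence "card E = card ?F + p * card ?C"
    using fin un card_Diff_subset[of ?F E] card_mono[of E ?F] by auto
  thus ?thesis by (simp add: cong_def)
qed

context group begin

text \<open>\<open>Q\<close> normalizes \<open>H\<close>, hence acts on the \<open>H\<close>-fixed
  points, and those among them fixed by \<open>Q\<close> are the points fixed by
  \<open>L = HQ\<close>.\<close>

lemma fixed_points_cong_prime:
  assumes U: "finite_gset G U" and H: "H \<subseteq> carrier G" and Q: "subgroup Q G" "card Q = p" "prime p"
    and norm: "\<And>h y. h \<in> H \<Longrightarrow> y \<in> Q \<Longrightarrow> inv y \<otimes> h \<otimes> y \<in> H"
    and L: "H \<subseteq> L" "Q \<subseteq> L" "\<And>l. l \<in> L \<Longrightarrow> \<exists>h\<in>H. \<exists>y\<in>Q. l = h \<otimes> y"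
  shows "[card (fixed_points H U) = card (fixed_points L U)] (mod p)"
proof -
  interpret Q: subgroup Q G by fact
  let ?Q = "G\<lparr>carrier := Q\<rparr>" and ?F = "fixed_points H U"
  interpret QG: group ?Q by (rule subgroup.subgroup_is_group[OF Q(1)]) (rule is_group)
  note g = finite_gsetD[OF U]
  have F: "x \<in> fst U" "h \<in> H \<Longrightarrow> snd U h x = x" if "x \<in> ?F" for x h
    using that by (auto simp: fixed_points_def)
  have cl: "snd U y x \<in> ?F" if y: "y \<in> Q" and x: "x \<in> ?F" for x y
  proof -
    have yG: "y \<in> carrier G" using y by simp
    have "snd U h (snd U y x) = snd U y x" if h: "h \<in> H" for h
    proof -
      have hG: "h \<in> carrier G" using h H by blast
      have "snd U h (snd U y x) = snd U (h \<otimes> y) x" using g(5)[OF hG yG F(1)[OF x]] by simp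
      also have "h \<otimes> y = y \<otimes> (inv y \<otimes> h \<otimes> y)" using hG yG by (simp add: m_assoc inv_mult_cancel)
      also have "snd U \<dots> x = snd U y (snd U (inv y \<otimes> h \<otimes> y) x)"
        using g(5)[OF yG _ F(1)[OF x]] hG yG by simp
      also have "\<dots> = snd U y x" using F(2)[OF x norm[OF h y]] by simp
      finally show ?thesis .
    qed
    thus ?thesis using g(3)[OF yG F(1)[OF x]] by (simp add: fixed_points_def)
  qed
  have fF: "finite ?F" using g(1) by (simp add: fixed_points_def)
  have "finite_gset ?Q (?F, \<lambda>y. \<lambda>x\<in>?F. snd U y x)"
    by (rule QG.finite_gsetI) (use fF cl F g in auto)
  then interpret A: group_action ?Q ?F "\<lambda>y. \<lambda>x\<in>?F. snd U y x" by (simp add: finite_gset_def)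
  have "[card ?F = card {x \<in> ?F. \<forall>y\<in>carrier ?Q. (\<lambda>x\<in>?F. snd U y x) x = x}] (mod p)"
    by (rule A.card_fixed_cong[OF Q(3) _ fF]) (simp add: order_def Q(2))
  also have "{x \<in> ?F. \<forall>y\<in>carrier ?Q. (\<lambda>x\<in>?F. snd U y x) x = x} = fixed_points L U"
  proof (intro equalityI subsetI)
    fix x assume x: "x \<in> {x \<in> ?F. \<forall>y\<in>carrier ?Q. (\<lambda>x\<in>?F. snd U y x) x = x}"
    hence xF: "x \<in> ?F" and xQ: "\<And>y. y \<in> Q \<Longrightarrow> snd U y x = x" by auto
    have "snd U l x = x" if "l \<in> L" for l
    proof -
      obtain h y where hy: "h \<in> H" "y \<in> Q" "l = h \<otimes> y" using L(3)[OF \<open>l \<in> L\<close>] by blast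
      have "snd U l x = snd U h (snd U y x)" unfolding hy(3) using g(5)[OF _ _ F(1)[OF xF]] hy H by auto
      thus ?thesis using xQ[OF hy(2)] F(2)[OF xF hy(1)] by simp
    qed
    thus "x \<in> fixed_points L U" using F(1)[OF xF] by (simp add: fixed_points_def)
  next
    fix x assume "x \<in> fixed_points L U"
    thus "x \<in> {x \<in> ?F. \<forall>y\<in>carrier ?Q. (\<lambda>x\<in>?F. snd U y x) x = x}"
      using L(1,2) by (auto simp: fixed_points_def)
  qed
  finally show ?thesis .
qed

text \<open>Acting by \<open>g\<close> carries the points fixed by the conjugate onto those fixed by
  \<open>K\<close>.\<close>

lemma fixed_points_conj:
  assumes U: "finite_gset G U" and K: "K \<subseteq> carrier G" and g: "g \<in> carrier G"
  shows "card (fixed_points ((\<lambda>k. inv g \<otimes> k \<otimes> g) ` K) U) = card (fixed_points K U)"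
proof -
  note gs = finite_gsetD[OF U]
  let ?K = "(\<lambda>k. inv g \<otimes> k \<otimes> g) ` K"
  have inv: "snd U (inv g) (snd U g x) = x" "snd U g (snd U (inv g) x) = x" if x: "x \<in> fst U" for x
    using gs(5)[OF inv_closed[OF g] g x] gs(5)[OF g inv_closed[OF g] x] gs(4)[OF x] g by simp_all
  have "bij_betw (snd U g) (fixed_points ?K U) (fixed_points K U)"
  proof (rule bij_betw_byWitness[where f' = "snd U (inv g)"])
    show "\<forall>a\<in>fixed_points ?K U. snd U (inv g) (snd U g a) = a"
      "\<forall>a'\<in>fixed_points K U. snd U g (snd U (inv g) a') = a'"
      using inv by (auto simp: fixed_points_def)
    show "snd U g ` fixed_points ?K U \<subseteq> fixed_points K U"
    proof
      fix y assume "y \<in> snd U g ` fixed_points ?K U"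
      then obtain x where x: "x \<in> fst U" "\<And>k. k \<in> K \<Longrightarrow> snd U (inv g \<otimes> k \<otimes> g) x = x" "y = snd U g x"
        by (auto simp: fixed_points_def)
      have "snd U k y = y" if k: "k \<in> K" for k
      proof -
        have kG: "k \<in> carrier G" using k K by blast
        have "snd U k y = snd U (k \<otimes> g) x" using gs(5)[OF kG g x(1)] x(3) by simp
        also have "k \<otimes> g = g \<otimes> (inv g \<otimes> k \<otimes> g)" using kG g by (simp add: m_assoc inv_mult_cancel)
        also have "snd U \<dots> x = snd U g (snd U (inv g \<otimes> k \<otimes> g) x)"
          using gs(5)[OF g _ x(1)] kG g by simp
        finally show ?thesis using x(2)[OF k] x(3) by simp
      qed
      thus "y \<in> fixed_points K U" using gs(3)[OF g x(1)] x(3) by (simp add: fixed_points_def)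
    qed
    show "snd U (inv g) ` fixed_points K U \<subseteq> fixed_points ?K U"
    proof
      fix x assume "x \<in> snd U (inv g) ` fixed_points K U"
      then obtain y where y: "y \<in> fst U" "\<And>k. k \<in> K \<Longrightarrow> snd U k y = y" "x = snd U (inv g) y"
        by (auto simp: fixed_points_def)
      have xE: "x \<in> fst U" using gs(3)[OF inv_closed[OF g] y(1)] y(3) by simp
      have "snd U (inv g \<otimes> k \<otimes> g) x = x" if k: "k \<in> K" for k
      proof -
        have kG: "k \<in> carrier G" using k K by blast
        have "snd U (inv g \<otimes> k \<otimes> g) x = snd U (inv g \<otimes> k) (snd U g x)"
          using gs(5)[OF _ g xE] kG g by simp
        also have "\<dots> = snd U (inv g) (snd U k y)"
          using gs(5)[OF inv_closed[OF g] kG y(1)] inv(2)[OF y(1)] y(3) by simp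
        finally show ?thesis using y(2)[OF k] y(3) by simp
      qed
      thus "x \<in> fixed_points ?K U" using xE by (auto simp: fixed_points_def)
    qed
  qed
  thus ?thesis by (rule bij_betw_same_card)
qed

end

section \<open>Marks determine a finite G-set\<close>

context group begin

definition gset_restrict :: "'a gset \<Rightarrow> nat set \<Rightarrow> 'a gset" where
  "gset_restrict U S = (S, \<lambda>g. \<lambda>x\<in>S. snd U g x)"

lemma gset_restrict_simps [simp]:
  "fst (gset_restrict U S) = S" "x \<in> S \<Longrightarrow> snd (gset_restrict U S) g x = snd U g x"
  by (simp_all add: gset_restrict_def)

lemma finite_gset_restrict:
  assumes "finite_gset G U" "S \<subseteq> fst U" "\<And>g x. g \<in> carrier G \<Longrightarrow> x \<in> S \<Longrightarrow> snd U g x \<in> S"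
  shows "finite_gset G (gset_restrict U S)"
  unfolding gset_restrict_def
  by (rule finite_gsetI)
    (use assms finite_gsetD[OF assms(1)] in \<open>auto intro: finite_subset simp: subsetD\<close>)

lemma fixed_points_restrict: "S \<subseteq> fst U \<Longrightarrow> fixed_points K (gset_restrict U S) = fixed_points K U \<inter> S"
  by (auto simp: fixed_points_def)

lemma gset_iso_glue:
  assumes U: "finite_gset G U" and V: "finite_gset G V" and S: "S \<subseteq> fst U" and T: "T \<subseteq> fst V"
    and 1: "(gset_restrict U S, gset_restrict V T) \<in> gset_iso G"
    and 2: "(gset_restrict U (fst U - S), gset_restrict V (fst V - T)) \<in> gset_iso G"
  shows "(U, V) \<in> gset_iso G"
proof -
  obtain f where f: "bij_betw f S T"
    "\<And>g x. g \<in> carrier G \<Longrightarrow> x \<in> S \<Longrightarrow> f (snd U g x) = snd (gset_restrict V T) g (f x)"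
    and US: "finite_gset G (gset_restrict U S)"
    using 1 by (auto simp: gset_iso_def)
  obtain f' where f': "bij_betw f' (fst U - S) (fst V - T)"
    "\<And>g x. g \<in> carrier G \<Longrightarrow> x \<in> fst U - S \<Longrightarrow> f' (snd U g x) = snd (gset_restrict V (fst V - T)) g (f' x)"
    and US': "finite_gset G (gset_restrict U (fst U - S))"
    using 2 by (auto simp: gset_iso_def)
  let ?f = "\<lambda>x. if x \<in> S then f x else f' x"
  have "bij_betw ?f S T" using f(1) by (rule bij_betw_cong[THEN iffD1, rotated]) simp
  moreover have "bij_betw ?f (fst U - S) (fst V - T)"
    using f'(1) by (rule bij_betw_cong[THEN iffD1, rotated]) simp
  ultimately have "bij_betw ?f (S \<union> (fst U - S)) (T \<union> (fst V - T))"
    by (rule bij_betw_combine) auto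
  hence bij: "bij_betw ?f (fst U) (fst V)" using S T by (simp add: Un_absorb1)
  show ?thesis
  proof (rule gset_isoI[OF U V bij])
    fix g x assume g: "g \<in> carrier G" and x: "x \<in> fst U"
    show "?f (snd U g x) = snd V g (?f x)"
    proof (cases "x \<in> S")
      case True
      have "snd U g x \<in> S" using finite_gsetD(3)[OF US g, of x] True by simp
      thus ?thesis using True f(2)[OF g True] bij_betwE[OF f(1)] by simp
    next
      case False
      have "snd U g x \<in> fst U - S" using finite_gsetD(3)[OF US' g, of x] False x by simp
      thus ?thesis using False x f'(2)[OF g] bij_betwE[OF f'(1)] by simp
    qed
  qed
qed

lemma gset_orbit:
  assumes U: "finite_gset G U" and x: "x \<in> fst U"
  defines "S \<equiv> (\<lambda>g. snd U g x) ` carrier G"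
  shows "S \<subseteq> fst U" "x \<in> S" "finite_gset G (gset_restrict U S)" "finite_gset G (gset_restrict U (fst U - S))"
proof -
  note g = finite_gsetD[OF U]
  show S: "S \<subseteq> fst U" using g(3) x by (auto simp: S_def)
  show "x \<in> S" using g(4)[OF x] unfolding S_def by (metis imageI one_closed)
  have cl: "snd U h y \<in> S" if hy: "h \<in> carrier G" "y \<in> S" for h y
  proof -
    obtain a where a: "a \<in> carrier G" "y = snd U a x" using hy(2) by (auto simp: S_def)
    have "snd U h y = snd U (h \<otimes> a) x" using g(5)[OF hy(1) a(1) x] a(2) by simp
    thus ?thesis using hy(1) a(1) by (simp add: S_def)
  qed
  thus "finite_gset G (gset_restrict U S)" using finite_gset_restrict[OF U S] by blast
  have "snd U h y \<in> fst U - S" if h: "h \<in> carrier G" and y: "y \<in> fst U - S" for h y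
  proof -
    have "snd U (inv h) (snd U h y) = y"
      using g(5)[OF inv_closed[OF h] h, of y] g(4)[of y] h y by simp
    hence "snd U h y \<notin> S" using cl[OF inv_closed[OF h], of "snd U h y"] y by auto
    thus ?thesis using g(3)[OF h] y by blast
  qed
  thus "finite_gset G (gset_restrict U (fst U - S))" using finite_gset_restrict[OF U, of "fst U - S"] by blast
qed

text \<open>With equal stabilizers, sending \<open>snd U g x\<close> to \<open>snd V g y\<close> is
  well defined and injective.\<close>

lemma gset_orbit_iso:
  assumes U: "finite_gset G U" and V: "finite_gset G V" and x: "x \<in> fst U" and y: "y \<in> fst V"
    and stab: "\<And>g. g \<in> carrier G \<Longrightarrow> snd U g x = x \<longleftrightarrow> snd V g y = y"
  shows "(gset_restrict U ((\<lambda>g. snd U g x) ` carrier G), gset_restrict V ((\<lambda>g. snd V g y) ` carrier G)) \<in> gset_iso G"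
proof -
  let ?S = "(\<lambda>g. snd U g x) ` carrier G" and ?T = "(\<lambda>g. snd V g y) ` carrier G"
  have eq: "snd W g z = snd W h z \<longleftrightarrow> snd W (inv h \<otimes> g) z = z"
    if W: "finite_gset G W" "z \<in> fst W" and gh: "g \<in> carrier G" "h \<in> carrier G" for W g h z
  proof -
    note w = finite_gsetD[OF W(1)]
    have "snd W (inv h \<otimes> g) z = snd W (inv h) (snd W g z)" using w(5)[OF _ gh(1) W(2)] gh(2) by simp
    moreover have "snd W (inv h) (snd W h z) = z"
      using w(5)[OF inv_closed[OF gh(2)] gh(2) W(2)] w(4)[OF W(2)] gh(2) by simp
    moreover have "snd W h (snd W (inv h) (snd W g z)) = snd W g z"
      using w(5)[OF gh(2) inv_closed[OF gh(2)] w(3)[OF gh(1) W(2)]] w(4)[OF w(3)[OF gh(1) W(2)]] gh(2) by simp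
    ultimately show ?thesis by metis
  qed
  have stab': "snd U g x = snd U h x \<longleftrightarrow> snd V g y = snd V h y" if "g \<in> carrier G" "h \<in> carrier G" for g h
    using eq[OF U x that] eq[OF V y that] stab[of "inv h \<otimes> g"] that by simp
  define f where "f z = snd V (SOME g. g \<in> carrier G \<and> z = snd U g x) y" for z
  have f: "f (snd U g x) = snd V g y" if g: "g \<in> carrier G" for g
  proof -
    let ?h = "SOME h. h \<in> carrier G \<and> snd U g x = snd U h x"
    have "?h \<in> carrier G \<and> snd U g x = snd U ?h x" by (rule someI[of _ g]) (use g in simp)
    thus ?thesis using stab'[OF g, of ?h] by (simp add: f_def)
  qed
  show ?thesis
  proof (rule gset_isoI[where f = f])
    show "finite_gset G (gset_restrict U ?S)" by (rule gset_orbit(3)[OF U x])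
    show "finite_gset G (gset_restrict V ?T)" by (rule gset_orbit(3)[OF V y])
    show "bij_betw f (fst (gset_restrict U ?S)) (fst (gset_restrict V ?T))"
      unfolding bij_betw_def
    proof
      show "inj_on f (fst (gset_restrict U ?S))" by (auto simp: inj_on_def f stab')
      show "f ` fst (gset_restrict U ?S) = fst (gset_restrict V ?T)" by (auto simp: f image_image)
    qed
    fix g z assume g: "g \<in> carrier G" and "z \<in> fst (gset_restrict U ?S)"
    then obtain h where h: "h \<in> carrier G" "z = snd U h x" by auto
    have "snd U g z = snd U (g \<otimes> h) x" using finite_gsetD(5)[OF U g h(1) x] h(2) by simp
    moreover have "snd V g (f z) = snd V (g \<otimes> h) y" using finite_gsetD(5)[OF V g h(1) y] h f by simp
    ultimately show "f (snd (gset_restrict U ?S) g z) = snd (gset_restrict V ?T) g (f z)"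
      using f[of "g \<otimes> h"] f[OF h(1)] g h by simp
  qed
qed

definition gset_stabilizer :: "'a gset \<Rightarrow> nat \<Rightarrow> 'a set" where
  "gset_stabilizer U x = {g \<in> carrier G. snd U g x = x}"

lemma subgroup_gset_stabilizer:
  assumes U: "finite_gset G U" and x: "x \<in> fst U"
  shows "subgroup (gset_stabilizer U x) G"
proof -
  note g = finite_gsetD[OF U]
  show ?thesis
  proof (rule subgroupI)
    show "gset_stabilizer U x \<noteq> {}" using g(4)[OF x] by (auto simp: gset_stabilizer_def)
    fix a assume a: "a \<in> gset_stabilizer U x"
    hence aG: "a \<in> carrier G" by (simp add: gset_stabilizer_def)
    show "inv a \<in> gset_stabilizer U x"
      using a g(5)[OF inv_closed[OF aG] aG x] g(4)[OF x] by (simp add: gset_stabilizer_def)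
    fix b assume b: "b \<in> gset_stabilizer U x"
    thus "a \<otimes> b \<in> gset_stabilizer U x"
      using a g(5)[OF aG _ x, of b] by (simp add: gset_stabilizer_def)
  qed (auto simp: gset_stabilizer_def)
qed

text \<open>Burnside's theorem, by induction on the size of \<open>U\<close>: a pair of isomorphic
  orbits is split off. They come from a subgroup of largest order among those with a fixed
  point.\<close>

lemma gset_iso_if_marks_eq:
  assumes fin: "finite (carrier G)"
    and U: "finite_gset G U" and V: "finite_gset G V"
    and marks: "\<And>K. subgroup K G \<Longrightarrow> card (fixed_points K U) = card (fixed_points K V)"
  shows "(U, V) \<in> gset_iso G"
  using U V marks
proof (induction "card (fst U)" arbitrary: U V rule: less_induct)
  case less
  note U = less.prems(1) and V = less.prems(2) and marks = less.prems(3)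
  have triv: "fixed_points {\<one>} W = fst W" if "finite_gset G W" for W
    using finite_gsetD(4)[OF that] by (auto simp: fixed_points_def)
  have c: "card (fst U) = card (fst V)"
    using marks[OF triv_subgroup] triv[OF U] triv[OF V] by simp
  have ffix: "finite (fixed_points K W)" if "finite_gset G W" for K W
    using finite_gsetD(1)[OF that] by (simp add: fixed_points_def)
  show ?case
  proof (cases "fst U = {}")
    case True
    hence "fst V = {}" using c finite_gsetD(1)[OF V] by simp
    thus ?thesis using True U V by (intro gset_isoI[where f = id]) auto
  next
    case False
    let ?Q = "\<lambda>K. subgroup K G \<and> fixed_points K U \<noteq> {}"
    have b: "\<And>K. ?Q K \<Longrightarrow> card K \<le> card (carrier G)" using fin by (meson card_mono subgroup.subset)
    have "?Q {\<one>}" using triv_subgroup triv[OF U] False by simp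
    moreover have "\<forall>K. ?Q K \<longrightarrow> card K < Suc (card (carrier G))" using b by (simp add: less_Suc_eq_le)
    ultimately have "\<exists>K. ?Q K \<and> (\<forall>K'. ?Q K' \<longrightarrow> card K' \<le> card K)"
      by (rule ex_has_greatest_nat[where P = ?Q and f = card])
    then obtain K where K: "?Q K" and "\<forall>K'. ?Q K' \<longrightarrow> card K' \<le> card K" by (elim exE conjE) simp
    hence K_max: "card K' \<le> card K" if "subgroup K' G" "fixed_points K' U \<noteq> {}" for K'
      using that by simp
    \<comment> \<open>The stabilizer contains \<open>K\<close> and has a fixed point on
      \<open>W\<close>, hence on \<open>U\<close> by equality of marks; maximality then leaves only
      \<open>K\<close>.\<close>
    have stab_eq: "gset_stabilizer W x = K"
      if W: "finite_gset G W" "x \<in> fixed_points K W" "\<And>K. subgroup K G \<Longrightarrow> card (fixed_points K W) = card (fixed_points K U)"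
      for W x
    proof -
      have x: "x \<in> fst W" using W(2) by (simp add: fixed_points_def)
      have sub: "K \<subseteq> gset_stabilizer W x"
        using W(2) subgroup.subset[of K] K by (auto simp: gset_stabilizer_def fixed_points_def)
      have sg: "subgroup (gset_stabilizer W x) G" by (rule subgroup_gset_stabilizer[OF W(1) x])
      have "x \<in> fixed_points (gset_stabilizer W x) W" using x by (simp add: fixed_points_def gset_stabilizer_def)
      hence "card (fixed_points (gset_stabilizer W x) W) \<noteq> 0" using ffix[OF W(1)] by auto
      hence "fixed_points (gset_stabilizer W x) U \<noteq> {}" using W(3)[OF sg] by auto
      hence "card (gset_stabilizer W x) \<le> card K" using K_max[OF sg] by blast
      moreover have "finite (gset_stabilizer W x)"
        by (rule finite_subset[OF _ fin]) (auto simp: gset_stabilizer_def)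
      ultimately show ?thesis using card_seteq[OF _ sub] by simp
    qed
    obtain x where x: "x \<in> fixed_points K U" using K by blast
    have "card (fixed_points K V) \<noteq> 0" using marks[of K] K x ffix[OF U] by auto
    then obtain y where y: "y \<in> fixed_points K V" by fastforce
    have xU: "x \<in> fst U" and yV: "y \<in> fst V" using x y by (auto simp: fixed_points_def)
    have "gset_stabilizer U x = gset_stabilizer V y"
      using stab_eq[OF U x] stab_eq[OF V y] marks by simp
    hence st: "snd U g x = x \<longleftrightarrow> snd V g y = y" if "g \<in> carrier G" for g
      using that by (auto simp: gset_stabilizer_def)
    let ?S = "(\<lambda>g. snd U g x) ` carrier G" and ?T = "(\<lambda>g. snd V g y) ` carrier G"
    note S = gset_orbit[OF U xU] and T = gset_orbit[OF V yV]
    have iso: "(gset_restrict U ?S, gset_restrict V ?T) \<in> gset_iso G"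
      by (rule gset_orbit_iso[OF U V xU yV st])
    have split: "card (fixed_points K' W) =
        card (fixed_points K' (gset_restrict W R)) + card (fixed_points K' (gset_restrict W (fst W - R)))"
      if "finite_gset G W" "R \<subseteq> fst W" for K' W R
    proof -
      have "fixed_points K' W = (fixed_points K' W \<inter> R) \<union> (fixed_points K' W \<inter> (fst W - R))"
        by (auto simp: fixed_points_def)
      hence "card (fixed_points K' W) = card (fixed_points K' W \<inter> R) + card (fixed_points K' W \<inter> (fst W - R))"
        using ffix[OF that(1)] by (metis card_Un_disjoint finite_Int Diff_disjoint Int_commute Int_left_commute inf_bot_right)
      thus ?thesis using that(2) by (simp add: fixed_points_restrict)
    qed
    have "(gset_restrict U (fst U - ?S), gset_restrict V (fst V - ?T)) \<in> gset_iso G"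
    proof (rule less.hyps)
      have "card (fst U - ?S) < card (fst U)"
        by (rule psubset_card_mono[OF finite_gsetD(1)[OF U]]) (use S(2) xU in blast)
      thus "card (fst (gset_restrict U (fst U - ?S))) < card (fst U)" by simp
      show "card (fixed_points K' (gset_restrict U (fst U - ?S))) =
        card (fixed_points K' (gset_restrict V (fst V - ?T)))" if K': "subgroup K' G" for K'
        using split[OF U S(1), of K'] split[OF V T(1), of K'] marks[OF K']
          fixed_points_iso[OF iso subgroup.subset[OF K']] by simp
    qed (use S(4) T(4) in auto)
    thus ?thesis using gset_iso_glue[OF U V S(1) T(1) iso] by blast
  qed
qed

section \<open>Elements of the Burnside ring are determined by their marks\<close>

lemma burnside_ring_carrierE:
  assumes "a \<in> carrier (burnside_ring G)"
  obtains U V where "finite_gset G U" "finite_gset G V"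
    "a = groth_class (gset_semiring G) (gset_class G U) (gset_class G V)"
    "\<And>H. H \<subseteq> carrier G \<Longrightarrow> mark G H a = int (card (fixed_points H U)) - int (card (fixed_points H V))"
proof -
  interpret comm_semiring "gset_semiring G" by (rule comm_semiring_gset)
  from assms obtain x y where "x \<in> carrier (gset_semiring G)" "y \<in> carrier (gset_semiring G)"
    "a = groth_class (gset_semiring G) x y"
    unfolding burnside_ring_def by (rule groth_carrierE)
  then obtain U V where "finite_gset G U" "finite_gset G V"
    "a = groth_class (gset_semiring G) (gset_class G U) (gset_class G V)"
    by (metis gset_semiring_carrierE)
  thus thesis using that mark_groth_class by blast
qed

text \<open>In a formal difference with vanishing marks the two G-sets have equal numbers of fixed
  points, so they are isomorphic.\<close>

lemma marks_injective:
  assumes fin: "finite (carrier G)" and a: "a \<in> carrier (burnside_ring G)"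
    and marks: "\<And>K. subgroup K G \<Longrightarrow> mark G K a = 0"
  shows "a = \<zero>\<^bsub>burnside_ring G\<^esub>"
proof -
  interpret S: comm_semiring "gset_semiring G" by (rule comm_semiring_gset)
  obtain U V where U: "finite_gset G U" and V: "finite_gset G V"
    and a: "a = groth_class (gset_semiring G) (gset_class G U) (gset_class G V)"
    and m: "\<And>H. H \<subseteq> carrier G \<Longrightarrow> mark G H a = int (card (fixed_points H U)) - int (card (fixed_points H V))"
    by (rule burnside_ring_carrierE[OF a]) blast
  have "(U, V) \<in> gset_iso G"
    using marks m subgroup.subset by (intro gset_iso_if_marks_eq[OF fin U V]) force
  hence eq: "gset_class G U = gset_class G V" using gset_class_eq_iff[OF U V] by blast
  have "gset_class G V \<in> carrier (gset_semiring G)" using V by blast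
  thus ?thesis unfolding a eq burnside_ring_def S.groth_ops(3)[OF S.zero_closed S.zero_closed S.zero_closed S.zero_closed]
    by (intro S.groth_class_eqI) auto
qed

end

section \<open>Congruences between marks\<close>

context group begin

text \<open>\<open>conj_class\<close> conjugates with \<open>inv g\<close> on the right; having it
  on the left matches \<open>conj_stable\<close> and the fixed point criterion for cosets.\<close>

lemma conj_class_eq_image: "K \<subseteq> carrier G \<Longrightarrow> conj_class G K = (\<lambda>g. (\<lambda>k. inv g \<otimes> k \<otimes> g) ` K) ` carrier G"
proof -
  assume K: "K \<subseteq> carrier G"
  have *: "g <# K #> inv g = (\<lambda>k. inv (inv g) \<otimes> k \<otimes> inv g) ` K" if "g \<in> carrier G" for g
    using that by (auto simp: l_coset_def r_coset_def)
  have "conj_class G K = (\<lambda>g. (\<lambda>k. inv (inv g) \<otimes> k \<otimes> inv g) ` K) ` carrier G"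
    using * by (auto simp: conj_class_def)
  also have "\<dots> = (\<lambda>g. (\<lambda>k. inv g \<otimes> k \<otimes> g) ` K) ` (\<lambda>g. inv g) ` carrier G"
    by (simp add: image_image)
  also have "(\<lambda>g. inv g) ` carrier G = carrier G"
    by (auto intro!: image_eqI[of _ _ "inv _"])
  finally show ?thesis .
qed

lemma self_in_conj_class: "K \<subseteq> carrier G \<Longrightarrow> K \<in> conj_class G K"
  unfolding conj_class_eq_image by (rule image_eqI[of _ _ \<one>]) (auto simp: subsetD)

lemma conj_class_conj:
  assumes K: "K \<subseteq> carrier G" and g: "g \<in> carrier G"
  shows "conj_class G ((\<lambda>k. inv g \<otimes> k \<otimes> g) ` K) = conj_class G K"
proof -
  let ?K = "(\<lambda>k. inv g \<otimes> k \<otimes> g) ` K"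
  have K': "?K \<subseteq> carrier G" using K g by auto
  have *: "(\<lambda>k. inv h \<otimes> k \<otimes> h) ` ?K = (\<lambda>k. inv (g \<otimes> h) \<otimes> k \<otimes> (g \<otimes> h)) ` K" if "h \<in> carrier G" for h
    unfolding image_image using that g K by (intro image_cong refl) (auto simp: conj_conj subsetD)
  have "conj_class G ?K = (\<lambda>h. (\<lambda>k. inv (g \<otimes> h) \<otimes> k \<otimes> (g \<otimes> h)) ` K) ` carrier G"
    unfolding conj_class_eq_image[OF K'] by (rule image_cong[OF refl *])
  also have "\<dots> = (\<lambda>h. (\<lambda>k. inv h \<otimes> k \<otimes> h) ` K) ` ((\<lambda>h. g \<otimes> h) ` carrier G)"
    by (simp add: image_image)
  also have "(\<lambda>h. g \<otimes> h) ` carrier G = carrier G" by (rule surj_const_mult[OF g])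
  finally show ?thesis unfolding conj_class_eq_image[OF K] .
qed

lemma mark_conj_class_cong:
  assumes "H \<subseteq> carrier G" "J \<subseteq> carrier G" "conj_class G H = conj_class G J" "a \<in> carrier (burnside_ring G)"
  shows "mark G H a = mark G J a"
proof -
  have "H \<in> conj_class G J" using self_in_conj_class[OF assms(1)] assms(3) by simp
  then obtain g where g: "g \<in> carrier G" "H = (\<lambda>k. inv g \<otimes> k \<otimes> g) ` J"
    unfolding conj_class_eq_image[OF assms(2)] by blast
  obtain U V where "finite_gset G U" "finite_gset G V"
    "\<And>H. H \<subseteq> carrier G \<Longrightarrow> mark G H a = int (card (fixed_points H U)) - int (card (fixed_points H V))"
    by (rule burnside_ring_carrierE[OF assms(4)]) blast
  thus ?thesis using fixed_points_conj[OF _ assms(2) g(1)] assms(1,2) g(2) by simp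
qed

lemma burnside_class_closed: "finite_gset G U \<Longrightarrow> burnside_class G U \<in> carrier (burnside_ring G)"
proof -
  assume U: "finite_gset G U"
  interpret S: comm_semiring "gset_semiring G" by (rule comm_semiring_gset)
  show ?thesis using U unfolding burnside_class_def burnside_ring_def by auto
qed

text \<open>The conjugate of \<open>J\<close> inside \<open>H\<close> has \<open>card J\<close>
  elements, so by the size assumption it fills \<open>H\<close>.\<close>

lemma conj_class_eq_if_subconj:
  assumes fin: "finite (carrier G)" and H: "subgroup H G" and J: "subgroup J G"
    and le: "card H \<le> card J" and g: "g \<in> carrier G" "\<forall>k\<in>J. inv g \<otimes> k \<otimes> g \<in> H"
  shows "conj_class G H = conj_class G J"
proof -
  have JG: "J \<subseteq> carrier G" and HG: "H \<subseteq> carrier G" using H J subgroup.subset by auto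
  have "card ((\<lambda>k. inv g \<otimes> k \<otimes> g) ` J) = card J" by (rule card_image[OF inj_on_conj[OF g(1) JG]])
  hence "(\<lambda>k. inv g \<otimes> k \<otimes> g) ` J = H"
    using g(2) le by (intro card_seteq[OF finite_subset[OF HG fin]]) auto
  thus ?thesis using conj_class_conj[OF JG g(1)] by simp
qed

text \<open>Take the class of G/H. A fixed point of \<open>J\<close> would conjugate
  \<open>J\<close> into \<open>H\<close>, which is impossible as \<open>H\<close> is no larger than
  \<open>J\<close> and not conjugate to it.\<close>

lemma mark_coset_gset:
  assumes fin: "finite (carrier G)" and H: "subgroup H G" and J: "subgroup J G"
    and le: "card H \<le> card J" and ne: "conj_class G H \<noteq> conj_class G J"
  obtains a where "a \<in> carrier (burnside_ring G)" "mark G J a = 0" "mark G H a > 0"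
    "int (card H) * mark G H a = int (card (conj_stable H))"
proof -
  have JG: "J \<subseteq> carrier G" and HG: "H \<subseteq> carrier G" using H J subgroup.subset by auto
  obtain U where U: "finite_gset G U"
    "\<And>K. K \<subseteq> carrier G \<Longrightarrow> fixed_points K U \<noteq> {} \<Longrightarrow> \<exists>g\<in>carrier G. \<forall>k\<in>K. inv g \<otimes> k \<otimes> g \<in> H"
    "card H * card (fixed_points H U) = card (conj_stable H)"
    using coset_gset[OF H fin] by blast
  have "card (conj_stable H) \<noteq> 0"
    using subgroup_conj_stable[OF H fin] fin by (metis finite_subset card_0_eq subgroup.subset subgroup_nonempty)
  hence "card (fixed_points H U) \<noteq> 0" using U(3) by (metis mult_0_right)
  moreover have "fixed_points J U = {}"
    using U(2)[OF JG] conj_class_eq_if_subconj[OF fin H J le] ne by blast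
  ultimately show thesis
    using that[OF burnside_class_closed[OF U(1)]] U(3) mark_burnside_class[OF U(1) HG] mark_burnside_class[OF U(1) JG]
    by (simp flip: of_nat_mult)
qed

text \<open>On the coset space of the smaller subgroup one of the two marks is 0, and the other
  divides the order of a normalizer. The divisibility later limits the power of p in the
  difference.\<close>

lemma marks_separate:
  assumes fin: "finite (carrier G)" and H: "subgroup H G" and J: "subgroup J G"
    and ne: "conj_class G H \<noteq> conj_class G J"
  obtains a where "a \<in> carrier (burnside_ring G)" "mark G H a \<noteq> mark G J a"
    "mark G H a - mark G J a dvd int (order G)"
proof -
  have *: "\<exists>a\<in>carrier (burnside_ring G). mark G H a \<noteq> mark G J a \<and> mark G H a - mark G J a dvd int (order G)"
    if H: "subgroup H G" and J: "subgroup J G" and ne: "conj_class G H \<noteq> conj_class G J"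
      and le: "card H \<le> card J" for H J
  proof -
    obtain a where a: "a \<in> carrier (burnside_ring G)" "mark G J a = 0" "mark G H a > 0"
      "int (card H) * mark G H a = int (card (conj_stable H))"
      by (rule mark_coset_gset[OF fin H J le ne]) blast
    have "mark G H a dvd int (card (conj_stable H))" using a(4) by (metis dvd_triv_right)
    also have "\<dots> dvd int (order G)" using card_subgroup_dvd[OF subgroup_conj_stable[OF H fin]] by simp
    finally show ?thesis using a by (intro bexI[of _ a]) auto
  qed
  show thesis
  proof (cases "card H \<le> card J")
    case True
    thus ?thesis using *[OF H J ne] that by blast
  next
    case False
    then obtain a where "a \<in> carrier (burnside_ring G)" "mark G J a \<noteq> mark G H a" "mark G J a - mark G H a dvd int (order G)"
      using *[OF J H ne[symmetric]] by auto
    thus ?thesis using that[of a] by (metis dvd_diff_commute minus_dvd_iff minus_diff_eq)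
  qed
qed

section \<open>Congruence of marks modulo p and the orders of subgroups\<close>

text \<open>Given \<open>p\<close> dividing the mark of \<open>G/H\<close> at \<open>H\<close>, a subgroup \<open>Q\<close> of order \<open>p\<close> normalizes \<open>H\<close>. Marks at
  \<open>H\<close> and at \<open>L = HQ\<close> agree modulo \<open>p\<close>, and the mark of \<open>G/L\<close> at \<open>L\<close> is prime to \<open>p\<close>.\<close>

lemma p_extension:
  assumes fin: "finite (carrier G)" and p: "prime p" "\<not> p\<^sup>2 dvd order G"
    and H: "subgroup H G" and pH: "\<not> p dvd card H" and d: "p dvd card (conj_stable H)"
  obtains L where "subgroup L G" "p dvd card L" "H \<subseteq> L"
    "\<And>a. a \<in> carrier (burnside_ring G) \<Longrightarrow> [mark G H a = mark G L a] (mod int p)"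
    "\<And>x n. x \<in> L \<Longrightarrow> \<not> p dvd n \<Longrightarrow> x [^] (n::nat) = \<one> \<Longrightarrow> x \<in> H"
proof -
  let ?N = "conj_stable H"
  interpret H: subgroup H G by (rule H)
  interpret N: subgroup ?N G by (rule subgroup_conj_stable[OF H fin])
  let ?NG = "G\<lparr>carrier := ?N\<rparr>"
  have NG: "group ?NG" by (rule subgroup.subgroup_is_group[OF N.subgroup_axioms is_group])
  obtain m where m: "card ?N = p * m" using d by (auto elim: dvdE)
  have "\<exists>Q. subgroup Q ?NG \<and> card Q = p ^ 1"
    by (rule sylow_thm[OF p(1) NG, of 1 m]) (use m N.subset fin finite_subset in \<open>auto simp: order_def\<close>)
  then obtain Q where Q': "subgroup Q ?NG" and cQ: "card Q = p" by auto
  have Q: "subgroup Q G" by (rule incl_subgroup[OF N.subgroup_axioms Q'])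
  interpret Q: subgroup Q G by (rule Q)
  have QN: "Q \<subseteq> ?N" using subgroup.subset[OF Q'] by simp
  have norm: "inv y \<otimes> h \<otimes> y \<in> H" "y \<otimes> h \<otimes> inv y \<in> H" if "h \<in> H" "y \<in> Q" for h y
  proof -
    have y: "y \<in> ?N" using QN \<open>y \<in> Q\<close> by (rule subsetD)
    show "y \<otimes> h \<otimes> inv y \<in> H" by (rule conj_stable_inv[OF H fin y \<open>h \<in> H\<close>])
    have "\<forall>l\<in>H. inv y \<otimes> l \<otimes> y \<in> H" using y unfolding conj_stable_def by (elim CollectE conjE)
    thus "inv y \<otimes> h \<otimes> y \<in> H" using \<open>h \<in> H\<close> by (rule bspec)
  qed
  define L where "L = (\<lambda>(h, y). h \<otimes> y) ` (H \<times> Q)"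
  have LI: "h \<otimes> y \<in> L" if "h \<in> H" "y \<in> Q" for h y using that by (auto simp: L_def)
  have LE: "\<exists>h\<in>H. \<exists>y\<in>Q. l = h \<otimes> y" if "l \<in> L" for l using that by (auto simp: L_def)
  \<comment> \<open>Moving \<open>y\<close> past \<open>h'\<close> conjugates \<open>h'\<close>, and
    the result stays in \<open>H\<close> because \<open>Q\<close> normalizes
    \<open>H\<close>.\<close>
  have prod: "(h \<otimes> y) \<otimes> (h' \<otimes> y') = (h \<otimes> (y \<otimes> h' \<otimes> inv y)) \<otimes> (y \<otimes> y')"
    if "h \<in> H" "y \<in> Q" "h' \<in> H" "y' \<in> Q" for h y h' y'
    using that by (simp add: m_assoc inv_mult_cancel)
  have L: "subgroup L G"
  proof (rule subgroupI)
    show "L \<subseteq> carrier G" by (auto simp: L_def)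
    show "L \<noteq> {}" using LI[OF H.one_closed Q.one_closed] by blast
    fix a assume "a \<in> L"
    then obtain h y where a: "h \<in> H" "y \<in> Q" "a = h \<otimes> y" using LE by blast
    have "inv a = (inv y \<otimes> inv h \<otimes> inv (inv y)) \<otimes> inv y"
      using a by (simp add: inv_mult_group m_assoc)
    thus "inv a \<in> L" using LI norm(2)[of "inv h" "inv y"] a by simp
    fix b assume "b \<in> L"
    then obtain h' y' where b: "h' \<in> H" "y' \<in> Q" "b = h' \<otimes> y'" using LE by blast
    show "a \<otimes> b \<in> L" unfolding a(3) b(3) prod[OF a(1,2) b(1,2)]
      using a b norm(2)[OF b(1) a(2)] by (intro LI) auto
  qed
  have HL: "H \<subseteq> L" using LI[OF _ Q.one_closed] by force
  have QL: "Q \<subseteq> L" using LI[OF H.one_closed] by force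
  show thesis
  proof (rule that[OF L])
    interpret LG: group "G\<lparr>carrier := L\<rparr>" by (rule subgroup.subgroup_is_group[OF L is_group])
    have "card Q dvd order (G\<lparr>carrier := L\<rparr>)"
      by (rule LG.card_subgroup_dvd[OF subgroup_incl[OF Q L QL]])
    thus "p dvd card L" by (simp add: cQ order_def)
    show "H \<subseteq> L" by (rule HL)
    show "[mark G H a = mark G L a] (mod int p)" if a: "a \<in> carrier (burnside_ring G)" for a
    proof -
      obtain U V where U: "finite_gset G U" "finite_gset G V"
        "\<And>H. H \<subseteq> carrier G \<Longrightarrow> mark G H a = int (card (fixed_points H U)) - int (card (fixed_points H V))"
        by (rule burnside_ring_carrierE[OF a]) blast
      have "[card (fixed_points H W) = card (fixed_points L W)] (mod p)" if "finite_gset G W" for W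
        by (rule fixed_points_cong_prime[OF that H.subset Q cQ p(1) norm(1) HL QL LE])
      thus ?thesis using U H.subset subgroup.subset[OF L] by (simp add: cong_diff cong_int_iff)
    qed
    fix x and n :: nat assume x: "x \<in> L" and n: "\<not> p dvd n" and xn: "x [^] n = \<one>"
    obtain h y where hy: "h \<in> H" "y \<in> Q" "x = h \<otimes> y" using LE[OF x] by blast
    \<comment> \<open>Modulo \<open>H\<close> the powers of \<open>x\<close> are those of
      \<open>y\<close>, so \<open>x [^] n = \<one>\<close> puts \<open>y [^] n\<close> into
      \<open>H\<close>. Then the order of \<open>y\<close> divides both \<open>n * card H\<close>
      and p, which are coprime, so \<open>y\<close> is trivial.\<close>
    have pow: "\<exists>h'\<in>H. x [^] k = h' \<otimes> y [^] k" for k :: nat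
    proof (induction k)
      case 0
      show ?case by (intro bexI[of _ \<one>]) auto
    next
      case (Suc k)
      then obtain h' where h': "h' \<in> H" "x [^] k = h' \<otimes> y [^] k" by blast
      have yk: "y [^] k \<in> Q" using hy(2) by (induction k) auto
      have "x [^] Suc k = (h' \<otimes> (y [^] k \<otimes> h \<otimes> inv (y [^] k))) \<otimes> (y [^] k \<otimes> y)"
        using prod[OF h'(1) yk hy(1,2)] h'(2) hy(3) by simp
      thus ?case using norm(2)[OF hy(1) yk] h'(1)
        by (intro bexI[of _ "h' \<otimes> (y [^] k \<otimes> h \<otimes> inv (y [^] k))"]) auto
    qed
    have yn: "y [^] n \<in> H"
    proof -
      obtain h' where h': "h' \<in> H" "x [^] n = h' \<otimes> y [^] n" using pow by blast
      have "y [^] n = inv h'"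
        using h' xn hy(2) inv_equality[of "y [^] n" h'] inv_comm[of h' "y [^] n"] by (auto simp: inv_unique')
      thus ?thesis using h'(1) by simp
    qed
    have finH: "finite H" by (rule finite_subset[OF H.subset fin])
    have pow_card: "z [^] card K = \<one>" if "subgroup K G" "z \<in> K" for z K
    proof -
      interpret K: group "G\<lparr>carrier := K\<rparr>" by (rule subgroup.subgroup_is_group[OF that(1) is_group])
      have "z [^]\<^bsub>G\<lparr>carrier := K\<rparr>\<^esub> order (G\<lparr>carrier := K\<rparr>) = \<one>\<^bsub>G\<lparr>carrier := K\<rparr>\<^esub>"
        by (rule K.pow_order_eq_1) (use that in simp)
      thus ?thesis by (simp add: order_def nat_pow_consistent[symmetric])
    qed
    have yG: "y \<in> carrier G" using hy(2) by simp
    have "y [^] (n * card H) = \<one>" using pow_card[OF H yn] yG by (simp add: nat_pow_pow)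
    moreover have "y [^] p = \<one>" using pow_card[OF Q hy(2)] cQ by simp
    ultimately have "ord y dvd n * card H" "ord y dvd p" using pow_eq_id[OF yG] by auto
    moreover have "coprime (n * card H) p"
      using n pH p(1) by (metis coprime_commute prime_dvd_mult_iff prime_imp_coprime)
    ultimately have "ord y = 1" by (metis coprime_common_divisor_nat)
    hence "y = \<one>" using pow_eq_id[OF yG, of 1] yG by simp
    thus "x \<in> H" using hy by simp
  qed
qed

lemma p_congruent_card:
  assumes fin: "finite (carrier G)" and p: "prime p" "\<not> p\<^sup>2 dvd order G"
    and H: "subgroup H G" and J: "subgroup J G" and ne: "conj_class G H \<noteq> conj_class G J"
    and cong: "\<And>a. a \<in> carrier (burnside_ring G) \<Longrightarrow> [mark G H a = mark G J a] (mod int p)"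
    and le: "card H \<le> card J"
  shows "\<not> p dvd card H" "p dvd card J"
proof -
  \<comment> \<open>The order of the normalizer contains p at most once, so only one of the two
    factors is divisible by p.\<close>
  have sq: "\<not> p dvd k" if "p dvd c" "c * k = card (conj_stable K)" "subgroup K G" for c k K
  proof
    assume "p dvd k"
    hence "p * p dvd c * k" using that(1) by (rule mult_dvd_mono[rotated])
    also have "\<dots> dvd order G" unfolding that(2) by (rule card_subgroup_dvd[OF subgroup_conj_stable[OF that(3) fin]])
    finally show False using p(2) by (simp add: power2_eq_square)
  qed
  obtain a where a: "a \<in> carrier (burnside_ring G)" "mark G J a = 0" "mark G H a > 0"
    "int (card H) * mark G H a = int (card (conj_stable H))"
    by (rule mark_coset_gset[OF fin H J le ne]) blast
  obtain k where k: "mark G H a = int k" using a(3) by (metis zero_less_imp_eq_int)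
  \<comment> \<open>The mark of G/H at \<open>J\<close> is 0, so by congruence its mark at
    \<open>H\<close> is divisible by p.\<close>
  have pk: "p dvd k" using cong[OF a(1)] a(2) k by (simp add: cong_0_iff)
  have ck: "card H * k = card (conj_stable H)" using a(4) k by (simp flip: of_nat_mult)
  show pH: "\<not> p dvd card H" using sq[of k "card H" H] pk ck H by (auto simp: mult.commute)
  have pN: "p dvd card (conj_stable H)" using pk ck by (metis dvd_mult)
  show "p dvd card J"
  proof (rule ccontr)
    assume pJ: "\<not> p dvd card J"
    obtain L where L: "subgroup L G" "p dvd card L" "H \<subseteq> L"
      "\<And>a. a \<in> carrier (burnside_ring G) \<Longrightarrow> [mark G H a = mark G L a] (mod int p)"
      "\<And>x n. x \<in> L \<Longrightarrow> \<not> p dvd n \<Longrightarrow> x [^] (n::nat) = \<one> \<Longrightarrow> x \<in> H"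
      by (rule p_extension[OF fin p H pH pN]) blast
    have LG: "L \<subseteq> carrier G" and JG: "J \<subseteq> carrier G" using L(1) J subgroup.subset by auto
    obtain U where U: "finite_gset G U"
      "\<And>K. K \<subseteq> carrier G \<Longrightarrow> fixed_points K U \<noteq> {} \<Longrightarrow> \<exists>g\<in>carrier G. \<forall>k\<in>K. inv g \<otimes> k \<otimes> g \<in> L"
      "card L * card (fixed_points L U) = card (conj_stable L)"
      using coset_gset[OF L(1) fin] by blast
    \<comment> \<open>p already divides \<open>card L\<close>, so it cannot divide the index of
      \<open>L\<close> in its normalizer.\<close>
    have "\<not> p dvd card (fixed_points L U)" by (rule sq[OF L(2) U(3) L(1)])
    moreover have "[mark G J (burnside_class G U) = mark G L (burnside_class G U)] (mod int p)"
      using cong L(4) burnside_class_closed[OF U(1)] by (meson cong_sym cong_trans)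
    ultimately have "\<not> p dvd card (fixed_points J U)"
      using mark_burnside_class[OF U(1) JG] mark_burnside_class[OF U(1) LG]
        cong_dvd_iff[of "card (fixed_points J U)" "card (fixed_points L U)" p]
      by (auto simp: cong_int_iff)
    hence "card (fixed_points J U) \<noteq> 0" by (metis dvd_0_right)
    then obtain g where g: "g \<in> carrier G" "\<forall>k\<in>J. inv g \<otimes> k \<otimes> g \<in> L" using U(2)[OF JG] by fastforce
    \<comment> \<open>The conjugate of \<open>J\<close> in \<open>L\<close> consists of elements
      with order dividing \<open>card J\<close>, prime to p; all such elements of \<open>L\<close>
      lie in \<open>H\<close>.\<close>
    have "inv g \<otimes> k \<otimes> g \<in> H" if k: "k \<in> J" for k
    proof (rule L(5)[OF _ pJ])
      show "inv g \<otimes> k \<otimes> g \<in> L" using g k by blast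
      have kG: "k \<in> carrier G" using k JG by blast
      have "(inv g \<otimes> k \<otimes> g) [^] m = inv g \<otimes> k [^] m \<otimes> g" for m :: nat
        using g(1) kG by (induction m) (simp_all add: m_assoc inv_mult_cancel)
      moreover have "k [^] card J = \<one>"
      proof -
        interpret K: group "G\<lparr>carrier := J\<rparr>" by (rule subgroup.subgroup_is_group[OF J is_group])
        have "k [^]\<^bsub>G\<lparr>carrier := J\<rparr>\<^esub> order (G\<lparr>carrier := J\<rparr>) = \<one>\<^bsub>G\<lparr>carrier := J\<rparr>\<^esub>"
          by (rule K.pow_order_eq_1) (use k in simp)
        thus ?thesis by (simp add: order_def nat_pow_consistent[symmetric])
      qed
      ultimately show "(inv g \<otimes> k \<otimes> g) [^] card J = \<one>" using g(1) by simp
    qed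
    thus False using conj_class_eq_if_subconj[OF fin H J le g(1)] ne by blast
  qed
qed

lemma p_congruent_dvd_card:
  assumes fin: "finite (carrier G)" and p: "prime p" "\<not> p\<^sup>2 dvd order G"
    and H: "subgroup H G" and J: "subgroup J G" and ne: "conj_class G H \<noteq> conj_class G J"
    and cong: "\<And>a. a \<in> carrier (burnside_ring G) \<Longrightarrow> [mark G H a = mark G J a] (mod int p)"
  shows "p dvd card H \<longleftrightarrow> \<not> p dvd card J"
proof (cases "card H \<le> card J")
  case True
  thus ?thesis using p_congruent_card[OF fin p H J ne cong] by blast
next
  case False
  hence le: "card J \<le> card H" by simp
  have "[mark G J a = mark G H a] (mod int p)" if "a \<in> carrier (burnside_ring G)" for a
    using cong[OF that] by (rule cong_sym)
  from p_congruent_card[OF fin p J H ne[symmetric] this le] show ?thesis by blast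
qed

end

section \<open>The equivalence classes and their Ext groups\<close>

lemma mark_module_eq: "mark_module G H = int_module (mark G H)"
  by (simp add: mark_module_def int_module_def)

context group begin

lemma int_character_mark:
  assumes "H \<subseteq> carrier G"
  shows "int_character (burnside_ring G) (mark G H)"
proof -
  interpret B: cring "burnside_ring G" by (rule cring_burnside_ring)
  show ?thesis
    by unfold_locales
      (use ring_hom_mult[OF mark_ring_hom[OF assms]] ring_hom_add[OF mark_ring_hom[OF assms]]
         ring_hom_one[OF mark_ring_hom[OF assms]] in auto)
qed

text \<open>Unlike divisibility of \<open>mark_modulus\<close>, this makes sense for conjugate
  subgroups too and is directly seen to be an equivalence relation.\<close>

definition p_cong :: "nat \<Rightarrow> 'a set \<Rightarrow> 'a set \<Rightarrow> bool" where
  "p_cong p H J \<longleftrightarrow> (\<forall>a\<in>carrier (burnside_ring G). [mark G H a = mark G J a] (mod int p))"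

lemma p_cong_sym: "p_cong p H J \<Longrightarrow> p_cong p J H"
  unfolding p_cong_def using cong_sym by blast

lemma p_cong_trans: "p_cong p H J \<Longrightarrow> p_cong p J K \<Longrightarrow> p_cong p H K"
  unfolding p_cong_def using cong_trans by blast

lemma p_cong_conj:
  assumes "H \<subseteq> carrier G" "J \<subseteq> carrier G" "conj_class G H = conj_class G J"
  shows "p_cong p H J"
  unfolding p_cong_def using mark_conj_class_cong[OF assms] by simp

text \<open>Valid moduli are bounded and closed under \<open>lcm\<close>, so the greatest one is a
  multiple of every other.\<close>

lemma dvd_mark_modulus_iff:
  assumes fin: "finite (carrier G)" and H: "subgroup H G" and J: "subgroup J G"
    and ne: "conj_class G H \<noteq> conj_class G J" and p: "p > 0"
  shows "p dvd mark_modulus G H J \<longleftrightarrow> p_cong p H J"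
proof -
  let ?Q = "\<lambda>d::nat. d > 0 \<and> (\<forall>a\<in>carrier (burnside_ring G). [mark G H a = mark G J a] (mod int d))"
  obtain a where a: "a \<in> carrier (burnside_ring G)" "mark G H a \<noteq> mark G J a"
    by (rule marks_separate[OF fin H J ne]) blast
  \<comment> \<open>A separating element bounds the moduli, so that \<open>GREATEST\<close> denotes
    an actual maximum.\<close>
  have b: "d \<le> nat \<bar>mark G H a - mark G J a\<bar>" if "?Q d" for d
  proof -
    have "int d dvd mark G H a - mark G J a" using that a(1) by (auto simp: cong_iff_dvd_diff)
    thus ?thesis using a(2) dvd_imp_le_int[of "mark G H a - mark G J a" "int d"] by auto
  qed
  define d where "d = mark_modulus G H J"
  have Qd: "?Q d" unfolding d_def mark_modulus_def
    by (rule GreatestI_nat[of ?Q 1, OF _ b]) auto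
  have max: "d' \<le> d" if "?Q d'" for d' unfolding d_def mark_modulus_def
    using that b by (intro Greatest_le_nat)
  show ?thesis unfolding d_def[symmetric]
  proof
    assume "p dvd d"
    thus "p_cong p H J" using Qd cong_dvd_modulus[of _ _ "int d" "int p"] by (simp add: p_cong_def)
  next
    assume "p_cong p H J"
    hence "?Q (lcm p d)" using Qd p
      by (auto simp: p_cong_def cong_iff_dvd_diff lcm_pos_nat simp flip: lcm_int_int_eq)
    hence "lcm p d \<le> d" by (rule max)
    moreover have "d dvd lcm p d" "lcm p d > 0" using Qd p by (auto simp: lcm_pos_nat)
    ultimately have "lcm p d = d" using dvd_imp_le[of d "lcm p d"] by linarith
    thus "p dvd d" by (metis dvd_lcm1)
  qed
qed

text \<open>\<open>p_rel\<close> chooses representatives existentially; invariance of marks under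
  conjugation makes the choice immaterial.\<close>

lemma p_rel_iff:
  assumes fin: "finite (carrier G)" and p: "p > 0" and H: "subgroup H G" and J: "subgroup J G"
  shows "(conj_class G H, conj_class G J) \<in> p_rel G p \<longleftrightarrow> p_cong p H J"
proof
  assume "(conj_class G H, conj_class G J) \<in> p_rel G p"
  then obtain H' J' where HJ: "conj_class G H = conj_class G H'" "conj_class G J = conj_class G J'"
    "subgroup H' G" "subgroup J' G"
    "conj_class G H' = conj_class G J' \<or> conj_class G H' \<noteq> conj_class G J' \<and> p dvd mark_modulus G H' J'"
    by (auto simp: p_rel_def)
  note S = subgroup.subset[OF H] subgroup.subset[OF J] subgroup.subset[OF HJ(3)] subgroup.subset[OF HJ(4)]
  have "p_cong p H' J'"
    using HJ(5) dvd_mark_modulus_iff[OF fin HJ(3,4) _ p] p_cong_conj[OF S(3,4)] by blast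
  thus "p_cong p H J"
    using p_cong_conj[OF S(1,3) HJ(1)] p_cong_conj[OF S(4,2) HJ(2)[symmetric]] p_cong_trans by blast
next
  assume "p_cong p H J"
  thus "(conj_class G H, conj_class G J) \<in> p_rel G p"
    using dvd_mark_modulus_iff[OF fin H J _ p] H J unfolding p_rel_def by blast
qed

lemma p_rel_Image:
  assumes fin: "finite (carrier G)" and p: "p > 0" and H: "subgroup H G"
  shows "p_rel G p `` {conj_class G H} = conj_class G ` {J. subgroup J G \<and> p_cong p H J}"
proof -
  have "(conj_class G H, C) \<in> p_rel G p \<Longrightarrow> \<exists>J. subgroup J G \<and> C = conj_class G J" for C
    by (auto simp: p_rel_def)
  thus ?thesis using p_rel_iff[OF fin p H] by blast
qed

text \<open>Three truth values cannot be pairwise different.\<close>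

lemma no_three_p_cong:
  assumes fin: "finite (carrier G)" and p: "prime p" "\<not> p\<^sup>2 dvd order G"
    and S: "subgroup H G" "subgroup J G" "subgroup K G"
    and c: "p_cong p H J" "p_cong p H K" and ne: "conj_class G H \<noteq> conj_class G J"
  shows "conj_class G K = conj_class G H \<or> conj_class G K = conj_class G J"
proof (rule ccontr)
  assume "\<not> ?thesis"
  moreover have "p_cong p J K" using p_cong_trans p_cong_sym c by blast
  ultimately have "p dvd card H \<longleftrightarrow> \<not> p dvd card J" "p dvd card H \<longleftrightarrow> \<not> p dvd card K"
    "p dvd card J \<longleftrightarrow> \<not> p dvd card K"
    using p_congruent_dvd_card[OF fin p] S c ne unfolding p_cong_def by metis+
  thus False by blast
qed

lemma p_class_pair:
  assumes fin: "finite (carrier G)" and p: "prime p" "\<not> p\<^sup>2 dvd order G"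
    and S: "subgroup H G" "subgroup J G"
    and c: "p_cong p H J" and ne: "conj_class G H \<noteq> conj_class G J"
  shows "p_rel G p `` {conj_class G H} = {conj_class G H, conj_class G J}"
proof -
  have "p_cong p H H" by (simp add: p_cong_def)
  moreover have "conj_class G K \<in> {conj_class G H, conj_class G J}" if "subgroup K G" "p_cong p H K" for K
    using no_three_p_cong[OF fin p S that(1) c that(2) ne] by blast
  ultimately show ?thesis
    unfolding p_rel_Image[OF fin prime_gt_0_nat[OF p(1)] S(1)] using S c by blast
qed

lemma p_class_quotientE:
  assumes "E \<in> ccs G // p_rel G p"
  obtains H where "subgroup H G" "E = p_rel G p `` {conj_class G H}"
  using assms by (auto simp: quotient_def ccs_def)

lemma p_class_card_le:
  assumes fin: "finite (carrier G)" and p: "prime p" "\<not> p\<^sup>2 dvd order G"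
    and E: "E \<in> ccs G // p_rel G p"
  shows "card E \<le> 2"
proof -
  obtain H where H: "subgroup H G" "E = p_rel G p `` {conj_class G H}" using E by (rule p_class_quotientE)
  show ?thesis
  proof (cases "\<exists>J. subgroup J G \<and> p_cong p H J \<and> conj_class G H \<noteq> conj_class G J")
    case True
    then obtain J where "subgroup J G" "p_cong p H J" "conj_class G H \<noteq> conj_class G J" by blast
    thus ?thesis using p_class_pair[OF fin p H(1)] H(2) by (simp add: card_insert_if)
  next
    case False
    hence "E \<subseteq> {conj_class G H}" unfolding H(2) p_rel_Image[OF fin prime_gt_0_nat[OF p(1)] H(1)] by blast
    hence "card E \<le> card {conj_class G H}" by (intro card_mono) auto
    thus ?thesis by simp
  qed
qed

lemma p_class_two_iff:
  assumes fin: "finite (carrier G)" and p: "prime p" "\<not> p\<^sup>2 dvd order G"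
    and H: "subgroup H G" and J: "subgroup J G"
  shows "(\<exists>E \<in> ccs G // p_rel G p. card E = 2 \<and> {conj_class G H, conj_class G J} = E) \<longleftrightarrow>
    conj_class G H \<noteq> conj_class G J \<and> p_cong p H J"
proof
  assume "conj_class G H \<noteq> conj_class G J \<and> p_cong p H J"
  hence "p_rel G p `` {conj_class G H} = {conj_class G H, conj_class G J}" "conj_class G H \<noteq> conj_class G J"
    using p_class_pair[OF fin p H J] by auto
  moreover have "p_rel G p `` {conj_class G H} \<in> ccs G // p_rel G p"
    using H by (intro quotientI) (auto simp: ccs_def)
  ultimately show "\<exists>E \<in> ccs G // p_rel G p. card E = 2 \<and> {conj_class G H, conj_class G J} = E"
    by (intro bexI[of _ "p_rel G p `` {conj_class G H}"]) auto
next
  assume "\<exists>E \<in> ccs G // p_rel G p. card E = 2 \<and> {conj_class G H, conj_class G J} = E"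
  hence E: "card {conj_class G H, conj_class G J} = 2" "{conj_class G H, conj_class G J} \<in> ccs G // p_rel G p"
    by auto
  note p0 = prime_gt_0_nat[OF p(1)]
  obtain K where K: "subgroup K G" "{conj_class G H, conj_class G J} = p_rel G p `` {conj_class G K}"
    using E(2) by (rule p_class_quotientE)
  have "(conj_class G K, conj_class G H) \<in> p_rel G p" "(conj_class G K, conj_class G J) \<in> p_rel G p"
    using K(2) by auto
  hence "p_cong p K H" "p_cong p K J" using p_rel_iff[OF fin p0 K(1)] H J by auto
  hence "p_cong p H J" using p_cong_trans p_cong_sym by blast
  thus "conj_class G H \<noteq> conj_class G J \<and> p_cong p H J" using E(1) by auto
qed

lemma p_class_two_mem_iff:
  assumes fin: "finite (carrier G)" and p: "prime p" "\<not> p\<^sup>2 dvd order G"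
    and H: "subgroup H G"
  shows "(\<exists>E \<in> ccs G // p_rel G p. card E = 2 \<and> conj_class G H \<in> E) \<longleftrightarrow>
    (\<exists>J. subgroup J G \<and> conj_class G H \<noteq> conj_class G J \<and> p_cong p H J)"
proof
  assume "\<exists>J. subgroup J G \<and> conj_class G H \<noteq> conj_class G J \<and> p_cong p H J"
  then obtain J where J: "subgroup J G" "conj_class G H \<noteq> conj_class G J \<and> p_cong p H J" by blast
  show "\<exists>E \<in> ccs G // p_rel G p. card E = 2 \<and> conj_class G H \<in> E"
    using p_class_two_iff[OF fin p H J(1), THEN iffD2, OF J(2)] by blast
next
  assume "\<exists>E \<in> ccs G // p_rel G p. card E = 2 \<and> conj_class G H \<in> E"
  then obtain E where E: "E \<in> ccs G // p_rel G p" "card E = 2" "conj_class G H \<in> E" by blast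
  obtain K where K: "subgroup K G" "E = p_rel G p `` {conj_class G K}" using E(1) by (rule p_class_quotientE)
  obtain C where C: "C \<noteq> conj_class G H" "E = {conj_class G H, C}"
    using E(2,3) by (auto simp: card_2_iff)
  have "C \<in> E" using C by blast
  then obtain J where J: "subgroup J G" "C = conj_class G J"
    unfolding K(2) p_rel_Image[OF fin prime_gt_0_nat[OF p(1)] K(1)] by blast
  have "conj_class G H \<noteq> conj_class G J \<and> p_cong p H J"
    using p_class_two_iff[OF fin p H J(1)] E(1,2) C(2) J(2) by blast
  thus "\<exists>J. subgroup J G \<and> conj_class G H \<noteq> conj_class G J \<and> p_cong p H J" using J(1) by blast
qed

section \<open>Elements of the Burnside ring with prescribed marks\<close>

lemma marks_eqI:
  assumes fin: "finite (carrier G)" and a: "a \<in> carrier (burnside_ring G)" "b \<in> carrier (burnside_ring G)"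
    and eq: "\<And>K. subgroup K G \<Longrightarrow> mark G K a = mark G K b"
  shows "a = b"
proof -
  interpret B: cring "burnside_ring G" by (rule cring_burnside_ring)
  have "a \<ominus>\<^bsub>burnside_ring G\<^esub> b = \<zero>\<^bsub>burnside_ring G\<^esub>"
  proof (rule marks_injective[OF fin])
    show "a \<ominus>\<^bsub>burnside_ring G\<^esub> b \<in> carrier (burnside_ring G)" using a by simp
    fix K assume K: "subgroup K G"
    interpret K: int_character "burnside_ring G" "mark G K" by (rule int_character_mark[OF subgroup.subset[OF K]])
    show "mark G K (a \<ominus>\<^bsub>burnside_ring G\<^esub> b) = 0"
      using a eq[OF K] by (simp add: B.minus_eq K.char_add K.char_neg)
  qed
  thus ?thesis using a by (simp add: B.minus_eq_iff)
qed

text \<open>Integer multiples of the unit have the same mark at every subgroup.\<close>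

lemma shift_mark:
  assumes a: "a \<in> carrier (burnside_ring G)"
  obtains b where "b \<in> carrier (burnside_ring G)" "\<And>K. K \<subseteq> carrier G \<Longrightarrow> mark G K b = mark G K a - n"
proof -
  interpret B: cring "burnside_ring G" by (rule cring_burnside_ring)
  obtain r where r: "r \<in> carrier (burnside_ring G)" "\<And>k. int_character (burnside_ring G) k \<Longrightarrow> k r = - n"
    using B.int_multipleE[of "- n"] by blast
  show thesis
    by (rule that[of "a \<oplus>\<^bsub>burnside_ring G\<^esub> r"])
      (use a r int_character_mark in \<open>auto simp: int_character.char_add[OF int_character_mark]\<close>)
qed

text \<open>An element whose marks at \<open>H\<close> and \<open>K\<close> are incongruent modulo p
  is shifted so that its mark at \<open>K\<close> becomes 0.\<close>

lemma not_p_cong_separate: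
  assumes K: "K \<subseteq> carrier G" and H: "H \<subseteq> carrier G" and nc: "\<not> p_cong p H K"
  obtains a where "a \<in> carrier (burnside_ring G)" "mark G K a = 0" "\<not> int p dvd mark G H a"
proof -
  obtain b where b: "b \<in> carrier (burnside_ring G)" "\<not> int p dvd mark G H b - mark G K b"
    using nc by (auto simp: p_cong_def cong_iff_dvd_diff)
  obtain a where "a \<in> carrier (burnside_ring G)" "\<And>L. L \<subseteq> carrier G \<Longrightarrow> mark G L a = mark G L b - mark G K b"
    by (rule shift_mark[OF b(1)]) blast
  thus thesis using that[of a] K H b by simp
qed

text \<open>A product of separating elements, one for each \<open>K\<close> not congruent to
  \<open>H\<close>; as p is prime, its mark at \<open>H\<close> stays prime to p.\<close>

lemma p_class_element:
  assumes fin: "finite (carrier G)" and p: "prime p" and H: "H \<subseteq> carrier G"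
  obtains e where "e \<in> carrier (burnside_ring G)" "\<not> int p dvd mark G H e"
    "\<And>K. K \<subseteq> carrier G \<Longrightarrow> \<not> p_cong p H K \<Longrightarrow> mark G K e = 0"
proof -
  interpret B: cring "burnside_ring G" by (rule cring_burnside_ring)
  interpret H: int_character "burnside_ring G" "mark G H" by (rule int_character_mark[OF H])
  \<comment> \<open>\<open>K\<close> ranges over subsets of the carrier rather than subgroups: the
    marks are characters there as well, and a finite group has only finitely many subsets.\<close>
  have "\<exists>e\<in>carrier (burnside_ring G). \<not> int p dvd mark G H e \<and> (\<forall>K\<in>S. mark G K e = 0)"
    if "finite S" "S \<subseteq> {K. K \<subseteq> carrier G \<and> \<not> p_cong p H K}" for S
    using that
  proof (induction S)
    case empty
    have "\<not> int p dvd 1" using prime_gt_1_nat[OF p] by simp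
    thus ?case by (intro bexI[of _ "\<one>\<^bsub>burnside_ring G\<^esub>"]) (simp_all add: H.char_one)
  next
    case (insert K S)
    from insert.prems have "S \<subseteq> {K. K \<subseteq> carrier G \<and> \<not> p_cong p H K}" by simp
    from insert.IH[OF this] obtain e where e: "e \<in> carrier (burnside_ring G)"
      "\<not> int p dvd mark G H e" "\<And>K. K \<in> S \<Longrightarrow> mark G K e = 0" by blast
    have K: "K \<subseteq> carrier G" "\<not> p_cong p H K" using insert.prems by auto
    obtain a where a: "a \<in> carrier (burnside_ring G)" "mark G K a = 0" "\<not> int p dvd mark G H a"
      by (rule not_p_cong_separate[OF K(1) H K(2)])
    have "\<not> int p dvd mark G H (a \<otimes>\<^bsub>burnside_ring G\<^esub> e)"
      using a e p by (simp add: H.char_mult prime_dvd_mult_iff)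
    moreover have "mark G K' (a \<otimes>\<^bsub>burnside_ring G\<^esub> e) = 0" if "K' \<in> insert K S" for K'
    proof -
      have "K' \<subseteq> carrier G" using that insert.prems by auto
      thus ?thesis using that a e by (auto simp: int_character.char_mult[OF int_character_mark])
    qed
    ultimately show ?case using a e by (intro bexI[of _ "a \<otimes>\<^bsub>burnside_ring G\<^esub> e"]) auto
  qed
  from this[of "{K. K \<subseteq> carrier G \<and> \<not> p_cong p H K}"] fin
  have "\<exists>e\<in>carrier (burnside_ring G). \<not> int p dvd mark G H e \<and>
      (\<forall>K\<in>{K. K \<subseteq> carrier G \<and> \<not> p_cong p H K}. mark G K e = 0)" by simp
  thus thesis using that by blast
qed

section \<open>Ext between the mark modules\<close>

lemma mark_Ext_eq: "mark_Ext G p H J l = Ext_p_part (burnside_ring G) p (mark G H) (mark G J) l"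
  by (simp add: mark_Ext_def mark_module_eq)

lemma mark_Ext_not_p_cong:
  assumes p: "prime p" and H: "H \<subseteq> carrier G" and J: "J \<subseteq> carrier G" and nc: "\<not> p_cong p H J" and l: "l \<ge> 1"
  shows "carrier (mark_Ext G p H J l) = {\<zero>\<^bsub>mark_Ext G p H J l\<^esub>}"
proof -
  obtain a where a: "a \<in> carrier (burnside_ring G)" "mark G H a = 0" "\<not> int p dvd mark G J a"
    using not_p_cong_separate[OF H J] nc p_cong_sym by blast
  show ?thesis unfolding mark_Ext_eq
    by (rule Ext_p_part_zeroI[OF int_character_mark[OF H] int_character_mark[OF J] p a l])
qed

lemma mark_Ext_singleton:
  assumes fin: "finite (carrier G)" and p: "prime p" and H: "subgroup H G"
    and single: "\<And>J. subgroup J G \<Longrightarrow> p_cong p H J \<Longrightarrow> conj_class G H = conj_class G J" and l: "l \<ge> 1"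
  shows "carrier (mark_Ext G p H H l) = {\<zero>\<^bsub>mark_Ext G p H H l\<^esub>}"
proof -
  interpret B: cring "burnside_ring G" by (rule cring_burnside_ring)
  have HG: "H \<subseteq> carrier G" by (rule subgroup.subset[OF H])
  obtain e where e: "e \<in> carrier (burnside_ring G)" "\<not> int p dvd mark G H e"
    "\<And>K. K \<subseteq> carrier G \<Longrightarrow> \<not> p_cong p H K \<Longrightarrow> mark G K e = 0"
    by (rule p_class_element[OF fin p HG]) blast
  show ?thesis unfolding mark_Ext_eq
  proof (rule Ext_p_part_self_zeroI[OF int_character_mark[OF HG] p e(1,2) _ l])
    fix a assume a: "a \<in> carrier (burnside_ring G)" "mark G H a = 0"
    show "e \<otimes>\<^bsub>burnside_ring G\<^esub> a = \<zero>\<^bsub>burnside_ring G\<^esub>"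
    proof (rule marks_injective[OF fin])
      show "e \<otimes>\<^bsub>burnside_ring G\<^esub> a \<in> carrier (burnside_ring G)" using e a by simp
      fix K assume K: "subgroup K G"
      have KG: "K \<subseteq> carrier G" by (rule subgroup.subset[OF K])
      \<comment> \<open>Outside the class \<open>e\<close> has mark 0; inside it \<open>K\<close> is
        conjugate to \<open>H\<close>, where \<open>a\<close> has mark 0.\<close>
      have "mark G K e = 0 \<or> mark G K a = 0"
        using e(3)[OF KG] single[OF K] mark_conj_class_cong[OF HG KG _ a(1)] a(2) by metis
      thus "mark G K (e \<otimes>\<^bsub>burnside_ring G\<^esub> a) = 0"
        using e a by (auto simp: int_character.char_mult[OF int_character_mark[OF KG]])
    qed
  qed
qed

text \<open>Supplies the data of \<open>paired_characters\<close>: \<open>a1\<close> and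
  \<open>a2\<close> are one separating element shifted to vanish at \<open>H\<close> or at
  \<open>J\<close>, and the factor \<open>e0\<close> removes all marks outside the class.\<close>

lemma mark_Ext_pair:
  assumes fin: "finite (carrier G)" and p: "prime p" "\<not> p\<^sup>2 dvd order G"
    and H: "subgroup H G" and J: "subgroup J G"
    and c: "p_cong p H J" and ne: "conj_class G H \<noteq> conj_class G J" and l: "l \<ge> 1"
  shows "odd l \<Longrightarrow> carrier (mark_Ext G p H H l) = {\<zero>\<^bsub>mark_Ext G p H H l\<^esub>}"
    and "even l \<Longrightarrow> add_monoid (mark_Ext G p H H l) \<cong> integer_mod_group p"
    and "odd l \<Longrightarrow> add_monoid (mark_Ext G p H J l) \<cong> integer_mod_group p"
    and "even l \<Longrightarrow> carrier (mark_Ext G p H J l) = {\<zero>\<^bsub>mark_Ext G p H J l\<^esub>}"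
proof -
  let ?B = "burnside_ring G"
  interpret B: cring ?B by (rule cring_burnside_ring)
  have HG: "H \<subseteq> carrier G" and JG: "J \<subseteq> carrier G" using H J subgroup.subset by auto
  interpret H: int_character ?B "mark G H" by (rule int_character_mark[OF HG])
  interpret J: int_character ?B "mark G J" by (rule int_character_mark[OF JG])
  obtain e0 where e0: "e0 \<in> carrier ?B" "\<not> int p dvd mark G H e0"
    "\<And>K. K \<subseteq> carrier G \<Longrightarrow> \<not> p_cong p H K \<Longrightarrow> mark G K e0 = 0"
    by (rule p_class_element[OF fin p(1) HG]) blast
  have dvd_iff: "int p dvd mark G H a \<longleftrightarrow> int p dvd mark G J a" if "a \<in> carrier ?B" for a
    using c that cong_dvd_iff by (auto simp: p_cong_def)
  obtain b where b: "b \<in> carrier ?B" "mark G H b - mark G J b dvd int (order G)"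
    by (rule marks_separate[OF fin H J ne]) blast
  have "int p dvd mark G H b - mark G J b" using c b(1) by (simp add: p_cong_def cong_iff_dvd_diff)
  then obtain n where n: "mark G H b - mark G J b = int p * n" by (auto elim: dvdE)
  \<comment> \<open>\<open>int p * n\<close> divides the group order, so a second factor p in it is
    excluded.\<close>
  have pn: "\<not> int p dvd n"
  proof
    assume "int p dvd n"
    hence "int p * int p dvd int p * n" by (rule mult_dvd_mono[OF dvd_refl])
    also have "int p * n dvd int (order G)" using b(2) n by simp
    finally have "int (p * p) dvd int (order G)" by simp
    hence "p * p dvd order G" unfolding int_dvd_int_iff .
    thus False using p(2) by (simp add: power2_eq_square)
  qed
  obtain a1 where a1: "a1 \<in> carrier ?B" "\<And>K. K \<subseteq> carrier G \<Longrightarrow> mark G K a1 = mark G K b - mark G H b"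
    by (rule shift_mark[OF b(1)]) blast
  obtain a2 where a2: "a2 \<in> carrier ?B" "\<And>K. K \<subseteq> carrier G \<Longrightarrow> mark G K a2 = mark G K b - mark G J b"
    by (rule shift_mark[OF b(1)]) blast
  have mult: "mark G K (x \<otimes>\<^bsub>?B\<^esub> y) = mark G K x * mark G K y"
    if "K \<subseteq> carrier G" "x \<in> carrier ?B" "y \<in> carrier ?B" for K x y
    using int_character.char_mult[OF int_character_mark[OF that(1)]] that by blast
  \<comment> \<open>By \<open>no_three_p_cong\<close> every subgroup congruent to \<open>H\<close>
    is conjugate to \<open>H\<close> or \<open>J\<close>, so equality has to be checked only at
    these two and outside the class.\<close>
  have eqI: "x = y"
    if xy: "x \<in> carrier ?B" "y \<in> carrier ?B" and hj: "mark G H x = mark G H y" "mark G J x = mark G J y"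
      and K: "\<And>K. K \<subseteq> carrier G \<Longrightarrow> \<not> p_cong p H K \<Longrightarrow> mark G K x = mark G K y" for x y
  proof (rule marks_eqI[OF fin xy])
    fix K assume "subgroup K G"
    hence KG: "K \<subseteq> carrier G" and KS: "subgroup K G" using subgroup.subset by auto
    show "mark G K x = mark G K y"
    proof (cases "p_cong p H K")
      case True
      from no_three_p_cong[OF fin p H J KS c True ne] show ?thesis
        using mark_conj_class_cong[OF KG HG] mark_conj_class_cong[OF KG JG] xy hj by metis
    qed (use K KG in blast)
  qed
  \<comment> \<open>\<open>r\<close> puts the cofactor \<open>n\<close> into \<open>?e\<close>. If
    \<open>a\<close> has marks 0 at \<open>H\<close> and \<open>int p * t\<close> at
    \<open>J\<close>, then \<open>e0\<close> times \<open>a\<close> has mark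
    \<open>mark G J e0 * int p * t\<close> at \<open>J\<close>; only after scaling by
    \<open>n\<close> is this the multiple by \<open>- t\<close> of the mark of
    \<open>?u\<close>.\<close>
  obtain r where r: "r \<in> carrier ?B" "\<And>k. int_character ?B k \<Longrightarrow> k r = n" using B.int_multipleE[of n] by blast
  let ?e = "r \<otimes>\<^bsub>?B\<^esub> e0" and ?u = "a1 \<otimes>\<^bsub>?B\<^esub> e0" and ?v = "a2 \<otimes>\<^bsub>?B\<^esub> e0"
  let ?\<mu> = "- n * mark G J e0" and ?\<nu> = "n * mark G H e0"
  note rK = r(2)[OF int_character_mark]
  note simps = mult HG JG rK a1 a2 e0(1,3) r(1)
  interpret paired_characters ?B "mark G H" "mark G J" p ?e ?u ?v ?\<mu> ?\<nu>
  proof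
    show "prime p" by (rule p(1))
    show "?e \<in> carrier ?B" "?u \<in> carrier ?B" "?v \<in> carrier ?B" using r a1 a2 e0 by auto
    show "[mark G H a = mark G J a] (mod int p)" if "a \<in> carrier ?B" for a using c that by (simp add: p_cong_def)
    show "\<not> int p dvd mark G H ?e" using pn e0 p(1) by (simp add: simps prime_dvd_mult_iff)
    show "mark G H ?u = 0" by (simp add: simps)
    show "mark G J ?u = int p * ?\<mu>" using n by (simp add: simps algebra_simps)
    show "\<not> int p dvd ?\<mu>" using pn e0 p(1) dvd_iff[OF e0(1)] by (simp add: prime_dvd_mult_iff)
    show "mark G J ?v = 0" by (simp add: simps)
    show "mark G H ?v = int p * ?\<nu>" using n by (simp add: simps algebra_simps)
    show "\<not> int p dvd ?\<nu>" using pn e0 p(1) by (simp add: prime_dvd_mult_iff)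
    show "?u \<otimes>\<^bsub>?B\<^esub> ?v = \<zero>\<^bsub>?B\<^esub>"
      by (rule eqI) (simp_all add: simps H.char_zero J.char_zero int_character.char_zero[OF int_character_mark])
  next
    fix a assume a: "a \<in> carrier ?B" "mark G H a = 0"
    obtain t where t: "mark G J a = int p * t" using dvd_iff[OF a(1)] a(2) by (auto elim: dvdE)
    obtain s where s: "s \<in> carrier ?B" "\<And>k. int_character ?B k \<Longrightarrow> k s = - t" using B.int_multipleE[of "- t"] by blast
    have "?e \<otimes>\<^bsub>?B\<^esub> a = ?u \<otimes>\<^bsub>?B\<^esub> s"
    proof (rule eqI)
      have "mark G J (?e \<otimes>\<^bsub>?B\<^esub> a) = n * mark G J e0 * (int p * t)"
        using a t r(1) e0(1) by (simp add: mult JG rK)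
      also have "\<dots> = mark G J ?u * - t" using n by (simp add: simps algebra_simps)
      also have "\<dots> = mark G J (?u \<otimes>\<^bsub>?B\<^esub> s)"
        using s(1) a1(1) e0(1) by (simp add: mult JG s(2)[OF J.int_character_axioms])
      finally show "mark G J (?e \<otimes>\<^bsub>?B\<^esub> a) = mark G J (?u \<otimes>\<^bsub>?B\<^esub> s)" .
    qed (use a s r a1 e0 in \<open>simp_all add: simps s(2)[OF int_character_mark]\<close>)
    thus "\<exists>c\<in>carrier ?B. ?e \<otimes>\<^bsub>?B\<^esub> a = ?u \<otimes>\<^bsub>?B\<^esub> c" using s(1) by blast
  next
    fix a assume a: "a \<in> carrier ?B" "mark G J a = 0"
    obtain t where t: "mark G H a = int p * t" using dvd_iff[OF a(1)] a(2) by (auto elim: dvdE)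
    obtain s where s: "s \<in> carrier ?B" "\<And>k. int_character ?B k \<Longrightarrow> k s = t" using B.int_multipleE[of t] by blast
    have "?e \<otimes>\<^bsub>?B\<^esub> a = ?v \<otimes>\<^bsub>?B\<^esub> s"
    proof (rule eqI)
      have "mark G H (?e \<otimes>\<^bsub>?B\<^esub> a) = n * mark G H e0 * (int p * t)"
        using a t r(1) e0(1) by (simp add: mult HG rK)
      also have "\<dots> = mark G H ?v * t" using n by (simp add: simps algebra_simps)
      also have "\<dots> = mark G H (?v \<otimes>\<^bsub>?B\<^esub> s)"
        using s(1) a2(1) e0(1) by (simp add: mult HG s(2)[OF H.int_character_axioms])
      finally show "mark G H (?e \<otimes>\<^bsub>?B\<^esub> a) = mark G H (?v \<otimes>\<^bsub>?B\<^esub> s)" .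
    qed (use a s r a2 e0 in \<open>simp_all add: simps s(2)[OF int_character_mark]\<close>)
    thus "\<exists>c\<in>carrier ?B. ?e \<otimes>\<^bsub>?B\<^esub> a = ?v \<otimes>\<^bsub>?B\<^esub> c" using s(1) by blast
  qed
  note E = Ext_p_part_pair[OF l]
  show "odd l \<Longrightarrow> carrier (mark_Ext G p H H l) = {\<zero>\<^bsub>mark_Ext G p H H l\<^esub>}"
    "even l \<Longrightarrow> add_monoid (mark_Ext G p H H l) \<cong> integer_mod_group p"
    "odd l \<Longrightarrow> add_monoid (mark_Ext G p H J l) \<cong> integer_mod_group p"
    "even l \<Longrightarrow> carrier (mark_Ext G p H J l) = {\<zero>\<^bsub>mark_Ext G p H J l\<^esub>}"
    unfolding mark_Ext_eq by (fact E)+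
qed

end

lemma iso_integer_mod_group_nontrivial:
  assumes "add_monoid M \<cong> integer_mod_group p" "p > 1"
  shows "carrier M \<noteq> {z}"
proof
  assume M: "carrier M = {z}"
  obtain f where "bij_betw f (carrier M) {0..<int p}"
    using assms by (auto simp: is_iso_def iso_def carrier_integer_mod_group)
  hence "card {0..<int p} = 1" using bij_betw_same_card M by fastforce
  thus False using assms(2) by simp
qed

theorem corollary19:
  fixes G :: "('g, 'a) monoid_scheme" and p :: nat
  assumes "group G" and "finite (carrier G)"
    and "prime p" and "p dvd order G" and "\<not> p\<^sup>2 dvd order G"
  shows
    "(\<forall>E \<in> ccs G // p_rel G p. card E \<le> 2) \<and>
     (\<forall>H. subgroup H G \<longrightarrow>
        ((\<exists>l\<ge>1. carrier (mark_Ext G p H H l) \<noteq> {\<zero>\<^bsub>mark_Ext G p H H l\<^esub>}) \<longleftrightarrow>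
         (\<exists>E \<in> ccs G // p_rel G p. card E = 2 \<and> conj_class G H \<in> E))) \<and>
     (\<forall>H J. subgroup H G \<longrightarrow> subgroup J G \<longrightarrow> conj_class G H \<noteq> conj_class G J \<longrightarrow>
        ((\<exists>l\<ge>1. carrier (mark_Ext G p H J l) \<noteq> {\<zero>\<^bsub>mark_Ext G p H J l\<^esub>}) \<longleftrightarrow>
         (\<exists>E \<in> ccs G // p_rel G p. card E = 2 \<and> {conj_class G H, conj_class G J} = E))) \<and>
     (\<forall>H. subgroup H G \<longrightarrow>
        (\<exists>E \<in> ccs G // p_rel G p. card E = 2 \<and> conj_class G H \<in> E) \<longrightarrow>
        (\<forall>l\<ge>1.
          (odd l \<longrightarrow> carrier (mark_Ext G p H H l) = {\<zero>\<^bsub>mark_Ext G p H H l\<^esub>}) \<and>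
          (even l \<longrightarrow> add_monoid (mark_Ext G p H H l) \<cong> integer_mod_group p))) \<and>
     (\<forall>H J. subgroup H G \<longrightarrow> subgroup J G \<longrightarrow>
        (\<exists>E \<in> ccs G // p_rel G p. card E = 2 \<and> {conj_class G H, conj_class G J} = E) \<longrightarrow>
        (\<forall>l\<ge>1.
          (odd l \<longrightarrow> add_monoid (mark_Ext G p H J l) \<cong> integer_mod_group p) \<and>
          (even l \<longrightarrow> carrier (mark_Ext G p H J l) = {\<zero>\<^bsub>mark_Ext G p H J l\<^esub>})))"
proof -
  interpret group G by fact
  note fin = assms(2) and p = assms(3,5)
  have p1: "p > 1" using assms(3) by (rule prime_gt_1_nat)
  note two = p_class_two_iff[OF fin p] and two_mem = p_class_two_mem_iff[OF fin p]
  note pair = mark_Ext_pair[OF fin p]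
  show ?thesis
  proof (intro conjI allI impI ballI)
    show "card E \<le> 2" if "E \<in> ccs G // p_rel G p" for E by (rule p_class_card_le[OF fin p that])
  next
    fix H assume H: "subgroup H G"
    show "(\<exists>l\<ge>1. carrier (mark_Ext G p H H l) \<noteq> {\<zero>\<^bsub>mark_Ext G p H H l\<^esub>}) \<longleftrightarrow>
         (\<exists>E \<in> ccs G // p_rel G p. card E = 2 \<and> conj_class G H \<in> E)"
      unfolding two_mem[OF H]
    proof
      assume "\<exists>l\<ge>1. carrier (mark_Ext G p H H l) \<noteq> {\<zero>\<^bsub>mark_Ext G p H H l\<^esub>}"
      thus "\<exists>J. subgroup J G \<and> conj_class G H \<noteq> conj_class G J \<and> p_cong p H J"
        using mark_Ext_singleton[OF fin assms(3) H] by blast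
    next
      assume "\<exists>J. subgroup J G \<and> conj_class G H \<noteq> conj_class G J \<and> p_cong p H J"
      then obtain J where J: "subgroup J G" "conj_class G H \<noteq> conj_class G J" "p_cong p H J" by blast
      \<comment> \<open>2 is the first even degree, where the p-part is cyclic of order p.\<close>
      have "carrier (mark_Ext G p H H 2) \<noteq> {\<zero>\<^bsub>mark_Ext G p H H 2\<^esub>}"
        by (rule iso_integer_mod_group_nontrivial[OF pair(2)[OF H J(1,3,2)] p1]) simp_all
      thus "\<exists>l\<ge>1. carrier (mark_Ext G p H H l) \<noteq> {\<zero>\<^bsub>mark_Ext G p H H l\<^esub>}"
        by (intro exI[of _ 2]) simp
    qed
  next
    fix H J assume H: "subgroup H G" and J: "subgroup J G" and ne: "conj_class G H \<noteq> conj_class G J"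
    have HG: "H \<subseteq> carrier G" and JG: "J \<subseteq> carrier G" using H J subgroup.subset by auto
    show "(\<exists>l\<ge>1. carrier (mark_Ext G p H J l) \<noteq> {\<zero>\<^bsub>mark_Ext G p H J l\<^esub>}) \<longleftrightarrow>
         (\<exists>E \<in> ccs G // p_rel G p. card E = 2 \<and> {conj_class G H, conj_class G J} = E)"
      unfolding two[OF H J]
    proof
      assume "\<exists>l\<ge>1. carrier (mark_Ext G p H J l) \<noteq> {\<zero>\<^bsub>mark_Ext G p H J l\<^esub>}"
      thus "conj_class G H \<noteq> conj_class G J \<and> p_cong p H J"
        using mark_Ext_not_p_cong[OF assms(3) HG JG] ne by blast
    next
      assume "conj_class G H \<noteq> conj_class G J \<and> p_cong p H J"
      hence c: "p_cong p H J" by blast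
      \<comment> \<open>For distinct classes the odd degrees are nonzero, so degree 1 serves as
        witness.\<close>
      have "carrier (mark_Ext G p H J 1) \<noteq> {\<zero>\<^bsub>mark_Ext G p H J 1\<^esub>}"
        by (rule iso_integer_mod_group_nontrivial[OF pair(3)[OF H J c ne] p1]) simp_all
      thus "\<exists>l\<ge>1. carrier (mark_Ext G p H J l) \<noteq> {\<zero>\<^bsub>mark_Ext G p H J l\<^esub>}"
        by (intro exI[of _ 1]) simp
    qed
  next
    fix H l assume H: "subgroup H G" and l: "(1::nat) \<le> l"
      and E: "\<exists>E \<in> ccs G // p_rel G p. card E = 2 \<and> conj_class G H \<in> E"
    obtain J where J: "subgroup J G" "conj_class G H \<noteq> conj_class G J" "p_cong p H J"
      using E unfolding two_mem[OF H] by blast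
    show "carrier (mark_Ext G p H H l) = {\<zero>\<^bsub>mark_Ext G p H H l\<^esub>}" if "odd l"
      by (rule pair(1)[OF H J(1,3,2) l that])
    show "add_monoid (mark_Ext G p H H l) \<cong> integer_mod_group p" if "even l"
      by (rule pair(2)[OF H J(1,3,2) l that])
  next
    fix H J l assume H: "subgroup H G" and J: "subgroup J G" and l: "(1::nat) \<le> l"
      and E: "\<exists>E \<in> ccs G // p_rel G p. card E = 2 \<and> {conj_class G H, conj_class G J} = E"
    have c: "p_cong p H J" "conj_class G H \<noteq> conj_class G J" using E unfolding two[OF H J] by blast+
    show "add_monoid (mark_Ext G p H J l) \<cong> integer_mod_group p" if "odd l"
      by (rule pair(3)[OF H J c l that])
    show "carrier (mark_Ext G p H J l) = {\<zero>\<^bsub>mark_Ext G p H J l\<^esub>}" if "even l"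
      by (rule pair(4)[OF H J c l that])
  qed
qed

end
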